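(* Let $G=A_n$ or $S_n$, where $n\ge 5$. (i) If $a$ and $b$ are any generators of $G$ (that is, $G=\langle a,b\rangle$), then there is a presentation of $G$ using $2$ generators that map onto $a$ and $b$, and $9$ relations. (ii) There is a presentation of $G$ using $2$ generators and $8$ relations.
   Context: A presentation $\langle X\mid R\rangle$ has $|X|$ generators and $|R|$ relations. *)

theory Defs
  imports "HOL-Algebra.Sym_Groups"
begin

section \<open>Free groups\<close>

text \<open>The letter \<open>(x, True)\<close> is the generator \<open>x\<close>, and \<open>(x, False)\<close> is its formal inverse.
  The elements of the free group are the freely reduced words.\<close>

type_synonym 'x word = "('x \<times> bool) list"

definition inv_letter :: "'x \<times> bool \<Rightarrow> 'x \<times> bool"
  where "inv_letter l = (fst l, \<not> snd l)"

fun reduced :: "'x word \<Rightarrow> bool" where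
  "reduced [] \<longleftrightarrow> True"
| "reduced [l] \<longleftrightarrow> True"
| "reduced (l # m # w) \<longleftrightarrow> m \<noteq> inv_letter l \<and> reduced (m # w)"

fun push_letter :: "'x \<times> bool \<Rightarrow> 'x word \<Rightarrow> 'x word" where
  "push_letter l [] = [l]"
| "push_letter l (m # w) = (if m = inv_letter l then w else l # m # w)"

definition free_reduce :: "'x word \<Rightarrow> 'x word"
  where "free_reduce w = foldr push_letter w []"

definition free_group :: "'x set \<Rightarrow> 'x word monoid"
  where "free_group X =
    \<lparr> carrier = {w. reduced w \<and> fst ` set w \<subseteq> X},
      mult = (\<lambda>u v. free_reduce (u @ v)),
      one = [] \<rparr>"

lemma inv_letter_simps [simp]:
  "inv_letter (inv_letter l) = l" "fst (inv_letter l) = fst l" "inv_letter l \<noteq> l"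
  by (auto simp: inv_letter_def prod_eq_iff)

lemma reduced_ConsD: "reduced (l # w) \<Longrightarrow> reduced w"
  by (cases w) auto

lemma reduced_push_letter: "reduced w \<Longrightarrow> reduced (push_letter l w)"
  by (cases w) (auto dest: reduced_ConsD)

lemma reduced_foldr_push: "reduced v \<Longrightarrow> reduced (foldr push_letter u v)"
  by (induction u) (auto intro: reduced_push_letter)

lemma reduced_free_reduce: "reduced (free_reduce w)"
  by (simp add: free_reduce_def reduced_foldr_push)

lemma free_reduce_reduced: "reduced w \<Longrightarrow> free_reduce w = w"
  by (induction w rule: reduced.induct) (auto simp: free_reduce_def)

lemma letters_push_letter: "fst ` set (push_letter l w) \<subseteq> insert (fst l) (fst ` set w)"
  by (cases w) auto

lemma letters_free_reduce: "fst ` set (free_reduce w) \<subseteq> fst ` set w"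
proof (induction w)
  case (Cons l w)
  then show ?case
    using subset_trans[OF letters_push_letter[of l "free_reduce w"] insert_mono]
    by (simp add: free_reduce_def)
qed (simp add: free_reduce_def)

lemma push_letter_inv: "reduced v \<Longrightarrow> push_letter l (push_letter (inv_letter l) v) = v"
proof (cases v)
  case (Cons m w)
  assume "reduced v"
  then show ?thesis
    using Cons by (cases w) auto
qed simp

lemma foldr_push_push:
  assumes "reduced w" "reduced v"
  shows "foldr push_letter (push_letter l w) v = push_letter l (foldr push_letter w v)"
proof (cases w)
  case (Cons m w')
  then show ?thesis
    using assms push_letter_inv[OF reduced_foldr_push, of v l w'] by auto
qed simp

lemma foldr_push_free_reduce:
  "reduced v \<Longrightarrow> foldr push_letter (free_reduce u) v = foldr push_letter u v"
proof (induction u)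
  case (Cons l u)
  have "free_reduce (l # u) = push_letter l (free_reduce u)"
    by (simp add: free_reduce_def)
  with Cons show ?case
    by (simp add: foldr_push_push reduced_free_reduce)
qed (simp add: free_reduce_def)

lemma free_reduce_append: "free_reduce (u @ v) = foldr push_letter u (free_reduce v)"
  by (simp add: free_reduce_def)

lemma free_reduce_append_left: "free_reduce (free_reduce u @ v) = free_reduce (u @ v)"
  by (simp add: free_reduce_append foldr_push_free_reduce reduced_free_reduce)

lemma free_reduce_append_right: "free_reduce (u @ free_reduce v) = free_reduce (u @ v)"
  by (simp add: free_reduce_append free_reduce_reduced reduced_free_reduce)

lemma free_reduce_inverse: "free_reduce (rev (map inv_letter w) @ w) = []"
proof (induction w)
  case (Cons l w)
  have "push_letter (inv_letter l) (push_letter l (free_reduce w)) = free_reduce w"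
    using push_letter_inv[of "free_reduce w" "inv_letter l"] by (simp add: reduced_free_reduce)
  with Cons show ?case
    by (simp add: free_reduce_def)
qed (simp add: free_reduce_def)

lemma group_free_group: "group (free_group X)"
proof (rule groupI)
  fix u v w
  assume u: "u \<in> carrier (free_group X)" and v: "v \<in> carrier (free_group X)"
  show "u \<otimes>\<^bsub>free_group X\<^esub> v \<in> carrier (free_group X)"
    using u v subset_trans[OF letters_free_reduce[of "u @ v"], of X]
    by (simp add: free_group_def reduced_free_reduce image_Un)
  show "u \<otimes>\<^bsub>free_group X\<^esub> v \<otimes>\<^bsub>free_group X\<^esub> w = u \<otimes>\<^bsub>free_group X\<^esub> (v \<otimes>\<^bsub>free_group X\<^esub> w)"
    by (simp add: free_group_def free_reduce_append_left free_reduce_append_right)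
next
  show "\<one>\<^bsub>free_group X\<^esub> \<in> carrier (free_group X)"
    by (simp add: free_group_def)
next
  fix u
  assume u: "u \<in> carrier (free_group X)"
  show "\<one>\<^bsub>free_group X\<^esub> \<otimes>\<^bsub>free_group X\<^esub> u = u"
    using u by (simp add: free_group_def free_reduce_reduced)
  let ?v = "free_reduce (rev (map inv_letter u))"
  have "fst ` set ?v \<subseteq> X"
    using subset_trans[OF letters_free_reduce[of "rev (map inv_letter u)"], of X] u
    by (simp add: free_group_def image_image)
  then show "\<exists>v \<in> carrier (free_group X). v \<otimes>\<^bsub>free_group X\<^esub> u = \<one>\<^bsub>free_group X\<^esub>"
    by (intro bexI[of _ ?v])
       (auto simp: free_group_def free_reduce_append_left free_reduce_inverse reduced_free_reduce)
qed

section \<open>Presentations\<close>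

definition normal_closure :: "('g, 'm) monoid_scheme \<Rightarrow> 'g set \<Rightarrow> 'g set"
  where "normal_closure F R = \<Inter> {N. N \<lhd> F \<and> R \<subseteq> N}"

lemma (in group) normal_normal_closure:
  assumes "R \<subseteq> carrier G"
  shows "normal_closure G R \<lhd> G"
proof -
  let ?S = "{N. N \<lhd> G \<and> R \<subseteq> N}"
  have ne: "carrier G \<in> ?S"
    using assms by (auto intro!: normal_invI subgroup_self)
  show ?thesis
    unfolding normal_closure_def
  proof (rule normal_invI)
    show "subgroup (\<Inter> ?S) G"
      using ne by (intro subgroups_Inter) (auto intro: normal_imp_subgroup)
    show "g \<otimes> h \<otimes> inv g \<in> \<Inter> ?S" if "g \<in> carrier G" "h \<in> \<Inter> ?S" for g h
      using that by (auto intro: normal.inv_op_closed2)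
  qed
qed

text \<open>A relation is given by its relator, an element of the free group on the generators; a
  relation \<open>u = v\<close> is the relator \<open>u v\<^sup>-\<^sup>1\<close>.\<close>

definition presented_group :: "'x set \<Rightarrow> 'x word set \<Rightarrow> 'x word set monoid"
  where "presented_group X R = free_group X Mod normal_closure (free_group X) R"

definition presented_generator :: "'x set \<Rightarrow> 'x word set \<Rightarrow> 'x \<Rightarrow> 'x word set"
  where "presented_generator X R x =
    normal_closure (free_group X) R #>\<^bsub>free_group X\<^esub> [(x, True)]"

definition is_presentation ::
    "('g, 'm) monoid_scheme \<Rightarrow> 'x set \<Rightarrow> 'x word set \<Rightarrow> bool"
  where "is_presentation G X R \<longleftrightarrow>
    R \<subseteq> carrier (free_group X) \<and> presented_group X R \<cong> G"

definition is_presentation_via ::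
    "('g, 'm) monoid_scheme \<Rightarrow> 'x set \<Rightarrow> 'x word set \<Rightarrow> ('x \<Rightarrow> 'g) \<Rightarrow> bool"
  where "is_presentation_via G X R f \<longleftrightarrow>
    R \<subseteq> carrier (free_group X) \<and>
    (\<exists>\<phi> \<in> iso (presented_group X R) G. \<forall>x \<in> X. \<phi> (presented_generator X R x) = f x)"

end

theory Submission
  imports Defs "HOL-Number_Theory.Number_Theory" "HOL-Library.Discrete_Functions"
begin

text \<open>Carmichael's relations \<open>x\<^sub>i\<^sup>3 = (x\<^sub>i x\<^sub>j)\<^sup>2 = 1\<close> present an alternating group on its cycles
  \<open>(\<alpha> \<beta> i)\<close>, but their number grows with the degree. Choose a prime \<open>p\<close> with \<open>p + 2 \<le> n < 2p\<close>, which
  exists for \<open>n \<noteq> 6\<close>, and let \<open>u = (1 \<dots> p)\<close>, \<open>t = (p+1 \<dots> M)\<close> with \<open>M \<in> {n-1, n}\<close>, \<open>w = u t\<close> and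
  \<open>z = (p+1 n p)\<close>. The cycles \<open>u\<close> and \<open>t\<close> have coprime lengths and are therefore powers of \<open>w\<close>. The
  conjugates of \<open>z\<close> under \<open>u\<close> satisfy Carmichael's relations as soon as one pair of them does, since
  an element \<open>h\<close> that raises \<open>u\<close> to a primitive root modulo \<open>p\<close> and fixes or inverts \<open>z\<close> permutes the
  pairs; this gives the alternating group on \<open>1, \<dots>, p+1, n\<close> from a bounded number of relations. As
  \<open>n < 2p\<close>, a conjugate of it covers the support of \<open>t\<close>, and two more relations that tie \<open>t\<close> to these
  two groups imply Carmichael's relations for all \<open>n\<close> letters. The subgroup that they bound is normal,
  with a quotient generated by the image of \<open>w\<close>, in which \<open>u\<close> dies. The parity of \<open>M\<close> decides
  between the alternating and the symmetric group, and seven relators suffice. For \<open>n = 6\<close> the prime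
  \<open>3\<close> serves, where for the alternating group \<open>u\<close> and \<open>t\<close> are words in \<open>w\<close> and \<open>z\<close> instead of powers
  of \<open>w\<close>. Two more relators that express \<open>a\<close> and \<open>b\<close> by lifts of \<open>w\<close> and \<open>z\<close> give (i); in (ii) the seven
  relators are padded.\<close>

section \<open>Permutations\<close>

text \<open>All relators hold in the target, so the presented group maps onto it and only an upper
  bound on its order is missing. The same counting makes the map injective on the subgroup generated
  by the conjugates of \<open>z\<close>: Carmichael's relations bound its order, and its image is
  already that large. From then on an equation inside that subgroup, or inside a conjugate of it, is
  verified by computing permutations, which is why so few relators suffice. In the general case
  single relators do several jobs. The order of \<open>w\<close> gives the orders of
  \<open>u\<close> and \<open>t\<close>, their commuting and \<open>w = u t\<close>. The action of
  \<open>h\<close> on \<open>u\<close> spreads one pair relation over all pairs and later forces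
  \<open>u\<close> to die in the abelian quotient. Parity is the obstacle: multiplication by a
  primitive root is an odd permutation. In the alternating group it is corrected by the
  transposition of \<open>p + 1\<close> and \<open>n\<close>, and then \<open>h\<close> inverts
  \<open>z\<close>; in the symmetric group it is used as it stands and fixes \<open>z\<close>. An
  odd \<open>t\<close> lies in no conjugate of an alternating group, so there it is multiplied by a
  factor \<open>r\<close> above the transposition of \<open>p - 1\<close> and
  \<open>p\<close>.\<close>

definition Alt :: "nat set \<Rightarrow> (nat \<Rightarrow> nat) set"
  where "Alt S = {\<sigma>. \<sigma> permutes S \<and> evenperm \<sigma>}"

definition tri :: "nat \<Rightarrow> nat \<Rightarrow> nat \<Rightarrow> nat \<Rightarrow> nat"
  where "tri a b c = transpose a b \<circ> transpose b c"

text \<open>The guard \<open>a \<le> b\<close> in the second branch makes this the identity for an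
  empty interval.\<close>

definition cyc :: "nat \<Rightarrow> nat \<Rightarrow> nat \<Rightarrow> nat"
  where "cyc a b i = (if a \<le> i \<and> i < b then Suc i else if i = b \<and> a \<le> b then a else i)"

lemma AltD: "\<sigma> \<in> Alt S \<Longrightarrow> \<sigma> permutes S" "\<sigma> \<in> Alt S \<Longrightarrow> evenperm \<sigma>"
  by (simp_all add: Alt_def)

lemma Alt_mono: "S \<subseteq> S' \<Longrightarrow> Alt S \<subseteq> Alt S'"
  by (auto simp: Alt_def intro: permutes_subset)

lemma Alt_id: "id \<in> Alt S"
  by (simp add: Alt_def permutes_id)

lemma Alt_comp: "finite S \<Longrightarrow> \<sigma> \<in> Alt S \<Longrightarrow> \<tau> \<in> Alt S \<Longrightarrow> \<sigma> \<circ> \<tau> \<in> Alt S"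
  by (auto simp: Alt_def permutes_compose evenperm_comp permutes_imp_permutation)

lemma Alt_conj:
  assumes "finite S" "\<sigma> permutes S" "\<tau> \<in> Alt S"
  shows "\<sigma> \<circ> \<tau> \<circ> inv' \<sigma> \<in> Alt S"
  using assms by (auto simp: Alt_def permutes_compose permutes_inv evenperm_comp evenperm_inv
      permutes_imp_permutation permutation_compose permutation_inverse)

lemma tri_apply:
  "a \<noteq> b \<Longrightarrow> b \<noteq> c \<Longrightarrow> a \<noteq> c \<Longrightarrow>
    tri a b c x = (if x = a then b else if x = b then c else if x = c then a else x)"
  by (auto simp: tri_def transpose_def)

lemma tri_in_Alt: "a \<noteq> b \<Longrightarrow> b \<noteq> c \<Longrightarrow> a \<noteq> c \<Longrightarrow> {a, b, c} \<subseteq> S \<Longrightarrow> tri a b c \<in> Alt S"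
  by (auto simp: Alt_def tri_def evenperm_comp permutation_swap_id evenperm_swap
      intro!: permutes_compose permutes_swap_id)

lemma tri_conj: "inj \<sigma> \<Longrightarrow> \<sigma> \<circ> tri a b c = tri (\<sigma> a) (\<sigma> b) (\<sigma> c) \<circ> \<sigma>"
  by (auto simp: tri_def transpose_def fun_eq_iff inj_eq)

lemma tri_rotate: "a \<noteq> b \<Longrightarrow> b \<noteq> c \<Longrightarrow> a \<noteq> c \<Longrightarrow> tri b c a = tri a b c"
  by (auto simp: fun_eq_iff tri_apply)

lemma tri_comp_reverse: "a \<noteq> b \<Longrightarrow> b \<noteq> c \<Longrightarrow> a \<noteq> c \<Longrightarrow> tri a b c \<circ> tri b a c = id"
  by (auto simp: fun_eq_iff tri_apply)

lemma tri_pair: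
  "distinct [a, b, c, d] \<Longrightarrow> tri a b c \<circ> tri a b d \<circ> tri a b c \<circ> tri a b d = id"
  by (auto simp: fun_eq_iff tri_apply)

lemma tri_cube:
  "a \<noteq> b \<Longrightarrow> b \<noteq> c \<Longrightarrow> a \<noteq> c \<Longrightarrow> tri a b c \<circ> tri a b c \<circ> tri a b c = id"
  by (auto simp: fun_eq_iff tri_apply)

lemma subgroup_sym_groupD:
  assumes "subgroup K (sym_group n)"
  shows "id \<in> K" "\<sigma> \<in> K \<Longrightarrow> \<tau> \<in> K \<Longrightarrow> \<sigma> \<circ> \<tau> \<in> K" "\<sigma> \<in> K \<Longrightarrow> inv' \<sigma> \<in> K"
    "\<sigma> \<in> K \<Longrightarrow> \<sigma> permutes {1..n}"
proof -
  interpret K: subgroup K "sym_group n" by fact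
  show "id \<in> K" "\<sigma> \<in> K \<Longrightarrow> \<tau> \<in> K \<Longrightarrow> \<sigma> \<circ> \<tau> \<in> K"
    using K.one_closed K.m_closed[of \<sigma> \<tau>] by (simp_all add: sym_group_def)
  show "\<sigma> \<in> K \<Longrightarrow> \<sigma> permutes {1..n}" using K.subset by (auto simp: sym_group_carrier)
  show "inv' \<sigma> \<in> K" if "\<sigma> \<in> K"
    using K.m_inv_closed[OF that] K.subset that by auto
qed

text \<open>Induction on the letters besides \<open>a\<close> and \<open>b\<close>: an element of
  \<open>K\<close> brings the image of the last letter \<open>m\<close> back to \<open>m\<close>,
  and the product moves fewer letters. On \<open>a\<close> and \<open>b\<close> alone the only even
  permutation is the identity.\<close>

lemma Alt_subset_subgroup:
  assumes K: "subgroup K (sym_group n)" and "S \<subseteq> {1..n}" "a \<in> S" "b \<in> S" "a \<noteq> b"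
    and tri: "\<And>w. w \<in> S \<Longrightarrow> w \<noteq> a \<Longrightarrow> w \<noteq> b \<Longrightarrow> tri a b w \<in> K"
  shows "Alt S \<subseteq> K"
proof -
  note D = subgroup_sym_groupD[OF K]
  have "\<sigma> \<in> K" if "finite T" "T \<subseteq> S - {a, b}" "\<sigma> \<in> Alt (T \<union> {a, b})" for T \<sigma>
    using that
  proof (induction T arbitrary: \<sigma> rule: finite_induct)
    case empty
    then have "\<sigma> = id \<or> \<sigma> = transpose a b" "evenperm \<sigma>"
      by (auto simp: Alt_def permutes_doubleton_iff)
    then show ?case using D(1) \<open>a \<noteq> b\<close> by (auto simp: evenperm_swap)
  next
    case (insert m T)
    have m: "m \<noteq> a" "m \<noteq> b" "m \<in> S" "m \<notin> T" using insert by auto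
    have sub: "{a, b, m} \<subseteq> insert m T \<union> {a, b}" by auto
    have fin: "finite (insert m T \<union> {a, b})" using insert by simp
    note A = Alt_comp[OF fin]
    have t: "tri a b m \<in> K" "tri a b m \<in> Alt (insert m T \<union> {a, b})"
      using tri m \<open>a \<noteq> b\<close> by (auto intro!: tri_in_Alt)
    \<comment> \<open>Two applications of the cycle through \<open>a\<close>, \<open>b\<close>,
      \<open>m\<close> lead from \<open>a\<close> to \<open>m\<close>, one leads from
      \<open>b\<close> to \<open>m\<close>; from any other letter its own cycle first leads to
      \<open>a\<close>.\<close>
    have "\<exists>g \<in> K \<inter> Alt (insert m T \<union> {a, b}). g (\<sigma> m) = m"
    proof -
      have "\<sigma> m \<in> insert m T \<union> {a, b}"
        using permutes_in_image[OF AltD(1)[OF insert.prems(2)], of m] by simp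
      then consider "\<sigma> m = m" | "\<sigma> m = a" | "\<sigma> m = b" | "\<sigma> m \<in> T" by blast
      then show ?thesis
      proof cases
        case 1
        then show ?thesis using D(1) Alt_id by (intro bexI[of _ id]) auto
      next
        case 2
        then show ?thesis using t D(2) A m \<open>a \<noteq> b\<close>
          by (intro bexI[of _ "tri a b m \<circ> tri a b m"]) (auto simp: tri_apply)
      next
        case 3
        then show ?thesis using t m \<open>a \<noteq> b\<close> by (intro bexI[of _ "tri a b m"]) (auto simp: tri_apply)
      next
        case 4
        let ?j = "\<sigma> m"
        have j: "?j \<noteq> a" "?j \<noteq> b" "?j \<in> S" "?j \<noteq> m" using 4 insert m by auto
        have u: "tri a b ?j \<in> K" "tri a b ?j \<in> Alt (insert m T \<union> {a, b})"
          using tri j \<open>a \<noteq> b\<close> 4 by (auto intro!: tri_in_Alt)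
        show ?thesis using t u D(2) A m j \<open>a \<noteq> b\<close>
          by (intro bexI[of _ "tri a b m \<circ> tri a b m \<circ> tri a b ?j"]) (auto simp: tri_apply)
      qed
    qed
    then obtain g where g: "g \<in> K" "g \<in> Alt (insert m T \<union> {a, b})" "g (\<sigma> m) = m" by blast
    have "g \<circ> \<sigma> \<in> Alt (insert m T \<union> {a, b})" by (rule A[OF g(2) insert.prems(2)])
    then have "g \<circ> \<sigma> \<in> Alt (T \<union> {a, b})"
      using g(3) m permutes_superset[of "g \<circ> \<sigma>" "insert m T \<union> {a, b}" "T \<union> {a, b}"]
      by (auto simp: Alt_def)
    then have "g \<circ> \<sigma> \<in> K" using insert by auto
    then have "inv' g \<circ> (g \<circ> \<sigma>) \<in> K" by (rule D(2)[OF D(3)[OF g(1)]])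
    moreover have "inv' g \<circ> (g \<circ> \<sigma>) = \<sigma>"
      using permutes_inv_o(2)[OF AltD(1)[OF g(2)]] by (simp flip: comp_assoc)
    ultimately show ?case by (simp only:)
  qed
  moreover have "S - {a, b} \<union> {a, b} = S" "finite (S - {a, b})"
    using assms(2-4) finite_subset[OF assms(2)] by auto
  ultimately show ?thesis by (metis order_refl subsetI)
qed

text \<open>The cycles \<open>(1 w q)\<close> arise one after the other by multiplying with
  consecutive ones. In this form the conjugates of \<open>y\<close> under powers of \<open>u\<close>
  will appear.\<close>

lemma Alt_subset_subgroup_consecutive:
  assumes K: "subgroup K (sym_group n)" and "2 \<le> p" "p < q" "q \<le> n"
    and tri: "\<And>j. 1 \<le> j \<Longrightarrow> j < p \<Longrightarrow> tri j (Suc j) q \<in> K"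
  shows "Alt ({1..p} \<union> {q}) \<subseteq> K"
proof -
  note D = subgroup_sym_groupD[OF K]
  have "tri 1 w q \<in> K" if "2 \<le> w" "w \<le> p" for w
    using that
  proof (induction w rule: dec_induct)
    case base
    then show ?case using tri[of 1] \<open>2 \<le> p\<close> by (simp add: numeral_2_eq_2)
  next
    case (step w)
    have eq: "tri 1 (Suc w) q = tri w (Suc w) q \<circ> tri 1 w q"
      using step assms(3) by (auto simp: fun_eq_iff tri_apply)
    have "tri w (Suc w) q \<in> K" "tri 1 w q \<in> K" using step tri[of w] by auto
    then show ?case unfolding eq by (rule D(2))
  qed
  moreover have "tri q 1 w = tri 1 w q" if "2 \<le> w" "w \<le> p" for w
    using that tri_rotate[of q 1 w] assms(3) by simp
  ultimately have t: "tri q 1 w \<in> K" if "2 \<le> w" "w \<le> p" for w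
    using that by simp
  show ?thesis
  proof (rule Alt_subset_subgroup[OF K, of _ q 1])
    show "tri q 1 w \<in> K" if "w \<in> {1..p} \<union> {q}" "w \<noteq> q" "w \<noteq> 1" for w
      using that by (intro t) auto
  qed (use assms in auto)
qed

lemma card_Alt:
  assumes "finite S" "2 \<le> card S"
  shows "2 * card (Alt S) = fact (card S)"
proof -
  obtain a b where ab: "a \<in> S" "b \<in> S" "a \<noteq> b"
    using assms(2) by (metis card_le_Suc0_iff_eq[OF assms(1)] not_less_eq_eq numeral_2_eq_2)
  let ?t = "transpose a b"
  let ?O = "{\<sigma>. \<sigma> permutes S \<and> \<not> evenperm \<sigma>}"
  have t: "?t permutes S" "\<not> evenperm ?t" using ab by (auto simp: permutes_swap_id evenperm_swap)
  have tt: "?t \<circ> (?t \<circ> \<sigma>) = \<sigma>" for \<sigma> by (simp add: fun_eq_iff)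
  have "bij_betw (\<lambda>\<sigma>. ?t \<circ> \<sigma>) (Alt S) ?O"
    by (rule bij_betw_byWitness[where f' = "\<lambda>\<sigma>. ?t \<circ> \<sigma>"])
      (use t permutes_imp_permutation[OF assms(1)] in
        \<open>auto simp: tt Alt_def evenperm_comp permutes_compose\<close>)
  then have "card (Alt S) = card ?O" by (rule bij_betw_same_card)
  moreover have "{\<sigma>. \<sigma> permutes S} = Alt S \<union> ?O" by (auto simp: Alt_def)
  moreover have "finite (Alt S)" "finite ?O"
    using finite_permutations[OF assms(1)] by (auto intro: finite_subset simp: Alt_def)
  moreover have "Alt S \<inter> ?O = {}" by (auto simp: Alt_def)
  ultimately have "card {\<sigma>. \<sigma> permutes S} = 2 * card (Alt S)" by (simp add: card_Un_disjoint)
  then show ?thesis using card_permutations[OF refl assms(1)] by simp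
qed

section \<open>Parity and powers of the cycle on an interval\<close>

lemma cyc_permutes: "a \<le> b \<Longrightarrow> cyc a b permutes {a..b}"
proof (rule bij_imp_permutes)
  assume "a \<le> b"
  have "cyc a b ` {a..b} = {a..b}"
  proof
    show "{a..b} \<subseteq> cyc a b ` {a..b}"
    proof
      fix x assume "x \<in> {a..b}"
      then show "x \<in> cyc a b ` {a..b}"
        using \<open>a \<le> b\<close>
        by (cases "x = a") (auto simp: cyc_def image_iff intro!: bexI[of _ b] bexI[of _ "x - 1"])
    qed
  qed (auto simp: cyc_def)
  then show "bij_betw (cyc a b) {a..b} {a..b}"
    by (simp add: bij_betw_def finite_surj_inj)
qed (auto simp: cyc_def)

lemma cyc_Suc: "a \<le> b \<Longrightarrow> cyc a (Suc b) = cyc a b \<circ> transpose b (Suc b)"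
  by (auto simp: cyc_def fun_eq_iff transpose_def)

lemma evenperm_cyc: "a \<le> b \<Longrightarrow> evenperm (cyc a b) \<longleftrightarrow> even (b - a)"
proof (induction b rule: dec_induct)
  case base
  have "cyc a a = id" by (auto simp: cyc_def fun_eq_iff)
  then show ?case by simp
next
  case (step b)
  then have "evenperm (cyc a b \<circ> transpose b (Suc b)) \<longleftrightarrow> \<not> evenperm (cyc a b)"
    using permutes_imp_permutation[OF _ cyc_permutes[of a b]]
    by (subst evenperm_comp) (auto simp: permutation_swap_id evenperm_swap)
  with step show ?case by (simp only: cyc_Suc Suc_diff_le) simp
qed

lemma cyc_funpow:
  assumes "a \<le> x" "x \<le> b"
  shows "(cyc a b ^^ j) x = a + (x - a + j) mod (b - a + 1)"
proof (induction j)
  case 0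
  then show ?case using assms by simp
next
  case (Suc j)
  define m where "m = (x - a + j) mod (b - a + 1)"
  have m: "m < b - a + 1" unfolding m_def by simp
  have "(x - a + Suc j) mod (b - a + 1) = (Suc m) mod (b - a + 1)"
    unfolding m_def by (simp add: mod_Suc_eq)
  then show ?case using Suc m assms unfolding m_def[symmetric]
    by (cases "m = b - a") (auto simp: cyc_def)
qed

lemma cyc_funpow_outside: "x < a \<or> b < x \<Longrightarrow> (cyc a b ^^ j) x = x"
  by (induction j) (auto simp: cyc_def)

lemma cyc_funpow_add: "a \<le> x \<Longrightarrow> x + j \<le> b \<Longrightarrow> (cyc a b ^^ j) x = x + j"
  by (simp add: cyc_funpow)

lemma cyc_funpow_length:
  assumes "a \<le> b"
  shows "cyc a b ^^ (b - a + 1) = id"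
proof (rule ext)
  fix x
  show "(cyc a b ^^ (b - a + 1)) x = id x"
  proof (cases "a \<le> x \<and> x \<le> b")
    case True
    then have "(cyc a b ^^ (b - a + 1)) x = a + (x - a + (b - a + 1)) mod (b - a + 1)"
      by (intro cyc_funpow) auto
    also have "\<dots> = a + (x - a) mod (b - a + 1)" by (simp only: mod_add_self2)
    also have "\<dots> = a + (x - a)" using True by (subst mod_less) auto
    also have "\<dots> = x" using True by simp
    finally show ?thesis by (simp only: id_apply)
  next
    case False
    then have "x < a \<or> b < x" by auto
    from cyc_funpow_outside[OF this] show ?thesis by (simp only: id_apply)
  qed
qed

section \<open>Three-cycles under conjugation by long cycles\<close>

lemma tri_conj_inv: "\<sigma> permutes S \<Longrightarrow> \<sigma> \<circ> tri a b c \<circ> inv' \<sigma> = tri (\<sigma> a) (\<sigma> b) (\<sigma> c)"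
  by (simp add: tri_conj permutes_inj comp_assoc permutes_inv_o)

lemma cyc_outside: "x < a \<or> b < x \<Longrightarrow> cyc a b x = x"
  by (auto simp: cyc_def)

lemma permutes_funpow: "\<sigma> permutes S \<Longrightarrow> \<sigma> ^^ j permutes S"
  by (induction j) (simp_all only: funpow.simps permutes_id permutes_compose)

text \<open>Conjugates of \<open>z\<close> under \<open>u\<close> give the cycles
  \<open>(p+1 n j)\<close> for all \<open>j \<le> p\<close>, hence the alternating group on
  \<open>p + 2\<close> letters. The cycle \<open>t\<close> fixes \<open>p\<close> and
  \<open>p - 1\<close> and carries \<open>p + 1\<close> through its support, which gives
  \<open>(p p-1 w)\<close> for the remaining \<open>w\<close>. The two long cycles need only act on
  \<open>K\<close>, so the result also covers subgroups made of conjugates of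
  \<open>z\<close>.\<close>

lemma Alt_subset_conj_closed:
  assumes K: "subgroup K (sym_group n)" and n: "3 \<le> p" "p + 2 \<le> n" and M: "M = n - 1 \<or> M = n"
    and z: "tri (p + 1) n p \<in> K"
    and u: "\<And>\<sigma>. \<sigma> \<in> K \<Longrightarrow> cyc 1 p \<circ> \<sigma> \<circ> inv' (cyc 1 p) \<in> K"
    and t: "\<And>\<sigma>. \<sigma> \<in> K \<Longrightarrow> cyc (p + 1) M \<circ> \<sigma> \<circ> inv' (cyc (p + 1) M) \<in> K"
  shows "Alt {1..n} \<subseteq> K"
proof -
  have cu: "cyc 1 p permutes {1..p}" using n by (intro cyc_permutes) simp
  have ct: "cyc (p + 1) M permutes {p + 1..M}" using n M by (intro cyc_permutes) auto
  have u': "tri (cyc 1 p a) (cyc 1 p b) (cyc 1 p c) \<in> K" if "tri a b c \<in> K" for a b c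
    using u[OF that] unfolding tri_conj_inv[OF cu] .
  have t': "tri (cyc (p + 1) M a) (cyc (p + 1) M b) (cyc (p + 1) M c) \<in> K" if "tri a b c \<in> K" for a b c
    using t[OF that] unfolding tri_conj_inv[OF ct] .
  have j: "tri (p + 1) n j \<in> K" if "1 \<le> j" "j \<le> p" for j
    using that
  proof (induction j rule: dec_induct)
    case base
    then show ?case using u'[OF z] n by (simp add: cyc_def)
  next
    case (step j)
    then show ?case using u'[of "p + 1" n j] n by (simp add: cyc_def)
  qed
  have Om: "Alt ({1..p + 1} \<union> {n}) \<subseteq> K"
    by (rule Alt_subset_subgroup[OF K, of _ "p + 1" n]) (use j n in auto)
  have A: "tri p (p - 1) (p + 1) \<in> K" "tri p (p - 1) n \<in> K"
    using n by (auto intro!: subsetD[OF Om] tri_in_Alt)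
  have i: "tri p (p - 1) w \<in> K" if "p + 1 \<le> w" "w \<le> M" for w
    using that
  proof (induction w rule: dec_induct)
    case base
    then show ?case using A by simp
  next
    case (step w)
    have "cyc (p + 1) M p = p" "cyc (p + 1) M (p - 1) = p - 1" "cyc (p + 1) M w = Suc w"
      using step by (auto simp: cyc_def)
    then show ?case using t'[of p "p - 1" w] step by simp
  qed
  show ?thesis
  proof (rule Alt_subset_subgroup[OF K, of _ p "p - 1"])
    fix w assume w: "w \<in> {1..n}" "w \<noteq> p" "w \<noteq> p - 1"
    then have "w \<in> {1..p} \<or> p + 1 \<le> w \<and> w \<le> M \<or> w = n" using M by auto
    moreover have "tri p (p - 1) w \<in> K" if "w \<in> {1..p}"
      using w n that by (intro subsetD[OF Om] tri_in_Alt) auto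
    ultimately show "tri p (p - 1) w \<in> K" using i A by blast
  qed (use n in auto)
qed

text \<open>The length \<open>2 * n - 1 - M\<close> is the one of \<open>n - 1\<close> and \<open>n\<close> that differs from \<open>M\<close>: the cycle
  then has the parity of \<open>cyc (p + 1) M\<close>, and agrees with it between \<open>p + 1\<close> and \<open>n - 2\<close>.\<close>

lemma turn_in_Alt:
  assumes "odd p" "p + 2 \<le> n" and M: "M = n - 1 \<or> M = n"
  shows "cyc 1 (2 * n - 1 - M) \<circ> inv' (cyc (p + 1) M) \<in> Alt ({1..p + 1} \<union> {n})"
proof -
  let ?c = "cyc 1 (2 * n - 1 - M)" and ?t = "cyc (p + 1) M"
  have le: "1 \<le> 2 * n - 1 - M" "2 * n - 1 - M \<le> n" "p + 1 \<le> M" "M \<le> n" using assms by auto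
  have c: "?c permutes {1..2 * n - 1 - M}" and t: "?t permutes {p + 1..M}"
    using le by (auto intro: cyc_permutes simp del: One_nat_def)
  have cn: "?c permutes {1..n}" by (rule permutes_subset[OF c]) (use le in auto)
  have tn: "?t permutes {1..n}" by (rule permutes_subset[OF t]) (use le in auto)
  have "?c \<circ> inv' ?t permutes {1..n}" using cn tn by (intro permutes_compose permutes_inv)
  moreover have "(?c \<circ> inv' ?t) x = x" if "x \<in> {1..n} - ({1..p + 1} \<union> {n})" for x
  proof -
    have x: "p + 1 < x" "x < n" using that by auto
    then have "?t (x - 1) = x" using M by (auto simp: cyc_def)
    then have "inv' ?t x = x - 1" using permutes_inverses(2)[OF t, of "x - 1"] by simp
    moreover have "?c (x - 1) = x" using x M by (auto simp: cyc_def)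
    ultimately show ?thesis by simp
  qed
  ultimately have "?c \<circ> inv' ?t permutes {1..p + 1} \<union> {n}" by (rule permutes_superset) auto
  moreover have "evenperm (?c \<circ> inv' ?t) \<longleftrightarrow> (evenperm ?c \<longleftrightarrow> evenperm ?t)"
    using permutes_imp_permutation[OF _ c] permutes_imp_permutation[OF _ t]
    by (simp add: evenperm_comp evenperm_inv permutation_inverse)
  moreover have "evenperm ?c \<longleftrightarrow> even (2 * n - 1 - M - 1)" using le by (intro evenperm_cyc)
  moreover have "evenperm ?t \<longleftrightarrow> even (M - (p + 1))" using le by (intro evenperm_cyc)
  moreover have "even (2 * n - 1 - M - 1) \<longleftrightarrow> even (M - (p + 1))"
    using assms by (auto simp: even_diff_nat)
  ultimately show ?thesis by (simp add: Alt_def)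
qed

text \<open>Outside the base set lie the \<open>k\<close> letters strictly between
  \<open>p + 1\<close> and \<open>n\<close>. The \<open>k\<close>-th power of the long cycle moves
  each of them above \<open>M\<close> or, after wrapping around, below \<open>p - 1\<close>, and
  there both factors are the identity. The condition \<open>k + 2 \<le> p\<close>, that is
  \<open>n \<le> 2 * p\<close>, is what keeps the wrapped letters below
  \<open>p - 1\<close>.\<close>

lemma window_in_Alt:
  assumes n: "3 \<le> p" "n = p + 2 + k" "k + 2 \<le> p" and M: "M = n - 1 \<or> M = n"
    and \<rho>: "\<rho> permutes {p - 1, p}" "evenperm (cyc (p + 1) M \<circ> \<rho>)"
  shows "inv' (cyc 1 (2 * n - 1 - M) ^^ k) \<circ> (cyc (p + 1) M \<circ> \<rho>) \<circ> cyc 1 (2 * n - 1 - M) ^^ k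
    \<in> Alt ({1..p + 1} \<union> {n})"
proof -
  let ?c = "cyc 1 (2 * n - 1 - M)" and ?\<tau> = "cyc (p + 1) M \<circ> \<rho>"
  let ?g = "?c ^^ k"
  have le: "1 \<le> 2 * n - 1 - M" "2 * n - 1 - M \<le> n" "p + 1 \<le> M" "M \<le> n" using assms by auto
  have c: "?c permutes {1..n}"
    using le by (intro permutes_subset[OF cyc_permutes]) auto
  have g: "?g permutes {1..n}" by (rule permutes_funpow[OF c])
  have t: "cyc (p + 1) M permutes {1..n}"
    using le by (intro permutes_subset[OF cyc_permutes]) auto
  have \<tau>: "?\<tau> permutes {1..n}"
    using n t by (intro permutes_compose permutes_subset[OF \<rho>(1)]) auto
  have "?\<tau> \<in> Alt {1..n}" using \<tau> \<rho>(2) by (simp add: Alt_def)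
  then have *: "inv' ?g \<circ> ?\<tau> \<circ> inv' (inv' ?g) \<in> Alt {1..n}"
    using g by (intro Alt_conj permutes_inv) auto
  moreover have "inv' (inv' ?g) = ?g" using g by (rule permutes_inv_inv)
  ultimately have A: "inv' ?g \<circ> ?\<tau> \<circ> ?g \<in> Alt {1..n}" by simp
  have fixed: "(inv' ?g \<circ> ?\<tau> \<circ> ?g) x = x" if "x \<in> {1..n} - ({1..p + 1} \<union> {n})" for x
  proof -
    have x: "p + 2 \<le> x" "x \<le> n - 1" using that by auto
    have "?g x = 1 + (x - 1 + k) mod (2 * n - 1 - M - 1 + 1)"
      using x M by (intro cyc_funpow) auto
    moreover have "2 * n - 1 - M - 1 + 1 = 2 * n - 1 - M" using le by simp
    ultimately have "?g x = 1 + (x - 1 + k) mod (2 * n - 1 - M)" by (simp only:)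
    moreover have "(x - 1 + k) mod (2 * n - 1 - M) =
        (if x - 1 + k < 2 * n - 1 - M then x - 1 + k else x - 1 + k - (2 * n - 1 - M))"
    proof (cases "x - 1 + k < 2 * n - 1 - M")
      case False
      then have "(x - 1 + k) mod (2 * n - 1 - M) = (x - 1 + k - (2 * n - 1 - M)) mod (2 * n - 1 - M)"
        by (intro le_mod_geq) simp
      also have "\<dots> = x - 1 + k - (2 * n - 1 - M)" using x n M by (intro mod_less) auto
      finally show ?thesis using False by simp
    qed simp
    ultimately have "?g x < p - 1 \<or> M < ?g x" using x n M by (simp only:) auto
    then have "\<rho> (?g x) = ?g x" "cyc (p + 1) M (?g x) = ?g x"
      using le by (auto intro!: permutes_not_in[OF \<rho>(1)] cyc_outside)
    then have "?\<tau> (?g x) = ?g x" by (simp only: comp_apply)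
    then show ?thesis using permutes_inverses(2)[OF g] by simp
  qed
  have "inv' ?g \<circ> ?\<tau> \<circ> ?g permutes {1..p + 1} \<union> {n}"
    by (rule permutes_superset[OF AltD(1)[OF A] fixed])
  then show ?thesis using AltD(2)[OF A] by (simp only: Alt_def mem_Collect_eq conj_absorb simp_thms)
qed

section \<open>Bertrand's postulate\<close>

text \<open>Legendre's formula; the sum may stop at \<open>K\<close> because higher powers of
  \<open>p\<close> exceed \<open>n\<close>.\<close>

lemma multiplicity_fact_prime:
  fixes p :: nat
  assumes "prime p" "n < p ^ Suc K"
  shows "multiplicity p (fact n :: nat) = (\<Sum>i=1..K. n div p ^ i)"
  using assms(2)
proof (induction n)
  case (Suc n)
  have p: "p > 1" using assms(1) prime_gt_1_nat by blast
  have "multiplicity p (Suc n) = card {i \<in> {1..K}. p ^ i dvd Suc n}"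
  proof -
    have "{i \<in> {1..K}. p ^ i dvd Suc n} = {1..multiplicity p (Suc n)}"
    proof -
      have "i \<le> K" if "p ^ i dvd Suc n" for i
      proof -
        have "p ^ i < p ^ Suc K" using dvd_imp_le[OF that] Suc.prems by simp
        then show ?thesis using p by (simp add: power_strict_increasing_iff less_Suc_eq_le del: power_Suc)
      qed
      moreover have "p ^ i dvd Suc n \<longleftrightarrow> i \<le> multiplicity p (Suc n)" for i
        using p by (intro power_dvd_iff_le_multiplicity) (auto simp: not_is_unit_0)
      ultimately show ?thesis by auto
    qed
    then show ?thesis by simp
  qed
  also have "\<dots> = (\<Sum>i=1..K. if p ^ i dvd Suc n then 1 else 0)"
    by (simp add: sum.If_cases Int_def)
  finally have m: "multiplicity p (Suc n) = (\<Sum>i=1..K. if p ^ i dvd Suc n then 1 else 0)" .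
  have "multiplicity p (fact (Suc n) :: nat) = multiplicity p (Suc n) + multiplicity p (fact n :: nat)"
    using assms(1) by (simp add: fact_Suc prime_elem_multiplicity_mult_distrib del: mult_Suc)
  also have "\<dots> = (\<Sum>i=1..K. (if p ^ i dvd Suc n then 1 else 0) + n div p ^ i)"
    using Suc by (simp add: m sum.distrib)
  also have "\<dots> = (\<Sum>i=1..K. Suc n div p ^ i)"
    by (intro sum.cong) (auto simp: div_Suc dvd_eq_mod_eq_0)
  finally show ?case .
qed simp

text \<open>By Legendre's formula the exponent is a sum of differences
  \<open>2 * N div p ^ i - 2 * (N div p ^ i)\<close>, each at most 1, over the \<open>i\<close> with
  \<open>p ^ i \<le> 2 * N\<close>. In the third claim \<open>3 \<le> p\<close> turns
  \<open>2 * N < 3 * p\<close> into \<open>2 * N < p\<^sup>2\<close>, so only \<open>i = 1\<close>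
  remains, with difference \<open>2 - 2\<close>.\<close>

lemma prime_power_central_binomial:
  fixes p :: nat
  assumes "prime p" "N > 0"
  shows "p ^ multiplicity p ((2 * N) choose N) \<le> 2 * N"
    and "2 * N < p\<^sup>2 \<Longrightarrow> multiplicity p ((2 * N) choose N) \<le> 1"
    and "2 * N < 3 * p \<Longrightarrow> p \<le> N \<Longrightarrow> 3 \<le> p \<Longrightarrow> multiplicity p ((2 * N) choose N) = 0"
proof -
  have p: "p > 1" using assms(1) prime_gt_1_nat by blast
  obtain L where L: "2 * N < p ^ Suc L" "p ^ L \<le> 2 * N"
    using ex_power_ivl1[of p "2 * N"] p assms(2) by auto
  have f: "fact (2 * N) = ((2 * N) choose N) * (fact N * fact N :: nat)"
    using binomial_fact_lemma[of N "2 * N"] by (simp add: mult_ac mult_2)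
  have eq: "multiplicity p (fact (2 * N) :: nat) = multiplicity p ((2 * N) choose N) + 2 * multiplicity p (fact N :: nat)"
    unfolding f using assms(1)
    by (subst prime_elem_multiplicity_mult_distrib; simp add: prime_elem_multiplicity_mult_distrib)+
  have m: "multiplicity p ((2 * N) choose N) = (\<Sum>i=1..L. 2 * N div p ^ i - 2 * (N div p ^ i))"
    if "2 * N < p ^ Suc L" for L
  proof -
    have "(\<Sum>i=1..L. 2 * N div p ^ i) = multiplicity p ((2 * N) choose N) + 2 * (\<Sum>i=1..L. N div p ^ i)"
      using eq multiplicity_fact_prime[OF assms(1), of "2 * N" L] multiplicity_fact_prime[OF assms(1), of N L] that
      by simp
    moreover have "2 * (N div q) \<le> 2 * N div q" for q
      by (metis div_mult2_eq div_times_less_eq_dividend less_eq_div_iff_mult_less_eq mult.assoc mult.commute mult_le_mono2 neq0_conv div_by_0 le0 mult_0_right)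
    ultimately show ?thesis
      by (subst sum_subtractf_nat) (auto simp: sum_distrib_left)
  qed
  have one: "2 * N div q - 2 * (N div q) \<le> 1" for q :: nat
  proof (cases "q = 0")
    case False
    have "N = q * (N div q) + N mod q" by simp
    moreover have "N mod q < q" using False by simp
    ultimately have "N < q * (N div q) + q" by linarith
    then have "2 * N < 2 * q * (N div q) + 2 * q" by simp
    then have "2 * N div q < 2 * (N div q) + 2"
      by (intro less_mult_imp_div_less) (simp add: algebra_simps)
    then show ?thesis by simp
  qed simp
  have le: "multiplicity p ((2 * N) choose N) \<le> L" if "2 * N < p ^ Suc L" for L
  proof -
    have "multiplicity p ((2 * N) choose N) \<le> (\<Sum>i=1..L. 1)"
      unfolding m[OF that] by (intro sum_mono one)
    then show ?thesis by simp
  qed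
  show "p ^ multiplicity p ((2 * N) choose N) \<le> 2 * N"
    using power_increasing[OF le[OF L(1)], of p] p L(2) by linarith
  show "2 * N < p\<^sup>2 \<Longrightarrow> multiplicity p ((2 * N) choose N) \<le> 1"
    using le[of 1] by (simp add: power2_eq_square)
  assume a: "2 * N < 3 * p" "p \<le> N" "3 \<le> p"
  have "2 * N < p\<^sup>2" using a(1) mult_le_mono1[OF a(3), of p] unfolding power2_eq_square by (rule less_le_trans)
  then have "multiplicity p ((2 * N) choose N) = 2 * N div p - 2 * (N div p)"
    using m[of 1] by (simp add: power2_eq_square)
  moreover have "N div p = 1" using a by (intro div_nat_eqI) auto
  moreover have "2 * N div p = 2" using a by (intro div_nat_eqI) auto
  ultimately show "multiplicity p ((2 * N) choose N) = 0" by simp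
qed

text \<open>The two middle coefficients of the row are equal, and the whole row sums to
  \<open>2 * 4 ^ m\<close>.\<close>

lemma central_binomial_odd_le: "(2 * m + 1) choose m \<le> 4 ^ m"
proof -
  have "((2 * m + 1) choose m) + ((2 * m + 1) choose (m + 1)) \<le> (\<Sum>k\<le>2*m+1. (2 * m + 1) choose k)"
    using sum_mono2[of "{..2*m+1}" "{m, m+1}" "\<lambda>k. (2 * m + 1) choose k"] by simp
  also have "\<dots> = 2 * 4 ^ m"
    by (subst choose_row_sum) (simp add: power_mult)
  finally show ?thesis
    using binomial_symmetric[of m "2 * m + 1"] by simp
qed

lemma four_power_le_central_binomial:
  assumes "N > 0"
  shows "4 ^ N \<le> 2 * N * ((2 * N) choose N)"
  using assms
proof (induction N rule: nat_induct_non_zero)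
  case (Suc N)
  have "(Suc N) * (2 * Suc N choose Suc N) = 2 * (2 * N + 1) * (2 * N choose N)"
  proof -
    have "Suc N * (2 * Suc N choose Suc N) = 2 * Suc N * (Suc (2 * N) choose N)"
      using Suc_times_binomial_eq[of "Suc (2 * N)" N] by (simp add: mult.commute del: binomial_Suc_Suc)
    also have "\<dots> = 2 * (Suc N * (Suc (2 * N) choose Suc N))"
      using binomial_symmetric[of "Suc N" "Suc (2 * N)"] by (simp del: binomial_Suc_Suc)
    also have "Suc N * (Suc (2 * N) choose Suc N) = Suc (2 * N) * (2 * N choose N)"
      using Suc_times_binomial_eq[of "2 * N" N] by (simp add: mult.commute del: binomial_Suc_Suc)
    finally show ?thesis by (simp del: binomial_Suc_Suc)
  qed
  then have "2 * Suc N * (2 * Suc N choose Suc N) = 4 * (2 * N + 1) * (2 * N choose N)"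
    by (simp only: mult.assoc)
  moreover have "4 * (2 * N * (2 * N choose N)) \<le> 4 * (2 * N + 1) * (2 * N choose N)"
    by (simp add: algebra_simps)
  ultimately show ?case using Suc.IH by (simp only: power_Suc)
qed simp

lemma prod_primes_dvd:
  fixes m :: nat
  assumes "finite A" "\<And>p. p \<in> A \<Longrightarrow> prime p" "\<And>p. p \<in> A \<Longrightarrow> p dvd m"
  shows "\<Prod>A dvd m"
  using assms
proof (induction A rule: finite_induct)
  case (insert x A)
  then have "coprime x (\<Prod>A)" by (intro prod_coprime_right) (auto intro: primes_coprime)
  with insert show ?case by (simp add: divides_mult)
qed simp

text \<open>For \<open>n = 2 * m + 1\<close> the primes above \<open>m + 1\<close> all divide the
  middle binomial coefficient, which is at most \<open>4 ^ m\<close>; the smaller primes fall to the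
  induction hypothesis. An even \<open>n > 2\<close> contributes no new prime.\<close>

lemma primorial_le: "(\<Prod>p\<in>{p. prime p \<and> p \<le> n}. p) \<le> (4::nat) ^ n"
proof (induction n rule: less_induct)
  case (less n)
  have fin: "finite {p::nat. prime p \<and> p \<le> k}" for k by simp
  have "n \<le> 1 \<or> n = 2 \<or> n > 2" by arith
  then consider "n \<le> 1" | "n = 2" | "n > 2" "even n" | "n > 2" "odd n" by blast
  then show ?case
  proof cases
    case 1
    then have "{p. prime p \<and> p \<le> n} = {}" by (auto dest: prime_ge_2_nat)
    then show ?thesis by (simp only: prod.empty) simp
  next
    case 2
    then have "{p. prime p \<and> p \<le> n} = {2}" by (auto dest: prime_ge_2_nat simp: two_is_prime_nat)
    then show ?thesis using 2 by simp
  next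
    case 3
    then have "\<not> prime n" using prime_odd_nat by blast
    have "p \<le> n - 1" if "prime p" "p \<le> n" for p using that \<open>\<not> prime n\<close> by (cases "p = n") auto
    then have "{p. prime p \<and> p \<le> n} = {p. prime p \<and> p \<le> n - 1}"
      by auto
    then show ?thesis
      using less[of "n - 1"] 3 power_increasing[of "n - 1" n "4::nat"] by (simp add: order_trans)
  next
    case 4
    then obtain m where n: "n = 2 * m + 1" "m \<ge> 1" by (auto elim!: oddE)
    let ?A = "{p. prime p \<and> p \<le> m + 1}" and ?B = "{p. prime p \<and> m + 1 < p \<and> p \<le> n}"
    have fB: "finite ?B" by (rule finite_subset[OF _ fin[of n]]) auto
    have "\<Prod>?B dvd ((2 * m + 1) choose m)"
    proof (rule prod_primes_dvd[OF fB])
      show "x dvd ((2 * m + 1) choose m)" if "x \<in> ?B" for x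
      proof -
        have "prime x" "m + 1 < x" "x \<le> 2 * m + 1" using that n by auto
        have "fact (2 * m + 1) = ((2 * m + 1) choose m) * (fact m * fact (m + 1) :: nat)"
          using binomial_fact_lemma[of m "2 * m + 1"] by (simp add: mult_ac del: fact_Suc)
        moreover have "x dvd fact (2 * m + 1)" using \<open>x \<le> 2 * m + 1\<close> \<open>prime x\<close> by (simp only: prime_dvd_fact_iff)
        moreover have "\<not> x dvd fact m * fact (m + 1)"
          using \<open>prime x\<close> \<open>m + 1 < x\<close> by (simp add: prime_dvd_mult_iff prime_dvd_fact_iff del: fact_Suc)
        ultimately show ?thesis using \<open>prime x\<close> by (metis prime_dvd_mult_iff)
      qed
    qed auto
    then have "\<Prod>?B \<le> 4 ^ m"
      using central_binomial_odd_le[of m] dvd_imp_le[of "\<Prod>?B" "(2 * m + 1) choose m"] by (simp add: zero_less_binomial)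
    moreover have "\<Prod>?A \<le> 4 ^ (m + 1)" using less[of "m + 1"] n 4 by auto
    ultimately have "\<Prod>?A * \<Prod>?B \<le> 4 ^ (m + 1) * 4 ^ m" by (intro mult_le_mono)
    moreover have "{p. prime p \<and> p \<le> n} = ?A \<union> ?B" using n by auto
    moreover have "\<Prod>(?A \<union> ?B) = \<Prod>?A * \<Prod>?B" using fB by (intro prod.union_disjoint) auto
    ultimately show ?thesis using n by (simp add: power_add mult_2)
  qed
qed

text \<open>At 43 the inequality still fails. From 44 on the left side grows per step by at most
  \<open>(45/44) ^ 8\<close>, which is less than 2.\<close>

lemma eighth_power_le_two_power: "44 \<le> a \<Longrightarrow> a ^ 8 \<le> (2::nat) ^ a"
proof (induction a rule: dec_induct)
  case (step a)
  have "44 * Suc a \<le> 45 * a" using step by simp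
  then have "(44 * Suc a) ^ 8 \<le> (45 * a) ^ 8" by (rule power_mono) simp
  then have "44 ^ 8 * Suc a ^ 8 \<le> 45 ^ 8 * a ^ 8" by (simp only: power_mult_distrib)
  moreover have "45 ^ 8 * a ^ 8 \<le> 44 ^ 8 * (2 * a ^ 8)" by simp
  ultimately have "44 ^ 8 * Suc a ^ 8 \<le> 44 ^ 8 * (2 * a ^ 8)" by (rule order_trans)
  then have "Suc a ^ 8 \<le> 2 * a ^ 8" by simp
  then show ?case using step by simp
qed simp

text \<open>Erdos's argument: without a prime in the range, the prime factors of the central binomial
  coefficient other than \<open>2 * N - 1\<close> are at most \<open>2 * N / 3\<close>, and only those up to the square root
  of \<open>2 * N\<close> occur with an exponent above \<open>1\<close>.\<close>

lemma central_binomial_le: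
  assumes N: "N \<ge> 5" and none: "\<And>p. prime p \<Longrightarrow> N < p \<Longrightarrow> p < 2 * N - 1 \<Longrightarrow> False"
  assumes s: "s\<^sup>2 \<le> 2 * N" "2 * N < (Suc s)\<^sup>2"
  shows "((2 * N) choose N) ^ 3 \<le> (2 * N) ^ (3 * s) * 4 ^ (2 * N)"
proof -
  let ?C = "(2 * N) choose N"
  let ?P = "prime_factors ?C"
  have C: "?C > 0" by (simp add: zero_less_binomial)
  let ?A = "{p \<in> ?P. p \<le> s}" and ?B = "{p \<in> ?P. s < p \<and> p \<le> 2 * N div 3}"
    and ?D = "{p \<in> ?P. s < p \<and> 2 * N div 3 < p}"
  have le: "p ^ multiplicity p ?C \<le> 2 * N" if "p \<in> ?P" for p
    using that prime_power_central_binomial(1)[of p N] N by auto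
  have pl: "p \<le> 2 * N" if "p \<in> ?P" for p
  proof -
    have "multiplicity p ?C \<noteq> 0" using that by (auto simp: prime_factors_multiplicity)
    then have "p ^ 1 \<le> p ^ multiplicity p ?C"
      using that prime_ge_1_nat[of p] by (intro power_increasing) auto
    then show ?thesis using le[OF that] by simp
  qed
  have s2: "s \<ge> 2"
  proof (rule ccontr)
    assume "\<not> s \<ge> 2"
    then have "(Suc s)\<^sup>2 \<le> 2\<^sup>2" by (intro power_mono) auto
    then show False using s N by simp
  qed
  \<comment> \<open>The count \<open>s - 1\<close> instead of \<open>s\<close> saves one factor
    \<open>2 * N\<close>, which later pays for the possible prime factor
    \<open>2 * N - 1\<close>.\<close>
  have A: "(\<Prod>p\<in>?A. p ^ multiplicity p ?C) \<le> (2 * N) ^ (s - 1)"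
  proof -
    have "(\<Prod>p\<in>?A. p ^ multiplicity p ?C) \<le> (\<Prod>p\<in>?A. 2 * N)"
      using le by (intro prod_mono) auto
    also have "\<dots> = (2 * N) ^ card ?A" by simp
    also have "?A \<subseteq> {2..s}"
    proof
      fix p assume "p \<in> ?A"
      then show "p \<in> {2..s}" using prime_ge_2_nat[of p] in_prime_factors_imp_prime[of p ?C] by simp
    qed
    then have "card ?A \<le> card {2..s}" by (intro card_mono) auto
    then have "(2 * N) ^ card ?A \<le> (2 * N) ^ (s - 1)" using N by (intro power_increasing) auto
    finally show ?thesis .
  qed
  have sq: "multiplicity p ?C \<le> 1" if "p \<in> ?P" "s < p" for p
  proof -
    have "(Suc s)\<^sup>2 \<le> p\<^sup>2" using that by (intro power_mono) auto
    then have "2 * N < p\<^sup>2" using s(2) by linarith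
    then show ?thesis
      using prime_power_central_binomial(2)[of p N] in_prime_factors_imp_prime[OF that(1)] N by simp
  qed
  have B: "(\<Prod>p\<in>?B. p ^ multiplicity p ?C) \<le> 4 ^ (2 * N div 3)"
  proof -
    have "(\<Prod>p\<in>?B. p ^ multiplicity p ?C) \<le> (\<Prod>p\<in>?B. p)"
    proof (intro prod_mono conjI)
      fix p assume "p \<in> ?B"
      then have "p ^ multiplicity p ?C \<le> p ^ 1"
        using sq[of p] prime_ge_1_nat[of p] by (intro power_increasing) auto
      then show "p ^ multiplicity p ?C \<le> p" by simp
    qed simp
    also have "\<dots> \<le> (\<Prod>p\<in>{p. prime p \<and> p \<le> 2 * N div 3}. p)"
      by (rule dvd_imp_le[OF prod_dvd_prod_subset]) (auto intro!: prod_pos dest: prime_gt_0_nat)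
    also have "\<dots> \<le> 4 ^ (2 * N div 3)" by (rule primorial_le)
    finally show ?thesis .
  qed
  have D: "(\<Prod>p\<in>?D. p ^ multiplicity p ?C) \<le> 2 * N"
  proof -
    have "?D \<subseteq> {2 * N - 1}"
    proof
      fix p assume p: "p \<in> ?D"
      then have pr: "prime p" and m: "multiplicity p ?C \<noteq> 0"
        by (auto simp: prime_factors_multiplicity)
      have p3: "2 * N < 3 * p" using p by auto
      then have "3 \<le> p" using N by linarith
      then have "N < p" using prime_power_central_binomial(3)[of p N] pr m p3 N by (meson linorder_not_le not_gr_zero le0 less_le_trans zero_less_numeral)
      then have "\<not> p < 2 * N - 1" using none pr by blast
      moreover have "p \<noteq> 2 * N" using prime_odd_nat[OF pr] \<open>3 \<le> p\<close> by auto
      ultimately show "p \<in> {2 * N - 1}" using pl[of p] p by auto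
    qed
    then have "?D = {} \<or> ?D = {2 * N - 1}" by blast
    then show ?thesis
    proof
      assume e: "?D = {2 * N - 1}"
      then have "2 * N - 1 \<in> ?P" by blast
      then show ?thesis unfolding e using le[of "2 * N - 1"] by (simp only: prod.insert prod.empty) simp
    next
      assume e: "?D = {}"
      show ?thesis unfolding e using N by simp
    qed
  qed
  have "?C = (\<Prod>p\<in>?P. p ^ multiplicity p ?C)"
    using prime_factorization_nat[OF C] .
  also have "?P = ?A \<union> (?B \<union> ?D)" by auto
  also have "(\<Prod>p\<in>?A \<union> (?B \<union> ?D). p ^ multiplicity p ?C) =
      (\<Prod>p\<in>?A. p ^ multiplicity p ?C) * ((\<Prod>p\<in>?B. p ^ multiplicity p ?C) * (\<Prod>p\<in>?D. p ^ multiplicity p ?C))"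
    by (subst prod.union_disjoint; auto)+
  also have "\<dots> \<le> (2 * N) ^ (s - 1) * (4 ^ (2 * N div 3) * (2 * N))"
    by (intro mult_le_mono A B D)
  also have "\<dots> = (2 * N) ^ s * 4 ^ (2 * N div 3)"
    using s2 by (cases s) auto
  \<comment> \<open>Cubing removes the rounding in \<open>2 * N div 3\<close>, since
    \<open>3 * (2 * N div 3) \<le> 2 * N\<close>.\<close>
  finally have "?C ^ 3 \<le> ((2 * N) ^ s * 4 ^ (2 * N div 3)) ^ 3" by (rule power_mono) simp
  also have "\<dots> = (2 * N) ^ (3 * s) * 4 ^ (3 * (2 * N div 3))"
    by (simp only: power_mult_distrib power_mult[symmetric] mult.commute)
  also have "\<dots> \<le> (2 * N) ^ (3 * s) * 4 ^ (2 * N)"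
    by (intro mult_le_mono2 power_increasing) auto
  finally show ?thesis .
qed

text \<open>Against the lower bound \<open>4 ^ N \<le> 2 * N * C\<close> for the central coefficient
  \<open>C\<close>, the upper bound leaves \<open>4 ^ N \<le> (2 * N) ^ (3 * a)\<close> with
  \<open>2 * N < a\<^sup>2\<close>. Fourth powers bring in \<open>a ^ 8 \<le> 2 ^ a\<close> and give
  \<open>8 * N \<le> 3 * a\<^sup>2\<close>, which contradicts
  \<open>(a - 1)\<^sup>2 \<le> 2 * N\<close>. The bound 925 is the least \<open>N\<close> with
  \<open>43\<^sup>2 \<le> 2 * N\<close>, which makes \<open>a \<ge> 44\<close>.\<close>

lemma prime_between_large:
  assumes "N \<ge> 925"
  shows "\<exists>p::nat. prime p \<and> N < p \<and> p < 2 * N - 1"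
proof (rule ccontr)
  assume contra: "\<not> ?thesis"
  define s where "s = floor_sqrt (2 * N)"
  define a where "a = Suc s"
  have s: "s\<^sup>2 \<le> 2 * N" "2 * N < a\<^sup>2"
    using floor_sqrt_power2_le[of "2 * N"] Suc_floor_sqrt_power2_gt[of "2 * N"] by (simp_all add: s_def a_def)
  have "43 \<le> s" unfolding s_def using assms by (intro le_floor_sqrtI) simp
  then have a: "a \<ge> 44" by (simp add: a_def)
  let ?C = "(2 * N) choose N"
  have C: "?C ^ 3 \<le> (2 * N) ^ (3 * s) * 4 ^ (2 * N)"
    by (rule central_binomial_le) (use contra assms s in \<open>auto simp: a_def\<close>)
  have "(4 ^ N) ^ 3 \<le> (2 * N * ?C) ^ 3"
    using assms by (intro power_mono four_power_le_central_binomial) auto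
  also have "\<dots> = (2 * N) ^ 3 * ?C ^ 3" by (rule power_mult_distrib)
  also have "\<dots> \<le> (2 * N) ^ 3 * ((2 * N) ^ (3 * s) * 4 ^ (2 * N))"
    by (rule mult_le_mono2[OF C])
  also have "\<dots> = (2 * N) ^ (3 * a) * 4 ^ (2 * N)"
    by (simp add: a_def power_add)
  also have "(4 ^ N) ^ 3 = (4::nat) ^ N * 4 ^ (2 * N)"
    by (simp add: power_mult[symmetric] power_add[symmetric])
  finally have "4 ^ N \<le> (2 * N) ^ (3 * a)" by simp
  also have "\<dots> \<le> (a\<^sup>2) ^ (3 * a)" using s by (intro power_mono) auto
  also have "\<dots> = a ^ (6 * a)" by (simp add: power_mult[symmetric])
  finally have "(4 ^ N) ^ 4 \<le> (a ^ (6 * a)) ^ 4" by (rule power_mono) simp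
  also have "\<dots> = (a ^ 8) ^ (3 * a)" by (simp add: power_mult[symmetric])
  also have "\<dots> \<le> (2 ^ a) ^ (3 * a)" by (intro power_mono eighth_power_le_two_power a) simp
  also have "(4 ^ N) ^ 4 = (2::nat) ^ (8 * N)"
    by (simp add: power_mult[symmetric] power_mult[of 2 2 "4 * N", simplified])
  also have "(2 ^ a) ^ (3 * a) = (2::nat) ^ (3 * a\<^sup>2)" by (simp add: power_mult[symmetric] power2_eq_square)
  finally have "8 * N \<le> 3 * a\<^sup>2" by (rule power_le_imp_le_exp[rotated]) simp
  then have "4 * s\<^sup>2 \<le> 3 * (s + 1)\<^sup>2" using s by (simp add: a_def)
  then have "s * s \<le> 6 * s + 3" by (simp add: power2_eq_square algebra_simps)
  moreover have "43 * s \<le> s * s" using \<open>43 \<le> s\<close> by (rule mult_le_mono1)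
  ultimately show False using \<open>43 \<le> s\<close> by linarith
qed

section \<open>Small arguments and the choice of the prime\<close>

lemma prime_nat_trial_division:
  fixes n :: nat
  assumes "1 < n" "n < b\<^sup>2" "\<forall>q\<in>set [2..<b]. \<not> q dvd n"
  shows "prime n"
proof (rule ccontr)
  assume "\<not> prime n"
  then obtain q where q: "q dvd n" "q \<noteq> 1" "q \<noteq> n"
    using assms(1) by (auto simp: prime_nat_iff)
  then obtain r where r: "n = q * r" by (elim dvdE)
  have "q \<noteq> 0" "r \<noteq> 0" "r \<noteq> 1" using r q assms(1) by (metis mult_0 mult_0_right mult_1_right not_less_zero)+
  then have "q \<ge> 2" "r \<ge> 2" using q by linarith+
  moreover have "r dvd n" using r by simp
  ultimately have "b \<le> q" "b \<le> r" using assms(3) q(1) by (metis atLeastLessThan_iff set_upt not_le)+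
  then have "b * b \<le> n" unfolding r by (rule mult_le_mono)
  then show False using assms(2) by (simp add: power2_eq_square)
qed

text \<open>The upper limit is sharper than Bertrand's \<open>2 * N\<close>, because two letters
  beyond \<open>p\<close> are needed. Below 925 a chain of primes suffices in which each is less
  than twice its predecessor minus 1, so that it serves every \<open>N\<close> from that predecessor
  on.\<close>

lemma prime_between:
  assumes "N \<ge> 4"
  shows "\<exists>p::nat. prime p \<and> N < p \<and> p < 2 * N - 1"
proof (cases "N \<ge> 925")
  case False
  have w: ?thesis if "prime p" "N < p" "p < 2 * N - 1" for p using that by blast
  consider "N = 4" | "5 \<le> N" "N < 7" | "7 \<le> N" "N < 11" | "11 \<le> N" "N < 19" | "19 \<le> N" "N < 31"
    | "31 \<le> N" "N < 59" | "59 \<le> N" "N < 113" | "113 \<le> N" "N < 223" | "223 \<le> N" "N < 443"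
    | "443 \<le> N" "N < 883" | "883 \<le> N" "N < 929" using False assms by linarith
  then show ?thesis
  proof cases
    case 1 then show ?thesis using w[of 5] by simp
  next
    case 2 then show ?thesis using w[of 7] by simp
  next
    case 3 then show ?thesis using w[of 11] by simp
  next
    case 4 then show ?thesis using w[of 19] by simp
  next
    case 5 then show ?thesis using w[of 31] by simp
  next
    case 6 then show ?thesis using w[OF prime_nat_trial_division[of 59 8]] by (simp add: upt_conv_Cons del: set_upt)
  next
    case 7 then show ?thesis using w[OF prime_nat_trial_division[of 113 11]] by (simp add: upt_conv_Cons del: set_upt)
  next
    case 8 then show ?thesis using w[OF prime_nat_trial_division[of 223 15]] by (simp add: upt_conv_Cons del: set_upt)
  next
    case 9 then show ?thesis using w[OF prime_nat_trial_division[of 443 22]] by (simp add: upt_conv_Cons del: set_upt)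
  next
    case 10 then show ?thesis using w[OF prime_nat_trial_division[of 883 30]] by (simp add: upt_conv_Cons del: set_upt)
  next
    case 11 then show ?thesis using w[OF prime_nat_trial_division[of 929 31]] by (simp add: upt_conv_Cons del: set_upt)
  qed
qed (rule prime_between_large)

lemma obtain_prime_for_degree:
  assumes "n \<ge> 5" "n \<noteq> 6"
  obtains p :: nat where "prime p" "odd p" "p + 2 \<le> n" "n < 2 * p"
proof -
  \<comment> \<open>Degrees 5 and 7 have \<open>n div 2 < 4\<close> and are settled by hand. In
    degree 6 the conditions would read \<open>3 < p\<close> and \<open>p \<le> 4\<close>.\<close>
  consider "n = 5" | "n = 7" | "n \<ge> 8" using assms by linarith
  then have "\<exists>p::nat. prime p \<and> p + 2 \<le> n \<and> n < 2 * p"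
  proof cases
    case 1
    show ?thesis by (rule exI[of _ 3]) (simp add: 1)
  next
    case 2
    show ?thesis by (rule exI[of _ 5]) (simp add: 2)
  next
    case 3
    then have "4 \<le> n div 2" by presburger
    then obtain p where "prime p" "n div 2 < p" "p < 2 * (n div 2) - 1"
      using prime_between[of "n div 2"] by blast
    then show ?thesis by (intro exI[of _ p]) (auto simp: algebra_simps)
  qed
  then obtain p :: nat where p: "prime p" "p + 2 \<le> n" "n < 2 * p" by blast
  then have "odd p" using assms prime_odd_nat[of p] by (cases "p = 2") auto
  then show thesis using p that by blast
qed

section \<open>Carmichael's relations\<close>

context group
begin

definition cj :: "'a \<Rightarrow> 'a \<Rightarrow> 'a"
  where "cj g x = g \<otimes> x \<otimes> inv g"

lemma inv_cancel_left [simp]: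
  "x \<in> carrier G \<Longrightarrow> y \<in> carrier G \<Longrightarrow> inv x \<otimes> (x \<otimes> y) = y"
  "x \<in> carrier G \<Longrightarrow> y \<in> carrier G \<Longrightarrow> x \<otimes> (inv x \<otimes> y) = y"
  by (simp_all flip: m_assoc)

lemma cj_closed [simp, intro]: "g \<in> carrier G \<Longrightarrow> x \<in> carrier G \<Longrightarrow> cj g x \<in> carrier G"
  by (simp add: cj_def)

lemma cj_one [simp]: "g \<in> carrier G \<Longrightarrow> cj g \<one> = \<one>" "x \<in> carrier G \<Longrightarrow> cj \<one> x = x"
  by (simp_all add: cj_def)

lemma cj_mult:
  "g \<in> carrier G \<Longrightarrow> x \<in> carrier G \<Longrightarrow> y \<in> carrier G \<Longrightarrow> cj g (x \<otimes> y) = cj g x \<otimes> cj g y"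
  by (simp add: cj_def m_assoc)

lemma cj_cj:
  "g \<in> carrier G \<Longrightarrow> h \<in> carrier G \<Longrightarrow> x \<in> carrier G \<Longrightarrow> cj g (cj h x) = cj (g \<otimes> h) x"
  by (simp add: cj_def m_assoc inv_mult_group)

lemma cj_inv: "g \<in> carrier G \<Longrightarrow> x \<in> carrier G \<Longrightarrow> cj g (inv x) = inv (cj g x)"
  by (simp add: cj_def m_assoc inv_mult_group)

lemma cj_inv_cj [simp]:
  "g \<in> carrier G \<Longrightarrow> x \<in> carrier G \<Longrightarrow> cj (inv g) (cj g x) = x"
  "g \<in> carrier G \<Longrightarrow> x \<in> carrier G \<Longrightarrow> cj g (cj (inv g) x) = x"
  by (simp_all add: cj_cj)

lemma cj_eq_iff: "g \<in> carrier G \<Longrightarrow> x \<in> carrier G \<Longrightarrow> cj g x = x \<longleftrightarrow> g \<otimes> x = x \<otimes> g"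
  by (metis cj_def inv_closed inv_solve_right' m_closed)

lemma pow_commute:
  assumes "x \<in> carrier G" "y \<in> carrier G" "x \<otimes> y = y \<otimes> x"
  shows "x [^] (i::nat) \<otimes> y = y \<otimes> x [^] i"
  using assms by (induction i) (simp_all add: m_assoc, metis m_assoc nat_pow_closed)

lemma cj_generate_closed:
  assumes "g \<in> carrier G" "X \<subseteq> carrier G" "subgroup N G" "\<And>x. x \<in> X \<Longrightarrow> cj g x \<in> N"
    and "x \<in> generate G X"
  shows "cj g x \<in> N"
  using assms(5)
proof (induction x rule: generate.induct)
  case one
  show ?case using assms subgroup.one_closed by simp
next
  case (incl h)
  then show ?case using assms by simp
next
  case (inv h)
  then have "cj g (inv h) = inv (cj g h)" using assms by (intro cj_inv) auto
  then show ?case using inv assms(3,4) by (simp add: subgroup.m_inv_closed)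
next
  case (eng x y)
  then have "cj g (x \<otimes> y) = cj g x \<otimes> cj g y"
    using assms(1,2) generate_in_carrier by (intro cj_mult) auto
  then show ?case using eng assms(3) by (simp add: subgroup.m_closed)
qed

lemma cj_pow_closed:
  assumes "g \<in> carrier G" "N \<subseteq> carrier G" "\<And>x. x \<in> N \<Longrightarrow> cj g x \<in> N" "x \<in> N"
  shows "cj (g [^] (i::nat)) x \<in> N"
proof (induction i)
  case (Suc i)
  have "cj (g [^] Suc i) x = cj g (cj (g [^] i) x)"
    using assms nat_pow_Suc2[OF assms(1), of i] by (subst cj_cj) auto
  then show ?case using Suc assms(3) by simp
qed (use assms in auto)

text \<open>The set \<open>S\<close> need not be a subgroup: it will be a union of right cosets, for
  which only right multiplication by generators is under control.\<close>

lemma generate_subset_right_closed: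
  assumes "X \<subseteq> carrier G" "S \<subseteq> carrier G" "\<one> \<in> S"
    and "\<And>s x. s \<in> S \<Longrightarrow> x \<in> X \<Longrightarrow> s \<otimes> x \<in> S"
    and "\<And>s x. s \<in> S \<Longrightarrow> x \<in> X \<Longrightarrow> s \<otimes> inv x \<in> S"
  shows "generate G X \<subseteq> S"
proof
  fix g assume g: "g \<in> generate G X"
  then have "s \<otimes> g \<in> S" if "s \<in> S" for s
    using that
  proof (induction g arbitrary: s rule: generate.induct)
    case (eng x y)
    have "s \<otimes> (x \<otimes> y) = s \<otimes> x \<otimes> y"
      using eng generate_in_carrier[OF assms(1)] assms(2) by (auto simp: m_assoc)
    then show ?case using eng by simp
  qed (use assms in auto)
  from this[OF \<open>\<one> \<in> S\<close>] show "g \<in> S" using generate_in_carrier[OF assms(1) g] by simp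
qed

section \<open>Elements of order three whose products are involutions\<close>

lemma inv_if_cube: "x \<in> carrier G \<Longrightarrow> x \<otimes> x \<otimes> x = \<one> \<Longrightarrow> inv x = x \<otimes> x"
  by (metis inv_equality m_closed)

lemma pair_swap:
  assumes "a \<in> carrier G" "b \<in> carrier G" "a \<otimes> b \<otimes> a \<otimes> b = \<one>"
  shows "b \<otimes> a \<otimes> b \<otimes> a = \<one>" "a \<otimes> b = inv b \<otimes> inv a" "inv a \<otimes> inv b = b \<otimes> a"
proof -
  have *: "(a \<otimes> b) \<otimes> (a \<otimes> b) = \<one>" using assms by (simp add: m_assoc)
  then show 1: "a \<otimes> b = inv b \<otimes> inv a"
    using assms by (metis inv_equality inv_mult_group m_closed)
  have "b \<otimes> a \<otimes> b \<otimes> a = b \<otimes> (a \<otimes> b) \<otimes> a" using assms by (simp add: m_assoc)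
  also have "\<dots> = \<one>" using assms by (simp add: 1 m_assoc)
  finally show 2: "b \<otimes> a \<otimes> b \<otimes> a = \<one>" .
  then have "(b \<otimes> a) \<otimes> (b \<otimes> a) = \<one>" using assms by (simp add: m_assoc)
  then show "inv a \<otimes> inv b = b \<otimes> a"
    using assms by (metis inv_equality inv_mult_group m_closed)
qed

text \<open>These rewrite a coset representative times a generator as an element of the smaller
  subgroup times a representative. Either \<open>a\<close> is the new generator and \<open>b\<close>
  an old one; the representatives are \<open>inv a\<close> and
  \<open>a \<otimes> inv b\<close>.\<close>

lemma carmichael_identities:
  assumes c: "a \<in> carrier G" "b \<in> carrier G"
    and cube: "a \<otimes> a \<otimes> a = \<one>" "b \<otimes> b \<otimes> b = \<one>" and pair: "a \<otimes> b \<otimes> a \<otimes> b = \<one>"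
  shows "inv a \<otimes> b = b \<otimes> (a \<otimes> inv b)" "a \<otimes> inv b \<otimes> a = inv b \<otimes> (a \<otimes> inv b)"
proof -
  note P = pair_swap[OF c pair]
  have A: "inv a \<otimes> inv a = a" "a \<otimes> a = inv a" and B: "inv b \<otimes> inv b = b" "b \<otimes> b = inv b"
    using inv_if_cube[OF c(1) cube(1)] inv_if_cube[OF c(2) cube(2)] cube c by (auto simp: m_assoc)
  have "b \<otimes> (a \<otimes> inv b) = b \<otimes> a \<otimes> inv b" using c by (simp add: m_assoc)
  also have "\<dots> = inv a \<otimes> inv b \<otimes> inv b" by (simp add: P(3))
  also have "\<dots> = inv a \<otimes> b" using c by (simp add: m_assoc B)
  finally show 1: "inv a \<otimes> b = b \<otimes> (a \<otimes> inv b)" by simp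
  have "a \<otimes> inv b \<otimes> a = a \<otimes> (b \<otimes> (b \<otimes> a))" using c by (simp add: m_assoc flip: B(2))
  also have "\<dots> = a \<otimes> b \<otimes> (inv a \<otimes> inv b)" using c by (simp add: P(3) m_assoc)
  also have "\<dots> = inv b \<otimes> (inv a \<otimes> (inv a \<otimes> inv b))" using c by (simp add: P(2) m_assoc)
  also have "\<dots> = inv b \<otimes> (inv a \<otimes> inv a \<otimes> inv b)" using c by (simp add: m_assoc)
  also have "\<dots> = inv b \<otimes> (a \<otimes> inv b)" by (simp add: A)
  finally show "a \<otimes> inv b \<otimes> a = inv b \<otimes> (a \<otimes> inv b)" .
qed

text \<open>The remaining rewriting rule: the representative \<open>a \<otimes> inv c\<close> meets
  an old generator \<open>b\<close> different from \<open>c\<close> and is reproduced, at the cost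
  of the element \<open>inv c \<otimes> b\<close> of the smaller subgroup.\<close>

lemma carmichael_identity3:
  assumes c: "a \<in> carrier G" "b \<in> carrier G" "c \<in> carrier G"
    and cube: "a \<otimes> a \<otimes> a = \<one>" "b \<otimes> b \<otimes> b = \<one>" "c \<otimes> c \<otimes> c = \<one>"
    and pair: "a \<otimes> b \<otimes> a \<otimes> b = \<one>" "a \<otimes> c \<otimes> a \<otimes> c = \<one>" "b \<otimes> c \<otimes> b \<otimes> c = \<one>"
  shows "a \<otimes> inv c \<otimes> b = (inv c \<otimes> b) \<otimes> (a \<otimes> inv c)"
proof -
  note cb = carmichael_identities(1)[OF c(3,2) cube(3,2) pair_swap(1)[OF c(2,3) pair(3)]]
  note ac = carmichael_identities(1)[OF c(1,3) cube(1,3) pair(2)]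
  have bcb: "inv b \<otimes> inv c = c \<otimes> b" using pair_swap(3)[OF c(2,3) pair(3)] .
  have C: "inv c = c \<otimes> c" "inv c \<otimes> inv c = c"
    using inv_if_cube[OF c(3) cube(3)] cube c by (auto simp: m_assoc)
  have ab: "a \<otimes> b = inv b \<otimes> inv a" using pair_swap(2)[OF c(1,2) pair(1)] .
  have bc: "inv c \<otimes> inv b = b \<otimes> c"
    using pair_swap(3)[OF c(3,2) pair_swap(1)[OF c(2,3) pair(3)]] .
  have "a \<otimes> inv c \<otimes> b = a \<otimes> (inv c \<otimes> b)" using c by (simp add: m_assoc)
  also have "\<dots> = a \<otimes> b \<otimes> (c \<otimes> inv b)" using c by (simp add: cb m_assoc)
  also have "\<dots> = inv b \<otimes> (inv a \<otimes> c) \<otimes> inv b" using c by (simp add: ab m_assoc)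
  also have "\<dots> = inv b \<otimes> c \<otimes> a \<otimes> (inv c \<otimes> inv b)" using c by (simp add: ac m_assoc)
  also have "\<dots> = inv b \<otimes> c \<otimes> (a \<otimes> b) \<otimes> c" using c by (simp add: bc m_assoc)
  also have "\<dots> = inv b \<otimes> c \<otimes> inv b \<otimes> (inv a \<otimes> c)" using c by (simp add: ab m_assoc)
  also have "\<dots> = (inv b \<otimes> c \<otimes> inv b \<otimes> c) \<otimes> (a \<otimes> inv c)" using c by (simp add: ac m_assoc)
  also have "inv b \<otimes> c \<otimes> inv b \<otimes> c = inv c \<otimes> b"
  proof -
    have "inv b \<otimes> c = c \<otimes> (b \<otimes> inv c)"
      by (rule carmichael_identities(1)[OF c(2,3) cube(2,3) pair(3)])
    then have "inv b \<otimes> c \<otimes> inv b \<otimes> c = c \<otimes> b \<otimes> inv c \<otimes> (inv b \<otimes> c)"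
      using c by (simp add: m_assoc)
    also have "\<dots> = c \<otimes> b \<otimes> inv c \<otimes> (c \<otimes> (b \<otimes> inv c))"
      using \<open>inv b \<otimes> c = c \<otimes> (b \<otimes> inv c)\<close> by simp
    also have "\<dots> = c \<otimes> (b \<otimes> b) \<otimes> inv c" using c by (simp add: m_assoc)
    also have "\<dots> = c \<otimes> (inv b \<otimes> inv c)" using inv_if_cube[OF c(2) cube(2)] c by (simp add: m_assoc)
    also have "\<dots> = c \<otimes> (c \<otimes> b)" by (simp only: bcb)
    also have "\<dots> = inv c \<otimes> b" using c by (simp add: C(1) m_assoc)
    finally show ?thesis .
  qed
  finally show ?thesis .
qed

text \<open>Carmichael's relations for the alternating group on \<open>card I + 2\<close> letters, where \<open>x i\<close> stands for
  the cycle \<open>(\<alpha> \<beta> i)\<close> with two fixed letters \<open>\<alpha>\<close>, \<open>\<beta>\<close>. In the induction step, \<open>T\<close> represents the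
  cosets of the subgroup \<open>N\<close> that belongs to one letter less.\<close>

lemma carmichael_bound:
  fixes x :: "'i \<Rightarrow> 'a"
  assumes "finite I" and c: "\<And>i. i \<in> I \<Longrightarrow> x i \<in> carrier G"
    and cube: "\<And>i. i \<in> I \<Longrightarrow> x i \<otimes> x i \<otimes> x i = \<one>"
    and pair: "\<And>i j. i \<in> I \<Longrightarrow> j \<in> I \<Longrightarrow> i \<noteq> j \<Longrightarrow> x i \<otimes> x j \<otimes> x i \<otimes> x j = \<one>"
  shows "finite (generate G (x ` I)) \<and> 2 * card (generate G (x ` I)) \<le> fact (card I + 2)"
  using assms
proof (induction I rule: finite_induct)
  case empty
  then show ?case by (simp add: generate_empty numeral_2_eq_2)
next
  case (insert m I)
  define N where "N = generate G (x ` I)"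
  \<comment> \<open>In the alternating group the inverses of these representatives send
    \<open>m\<close> to \<open>m\<close>, \<beta>, \<alpha> and \<open>j\<close> respectively: one
    coset for each of the \<open>card I + 3\<close> letters.\<close>
  define T where "T = {\<one>, x m, inv (x m)} \<union> (\<lambda>j. x m \<otimes> inv (x j)) ` I"
  define S where "S = (\<lambda>(s, t). s \<otimes> t) ` (N \<times> T)"
  have xI: "x ` I \<subseteq> carrier G" and xm: "x m \<in> carrier G" using insert by auto
  have N: "subgroup N G" unfolding N_def by (rule generate_is_subgroup[OF xI])
  interpret N: subgroup N G by fact
  have fN: "finite N" "2 * card N \<le> fact (card I + 2)"
    using insert by (auto simp: N_def)
  have TG: "T \<subseteq> carrier G" using xI xm by (auto simp: T_def)
  have SG: "S \<subseteq> carrier G" using TG by (auto simp: S_def)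
  have NI: "x i \<in> N" "inv (x i) \<in> N" if "i \<in> I" for i
    using that by (auto simp: N_def intro: generate.incl generate.inv)
  have step: "\<exists>s \<in> N. \<exists>t' \<in> T. t \<otimes> x i = s \<otimes> t'" if "t \<in> T" "i \<in> insert m I" for t i
  proof -
    have w: ?thesis if "s \<in> N" "t' \<in> T" "t \<otimes> x i = s \<otimes> t'" for s t' using that by blast
    have T: "\<one> \<in> T" "x m \<in> T" "inv (x m) \<in> T" "\<And>j. j \<in> I \<Longrightarrow> x m \<otimes> inv (x j) \<in> T"
      by (auto simp: T_def)
    have xi: "x i \<in> carrier G" using insert that by auto
    show ?thesis
    proof (cases "i = m")
      case True
      from \<open>t \<in> T\<close> consider "t = \<one>" | "t = x m" | "t = inv (x m)"
        | j where "j \<in> I" "t = x m \<otimes> inv (x j)" by (auto simp: T_def)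
      then show ?thesis
      proof cases
        case 1
        then show ?thesis using w[of \<one> "x m"] T xm True by simp
      next
        case 2
        then show ?thesis using w[of \<one> "inv (x m)"] T xm True inv_if_cube[of "x m"] insert by simp
      next
        case 3
        then show ?thesis using w[of \<one> \<one>] T xm True by simp
      next
        case 4
        then have "x j \<in> carrier G" "m \<noteq> j" using insert by auto
        then show ?thesis
          using w[of "inv (x j)" "x m \<otimes> inv (x j)"] T NI 4 True insert
            carmichael_identities(2)[of "x m" "x j"] by simp
      qed
    next
      case False
      then have i: "i \<in> I" using that by simp
      have im: "x m \<otimes> x i \<otimes> x m \<otimes> x i = \<one>" using insert i False by simp
      have ci: "x i \<otimes> x i \<otimes> x i = \<one>" and cm: "x m \<otimes> x m \<otimes> x m = \<one>" using insert i by auto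
      from \<open>t \<in> T\<close> consider "t = \<one>" | "t = x m" | "t = inv (x m)"
        | "t = x m \<otimes> inv (x i)" | j where "j \<in> I" "j \<noteq> i" "t = x m \<otimes> inv (x j)"
        by (auto simp: T_def)
      then show ?thesis
      proof cases
        case 1
        then show ?thesis using w[of "x i" \<one>] T NI i xi by simp
      next
        case 2
        then show ?thesis using w[of "inv (x i)" "inv (x m)"] T NI i pair_swap(2)[OF xm xi im] by simp
      next
        case 3
        then show ?thesis using w[of "x i" "x m \<otimes> inv (x i)"] T NI i
            carmichael_identities(1)[OF xm xi cm ci im] by simp
      next
        case 4
        then show ?thesis using w[of \<one> "x m"] T xm xi by (simp add: m_assoc)
      next
        case 5
        have "x j \<in> carrier G" "j \<noteq> m" using insert 5 by auto
        then have "x m \<otimes> inv (x j) \<otimes> x i = (inv (x j) \<otimes> x i) \<otimes> (x m \<otimes> inv (x j))"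
          using xm xi cm ci im insert 5 i False by (intro carmichael_identity3) auto
        then show ?thesis using w[of "inv (x j) \<otimes> x i" "x m \<otimes> inv (x j)"] T NI i 5 by simp
      qed
    qed
  qed
  have mult: "s \<otimes> x i \<in> S" if "s \<in> S" "i \<in> insert m I" for s i
  proof -
    from that obtain s' t where st: "s = s' \<otimes> t" "s' \<in> N" "t \<in> T" by (auto simp: S_def)
    from step[OF st(3) that(2)] obtain s'' t' where t': "s'' \<in> N" "t' \<in> T" "t \<otimes> x i = s'' \<otimes> t'" by blast
    have "x i \<in> carrier G" using insert that by auto
    moreover have "s' \<in> carrier G" "t \<in> carrier G" "s'' \<in> carrier G" "t' \<in> carrier G"
      using st t' TG by auto
    ultimately have "s \<otimes> x i = (s' \<otimes> s'') \<otimes> t'" using st(1) t'(3) by (simp add: m_assoc)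
    then show ?thesis using st t' by (auto simp: S_def)
  qed
  have "generate G (x ` insert m I) \<subseteq> S"
  proof (rule generate_subset_right_closed)
    show "\<one> \<in> S" by (auto simp: S_def T_def intro!: image_eqI[of _ _ "(\<one>, \<one>)"])
    fix s y assume s: "s \<in> S" and y: "y \<in> x ` insert m I"
    then obtain i where i: "i \<in> insert m I" "y = x i" by blast
    then show "s \<otimes> y \<in> S" using mult s by simp
    have yc: "y \<in> carrier G" "y \<otimes> y \<otimes> y = \<one>" using insert i by auto
    have "s \<otimes> y \<otimes> y \<in> S" using mult s i by simp
    then show "s \<otimes> inv y \<in> S" using inv_if_cube[OF yc] s SG yc(1) by (auto simp: m_assoc)
  qed (use xI xm SG in auto)
  moreover have fT: "finite T" using insert by (simp add: T_def)
  then have fS: "finite S" using fN by (simp add: S_def)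
  ultimately have "card (generate G (x ` insert m I)) \<le> card S" "finite (generate G (x ` insert m I))"
    by (auto intro: card_mono finite_subset)
  moreover have "card S \<le> card N * card T"
    unfolding S_def card_cartesian_product[symmetric] using fN fT by (intro card_image_le) auto
  moreover have "card T \<le> card I + 3"
  proof -
    have "card T \<le> card {\<one>, x m, inv (x m)} + card ((\<lambda>j. x m \<otimes> inv (x j)) ` I)"
      unfolding T_def by (rule card_Un_le)
    also have "\<dots> \<le> 3 + card I"
      using insert by (intro add_mono card_image_le) (auto simp: card_insert_if)
    finally show ?thesis by simp
  qed
  then have "2 * (card N * card T) \<le> fact (card I + 2) * (card I + 3)"
    using fN(2) mult_le_mono by (metis mult.assoc)
  moreover have "fact (card (insert m I) + 2) = fact (card I + 2) * (card I + 3)"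
    using insert by (simp add: numeral_3_eq_3)
  ultimately show ?case by linarith
qed

end

lemma (in group_hom) hom_cj: "g \<in> carrier G \<Longrightarrow> x \<in> carrier G \<Longrightarrow> h (G.cj g x) = H.cj (h g) (h x)"
  by (simp add: G.cj_def H.cj_def)

section \<open>Groups mapping onto the alternating group\<close>

text \<open>By Carmichael's relations, \<open>f\<close> maps \<open>A\<close> isomorphically onto the alternating group on
  \<open>{1..p + 1} \<union> {n}\<close>. The single condition on \<open>y\<close> determines how \<open>t\<close> acts on the part of \<open>A\<close> above
  \<open>{1..p} \<union> {n}\<close>, because \<open>t\<close> commutes with \<open>u\<close>.\<close>

locale alternating_base = group G for G (structure) +
  fixes n p k M :: nat and f and u t z y :: 'a
  assumes hom: "f \<in> hom G (sym_group n)"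
    and p3: "3 \<le> p" and n_eq: "n = p + 2 + k" and k_le: "k + 2 \<le> p" and M: "M = n - 1 \<or> M = n"
    and carrier: "u \<in> carrier G" "t \<in> carrier G" "z \<in> carrier G"
    and fu: "f u = cyc 1 p" and ft: "f t = cyc (p + 1) M" and fz: "f z = tri (p + 1) n p"
    and up: "u [^] p = \<one>" and ut: "u \<otimes> t = t \<otimes> u" and z3: "z \<otimes> z \<otimes> z = \<one>"
    and pairs: "\<And>j. 0 < j \<Longrightarrow> j < p \<Longrightarrow> z \<otimes> cj (u [^] j) z \<otimes> z \<otimes> cj (u [^] j) z = \<one>"
  fixes A
  defines "A \<equiv> generate G ((\<lambda>j. cj (u [^] j) z) ` {..<p})"
  assumes y: "y \<in> A" "f y = tri 1 2 n" "cj t y \<in> A"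
begin

interpretation f: group_hom G "sym_group n" f
  using hom sym_group_is_group group_axioms by (intro group_hom.intro group_hom_axioms.intro)

declare f.hom_mult [simp del] f.hom_one [simp del] f.hom_inv [simp del]

lemma n_bounds: "p + 2 \<le> n" "p + 1 \<le> M" "M \<le> n"
  using M n_eq by auto

lemma f_mult: "x \<in> carrier G \<Longrightarrow> x' \<in> carrier G \<Longrightarrow> f (x \<otimes> x') = f x \<circ> f x'"
  using f.hom_mult[of x x'] by (simp add: sym_group_mult)

lemma f_one: "f \<one> = id"
  using f.hom_one by (simp add: sym_group_one)

lemma f_permutes: "x \<in> carrier G \<Longrightarrow> f x permutes {1..n}"
  using f.hom_closed by (simp add: sym_group_carrier)

lemma f_inj: "x \<in> carrier G \<Longrightarrow> inj (f x)"
  using f_permutes permutes_inj by blast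

lemma f_inv: "x \<in> carrier G \<Longrightarrow> f (inv x) = inv' (f x)"
  using f.hom_inv f.hom_closed by simp

lemma f_pow: "x \<in> carrier G \<Longrightarrow> f (x [^] (i::nat)) = f x ^^ i"
  by (induction i) (simp_all add: f_one f_mult funpow_Suc_right del: funpow.simps(2))

lemma f_cj_tri:
  assumes "g \<in> carrier G" "x \<in> carrier G" "f x = tri i j l"
  shows "f (cj g x) = tri (f g i) (f g j) (f g l)"
proof -
  have "f (cj g x) = f g \<circ> tri i j l \<circ> inv' (f g)"
    using assms by (simp add: cj_def f_mult f_inv)
  also have "\<dots> = tri (f g i) (f g j) (f g l) \<circ> (f g \<circ> inv' (f g))"
    using tri_conj[OF f_inj[OF assms(1)], of i j l] by (simp add: comp_assoc)
  finally show ?thesis using permutes_inv_o(1)[OF f_permutes[OF assms(1)]] by simp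
qed

definition Om :: "nat set" where "Om = {1..p + 1} \<union> {n}"

lemma Om: "finite Om" "card Om = p + 2" "Om \<subseteq> {1..n}" "p + 1 \<in> Om" "n \<in> Om" "p + 1 \<noteq> n"
  using n_bounds p3 by (auto simp: Om_def)

lemma gens: "(\<lambda>j. cj (u [^] j) z) ` {..<p} \<subseteq> carrier G"
  using carrier by auto

lemma A_subgroup: "subgroup A G"
  unfolding A_def by (rule generate_is_subgroup[OF gens])

lemma A_carrier: "x \<in> A \<Longrightarrow> x \<in> carrier G"
  using subgroup.subset[OF A_subgroup] by blast

lemmas A_closed = subgroup.m_closed[OF A_subgroup] subgroup.m_inv_closed[OF A_subgroup]
  subgroup.one_closed[OF A_subgroup]

text \<open>Conjugation by a power of \<open>u\<close> moves the smaller exponent to 0, so only the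
  difference matters.\<close>

lemma z_pair:
  assumes "i < p" "j < p" "i \<noteq> j"
  shows "cj (u [^] i) z \<otimes> cj (u [^] j) z \<otimes> cj (u [^] i) z \<otimes> cj (u [^] j) z = \<one>"
proof -
  have *: "cj (u [^] i) z \<otimes> cj (u [^] j) z \<otimes> cj (u [^] i) z \<otimes> cj (u [^] j) z = \<one>" if "i < j" "j < p" for i j
  proof -
    have "cj (u [^] j) z = cj (u [^] i) (cj (u [^] (j - i)) z)"
      using that carrier by (simp add: cj_cj nat_pow_mult)
    then have "cj (u [^] i) z \<otimes> cj (u [^] j) z \<otimes> cj (u [^] i) z \<otimes> cj (u [^] j) z =
        cj (u [^] i) (z \<otimes> cj (u [^] (j - i)) z \<otimes> z \<otimes> cj (u [^] (j - i)) z)"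
      using carrier by (simp add: cj_mult)
    then show ?thesis using that pairs[of "j - i"] carrier by simp
  qed
  show ?thesis
  proof (cases "i < j")
    case True
    then show ?thesis using * assms by blast
  next
    case False
    then show ?thesis using *[of j i] assms carrier by (simp add: pair_swap(1)[of "cj (u [^] j) z" "cj (u [^] i) z"])
  qed
qed

lemma A_finite_card: "finite A" "2 * card A \<le> fact (p + 2)"
proof -
  have "finite A \<and> 2 * card A \<le> fact (card {..<p} + 2)"
    unfolding A_def
  proof (rule carmichael_bound)
    fix i assume "i \<in> {..<p}"
    have "cj (u [^] i) z \<otimes> cj (u [^] i) z \<otimes> cj (u [^] i) z = cj (u [^] i) (z \<otimes> z \<otimes> z)"
      using carrier by (simp add: cj_mult)
    then show "cj (u [^] i) z \<otimes> cj (u [^] i) z \<otimes> cj (u [^] i) z = \<one>" using carrier z3 by simp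
  qed (use z_pair carrier in auto)
  then show "finite A" "2 * card A \<le> fact (p + 2)" by auto
qed

lemma f_image_subgroup: "subgroup K G \<Longrightarrow> subgroup (f ` K) (sym_group n)"
  by (rule f.subgroup_img_is_subgroup)

lemma f_z: "j < p \<Longrightarrow> f (cj (u [^] j) z) = tri (p + 1) n (if j = 0 then p else j)"
proof -
  assume j: "j < p"
  have "f (cj (u [^] j) z) = tri (f (u [^] j) (p + 1)) (f (u [^] j) n) (f (u [^] j) p)"
    using carrier fz by (intro f_cj_tri) auto
  also have "f (u [^] j) = cyc 1 p ^^ j" using carrier fu by (simp add: f_pow)
  also have "(cyc 1 p ^^ j) (p + 1) = p + 1" by (rule cyc_funpow_outside) simp
  also have "(cyc 1 p ^^ j) n = n" using n_bounds by (intro cyc_funpow_outside) simp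
  also have "(cyc 1 p ^^ j) p = 1 + (p - 1 + j) mod p"
    using p3 cyc_funpow[of 1 p p j] by simp
  also have "1 + (p - 1 + j) mod p = (if j = 0 then p else j)"
  proof (cases j)
    case 0
    then show ?thesis using p3 by simp
  next
    case (Suc i)
    then have "p - 1 + j = i + p" using p3 by simp
    then show ?thesis using Suc j by simp
  qed
  finally show ?thesis .
qed

lemma Alt_subset_f_A: "Alt Om \<subseteq> f ` A"
proof (rule Alt_subset_subgroup[OF f_image_subgroup[OF A_subgroup] Om(3-6)])
  fix w assume w: "w \<in> Om" "w \<noteq> p + 1" "w \<noteq> n"
  define j where "j = (if w = p then 0 else w)"
  have "j < p" "w = (if j = 0 then p else j)" using w p3 by (auto simp: j_def Om_def)
  then have "f (cj (u [^] j) z) = tri (p + 1) n w" "cj (u [^] j) z \<in> A"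
    using f_z by (auto simp: A_def intro: generate.incl)
  then show "tri (p + 1) n w \<in> f ` A" by (metis imageI)
qed

text \<open>Two counts meet: \<open>A\<close> has at most half of \<open>(p + 2)!\<close> elements,
  and its image contains the alternating group, which has exactly that many.\<close>

lemma f_A: "f ` A = Alt Om" "inj_on f A"
proof -
  have c: "card A \<le> card (Alt Om)" using A_finite_card(2) card_Alt[OF Om(1)] Om(2) by simp
  then have "card (f ` A) \<le> card (Alt Om)" using card_image_le[OF A_finite_card(1), of f] by simp
  then show eq: "f ` A = Alt Om"
    using card_seteq[OF _ Alt_subset_f_A] A_finite_card(1) by auto
  have "card (f ` A) = card A"
    using c card_image_le[OF A_finite_card(1), of f] unfolding eq by simp
  then show "inj_on f A" by (rule eq_card_imp_inj_on[OF A_finite_card(1)])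
qed

lemma A_eqI: "x \<in> A \<Longrightarrow> x' \<in> A \<Longrightarrow> f x = f x' \<Longrightarrow> x = x'"
  using f_A(2) by (rule inj_onD)

lemma A_eq_one: "x \<in> A \<Longrightarrow> f x = id \<Longrightarrow> x = \<one>"
  using A_eqI[of x \<one>] A_closed(3) f_one by simp

lemma A_ex:
  assumes "\<sigma> \<in> Alt Om" obtains x where "x \<in> A" "f x = \<sigma>"
  using assms unfolding f_A(1)[symmetric] by blast

lemma cj_u_A: "x \<in> A \<Longrightarrow> cj u x \<in> A"
proof -
  assume "x \<in> A"
  then show ?thesis
    unfolding A_def
  proof (rule cj_generate_closed[OF carrier(1) gens A_subgroup[unfolded A_def], rotated])
    fix x assume "x \<in> (\<lambda>j. cj (u [^] j) z) ` {..<p}"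
    then obtain j where j: "j < p" "x = cj (u [^] j) z" by auto
    then have "cj u x = cj (u [^] Suc j) z"
      using carrier nat_pow_Suc2[OF carrier(1), of j] by (simp add: cj_cj)
    moreover have "cj (u [^] Suc j) z \<in> (\<lambda>j. cj (u [^] j) z) ` {..<p}"
    proof (cases "Suc j = p")
      case True
      then have "cj (u [^] Suc j) z = cj (u [^] (0::nat)) z" using up carrier by simp
      then show ?thesis using p3 by (metis imageI lessThan_iff less_le_trans zero_less_numeral)
    next
      case False
      then show ?thesis using j by (metis imageI lessThan_iff Suc_lessI)
    qed
    ultimately show "cj u x \<in> generate G ((\<lambda>j. cj (u [^] j) z) ` {..<p})"
      by (simp add: generate.incl)
  qed
qed

lemma cj_u_pow_A: "x \<in> A \<Longrightarrow> cj (u [^] (j::nat)) x \<in> A"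
  using cj_pow_closed[of u A x] carrier cj_u_A A_carrier by blast

text \<open>The cycle below \<open>t\<close> fixes \<open>1, ..., p\<close> and sends
  \<open>n\<close> to \<open>n\<close> or to \<open>p + 1\<close>, so these letters stay among those
  of \<open>A\<close>. The elements that \<open>t\<close> conjugates into \<open>A\<close> form a
  subgroup; it contains \<open>y\<close> and, since \<open>u\<close> commutes with \<open>t\<close>
  and preserves \<open>A\<close>, also the conjugates of \<open>y\<close> under powers of
  \<open>u\<close>.\<close>

lemma cj_t_A:
  assumes "x \<in> A" "f x \<in> Alt ({1..p} \<union> {n})"
  shows "cj t x \<in> A"
proof -
  let ?B = "{x \<in> A. cj t x \<in> A}"
  have B: "subgroup ?B G"
  proof (rule subgroupI)
    show "?B \<noteq> {}" using y by blast
    show "inv x \<in> ?B" if "x \<in> ?B" for x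
      using that A_closed carrier A_carrier by (auto simp: cj_inv)
    show "x \<otimes> x' \<in> ?B" if "x \<in> ?B" "x' \<in> ?B" for x x'
      using that A_closed carrier A_carrier by (auto simp: cj_mult)
  qed (use A_carrier in auto)
  have "Alt ({1..p} \<union> {n}) \<subseteq> f ` ?B"
  proof (rule Alt_subset_subgroup_consecutive[OF f_image_subgroup[OF B]])
    fix j assume j: "1 \<le> j" "j < p"
    let ?x = "cj (u [^] (j - 1)) y"
    have "f ?x = tri (f (u [^] (j - 1)) 1) (f (u [^] (j - 1)) 2) (f (u [^] (j - 1)) n)"
      using carrier y A_carrier by (intro f_cj_tri) auto
    also have "f (u [^] (j - 1)) = cyc 1 p ^^ (j - 1)" using carrier fu by (simp add: f_pow)
    also have "(cyc 1 p ^^ (j - 1)) n = n" using n_bounds by (auto intro: cyc_funpow_outside)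
    also have "(cyc 1 p ^^ (j - 1)) 1 = j" using j cyc_funpow_add[of 1 1 "j - 1" p] by simp
    also have "(cyc 1 p ^^ (j - 1)) 2 = Suc j" using j cyc_funpow_add[of 1 2 "j - 1" p] by simp
    finally have "f ?x = tri j (Suc j) n" .
    moreover have "?x \<in> ?B"
    proof -
      have "u [^] (j - 1) \<otimes> t = t \<otimes> u [^] (j - 1)" using carrier ut by (intro pow_commute) auto
      then have "cj t ?x = cj (u [^] (j - 1)) (cj t y)"
        using carrier A_carrier[OF y(1)] by (simp add: cj_cj)
      then show ?thesis using cj_u_pow_A y by simp
    qed
    ultimately show "tri j (Suc j) n \<in> f ` ?B" by (metis imageI)
  qed (use p3 n_bounds in auto)
  then have "f x \<in> f ` ?B" using assms(2) by (rule subsetD)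
  then obtain x' where x': "x' \<in> ?B" "f x = f x'" by (elim imageE)
  then have "x = x'" using assms(1) by (intro A_eqI) auto
  then show ?thesis using x' by simp
qed

end

text \<open>Conjugation by \<open>(b \<otimes> t) [^] k\<close> shifts \<open>A\<close> to a second copy \<open>W\<close> of the alternating group on
  \<open>p + 2\<close> letters, which covers \<open>p - 1\<close>, \<open>p\<close> and the support of \<open>t\<close>; the condition on \<open>a\<close> places \<open>t \<otimes> r\<close>
  in \<open>W\<close>. Any two letters lie in a common window up to conjugation by \<open>t\<close>, which yields Carmichael's
  relations for all \<open>n\<close> letters. The factor \<open>r\<close> is only needed to make \<open>t\<close> even.\<close>

locale alternating_extension = alternating_base +
  fixes b a r :: 'a
  assumes r_carrier: "r \<in> carrier G"
    and b: "b \<in> A" "f b \<circ> f t = cyc 1 (2 * n - 1 - M)"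
    and a: "a \<in> A" "t \<otimes> r = cj ((b \<otimes> t) [^] k) a"
    and rt: "r \<otimes> t = t \<otimes> r"
    and r: "\<And>x. x \<in> A \<Longrightarrow> f x = tri p (p - 1) (p + 1) \<Longrightarrow> cj r x = x \<or> cj r x = inv x"
    and tL: "t [^] (M - p) = \<one> \<or> r = \<one>"
begin

abbreviation "c \<equiv> b \<otimes> t"

lemma c_carrier: "c \<in> carrier G"
  using b A_carrier carrier by simp

lemma f_c: "f c = cyc 1 (2 * n - 1 - M)"
  using b A_carrier carrier by (simp add: f_mult)

lemma cj_c_A: "x \<in> A \<Longrightarrow> f x \<in> Alt ({1..p} \<union> {n}) \<Longrightarrow> cj c x \<in> A"
proof -
  assume x: "x \<in> A" "f x \<in> Alt ({1..p} \<union> {n})"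
  have "cj c x = b \<otimes> cj t x \<otimes> inv b"
    using x b A_carrier carrier by (simp add: cj_cj[symmetric]) (simp add: cj_def)
  then show ?thesis using cj_t_A[OF x] b A_closed by simp
qed

text \<open>This element belongs to \<open>A\<close> and to the shifted copy \<open>W\<close>. It is
  the seed whose conjugates under \<open>t\<close> serve the letters moved by
  \<open>t\<close>.\<close>

definition xP :: 'a where "xP = inv_into A f (tri p (p - 1) (p + 1))"

lemma xP: "xP \<in> A" "f xP = tri p (p - 1) (p + 1)"
proof -
  have "tri p (p - 1) (p + 1) \<in> Alt Om" using p3 by (intro tri_in_Alt) (auto simp: Om_def)
  then show "xP \<in> A" "f xP = tri p (p - 1) (p + 1)"
    unfolding xP_def f_A(1)[symmetric] by (auto intro: inv_into_into f_inv_into_f)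
qed

lemma xP_carrier: "xP \<in> carrier G"
  using xP A_carrier by blast

text \<open>Start in \<open>A\<close> with the same cycle, all letters lowered by \<open>k\<close>.
  Each conjugation by \<open>c\<close> raises the letters by one. Before each of the
  \<open>k\<close> conjugations they are at most \<open>p\<close>, so the result stays in
  \<open>A\<close>, and the last one is recognised there by its permutation.\<close>

lemma xP_window: "cj (inv (c [^] k)) xP \<in> A"
proof -
  have "tri (p - k) (p - 1 - k) (p + 1 - k) \<in> Alt Om"
    using k_le by (intro tri_in_Alt) (auto simp: Om_def)
  then obtain s where s: "s \<in> A" "f s = tri (p - k) (p - 1 - k) (p + 1 - k)" by (rule A_ex)
  have "cj (c [^] j) s \<in> A \<and> f (cj (c [^] j) s) = tri (p - k + j) (p - 1 - k + j) (p + 1 - k + j)"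
    if "j \<le> k" for j
    using that
  proof (induction j)
    case 0
    then show ?case using s A_carrier by simp
  next
    case (Suc j)
    let ?x = "cj (c [^] j) s"
    have x: "?x \<in> A" "f ?x = tri (p - k + j) (p - 1 - k + j) (p + 1 - k + j)" using Suc by auto
    have "f ?x \<in> Alt ({1..p} \<union> {n})"
      unfolding x(2) using Suc.prems k_le by (intro tri_in_Alt) auto
    then have "cj c ?x \<in> A" using cj_c_A x by blast
    moreover have "cj c ?x = cj (c [^] Suc j) s"
      using c_carrier s A_carrier nat_pow_Suc2[OF c_carrier, of j] by (simp add: cj_cj)
    moreover have "f (cj c ?x) = tri (f c (p - k + j)) (f c (p - 1 - k + j)) (f c (p + 1 - k + j))"
      using c_carrier x A_carrier by (intro f_cj_tri) auto
    ultimately show ?case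
      using Suc.prems k_le n_bounds M by (auto simp: f_c cyc_def Suc_diff_le)
  qed
  then have eq: "cj (c [^] k) s = xP" using xP k_le by (intro A_eqI) auto
  have "cj (inv (c [^] k)) xP = s"
    unfolding eq[symmetric] using c_carrier A_carrier[OF s(1)] by (intro cj_inv_cj) simp_all
  then show ?thesis using s by simp
qed

definition W :: "'a set" where "W = {x \<in> carrier G. cj (inv (c [^] k)) x \<in> A}"

lemma W_subgroup: "subgroup W G"
proof (rule subgroupI)
  show "W \<noteq> {}" using xP_window xP_carrier by (auto simp: W_def)
  show "inv x \<in> W" if "x \<in> W" for x
    using that A_closed c_carrier by (auto simp: W_def cj_inv)
  show "x \<otimes> x' \<in> W" if "x \<in> W" "x' \<in> W" for x x'
    using that A_closed c_carrier by (auto simp: W_def cj_mult)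
qed (auto simp: W_def)

lemmas W_closed = subgroup.m_closed[OF W_subgroup] subgroup.m_inv_closed[OF W_subgroup]
  subgroup.one_closed[OF W_subgroup]

lemma W_eq_one: "x \<in> W \<Longrightarrow> f x = id \<Longrightarrow> x = \<one>"
proof -
  assume x: "x \<in> W" "f x = id"
  then have xc: "x \<in> carrier G" "cj (inv (c [^] k)) x \<in> A" by (auto simp: W_def)
  have g: "c [^] k \<in> carrier G" using c_carrier by simp
  have "f (cj (inv (c [^] k)) x) = f (inv (c [^] k)) \<circ> f (c [^] k)"
    using xc(1) g x(2) by (simp add: cj_def f_mult)
  also have "\<dots> = f \<one>" using g by (simp flip: f_mult)
  finally have "f (cj (inv (c [^] k)) x) = f \<one>" .
  then have "cj (inv (c [^] k)) x = \<one>" using A_eqI xc A_closed by blast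
  then have "cj (c [^] k) (cj (inv (c [^] k)) x) = \<one>" using g by simp
  then show ?thesis using g xc by simp
qed

lemma W_mem: "xP \<in> W" "t \<otimes> r \<in> W"
  using xP_window xP_carrier a A_carrier c_carrier carrier r_carrier by (auto simp: W_def)

text \<open>It is \<open>t \<otimes> r\<close>, not \<open>t\<close>, that is known to lie in
  \<open>W\<close>. As \<open>r\<close> commutes with \<open>t\<close> and fixes or inverts
  \<open>xP\<close>, conjugating by powers of \<open>t \<otimes> r\<close> or of \<open>t\<close>
  gives the same element up to inversion, which a subgroup tolerates.\<close>

lemma t_pow_xP_W: "cj (t [^] (i::nat)) xP \<in> W"
proof -
  have "cj ((t \<otimes> r) [^] i) xP \<in> W \<and>
    (cj ((t \<otimes> r) [^] i) xP = cj (t [^] i) xP \<or> cj ((t \<otimes> r) [^] i) xP = inv (cj (t [^] i) xP))"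
  proof (induction i)
    case 0
    then show ?case using W_mem xP_carrier by simp
  next
    case (Suc i)
    let ?g = "t \<otimes> r" and ?x = "cj ((t \<otimes> r) [^] i) xP"
    have g: "?g \<in> carrier G" using r_carrier carrier by simp
    have eq: "cj (?g [^] Suc i) xP = cj ?g ?x"
      using g xP_carrier nat_pow_Suc2[OF g, of i] by (simp add: cj_cj)
    have tr: "t [^] i \<otimes> r = r \<otimes> t [^] i" using r_carrier carrier rt by (intro pow_commute) auto
    have "cj ?g (cj (t [^] i) xP) = cj t (cj (r \<otimes> t [^] i) xP)"
      using r_carrier carrier xP_carrier by (simp add: cj_cj m_assoc)
    also have "\<dots> = cj t (cj (t [^] i) (cj r xP))"
      using r_carrier carrier xP_carrier by (simp add: cj_cj tr)
    also have "\<dots> = cj (t [^] Suc i) (cj r xP)"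
      using cj_cj[of t "t [^] i" "cj r xP"] nat_pow_Suc2[OF carrier(2), of i] r_carrier carrier xP_carrier
      by (simp del: nat_pow_Suc)
    finally have "cj ?g (cj (t [^] i) xP) = cj (t [^] Suc i) (cj r xP)" .
    moreover have "cj r xP = xP \<or> cj r xP = inv xP" using r xP by blast
    ultimately have "cj ?g (cj (t [^] i) xP) = cj (t [^] Suc i) xP \<or>
        cj ?g (cj (t [^] i) xP) = inv (cj (t [^] Suc i) xP)"
      using r_carrier carrier xP_carrier by (auto simp: cj_inv simp del: nat_pow_Suc)
    moreover have "cj ?g (inv (cj (t [^] i) xP)) = inv (cj ?g (cj (t [^] i) xP))"
      using g r_carrier carrier xP_carrier by (intro cj_inv) auto
    ultimately have "cj ?g ?x = cj (t [^] Suc i) xP \<or> cj ?g ?x = inv (cj (t [^] Suc i) xP)"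
      using Suc r_carrier carrier xP_carrier by (auto simp del: nat_pow_Suc)
    moreover have "cj ?g ?x \<in> W" unfolding cj_def[of "t \<otimes> r"] using Suc W_mem W_closed by simp
    ultimately show ?case unfolding eq by blast
  qed
  then show ?thesis
    using W_closed r_carrier carrier xP_carrier by (metis cj_closed inv_inv nat_pow_closed)
qed

text \<open>Carmichael's generators for all \<open>n\<close> letters, with the common letters
  \<open>p\<close> and \<open>p - 1\<close>, which \<open>t\<close> fixes. On the support of
  \<open>t\<close> they are defined by conjugation, so that \<open>t\<close> permutes them and they
  fall into \<open>W\<close>; the others are taken from \<open>A\<close>.\<close>

definition xx :: "nat \<Rightarrow> 'a"
  where "xx w = (if p < w \<and> w \<le> M then cj (t [^] (w - p - 1)) xP else inv_into A f (tri p (p - 1) w))"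

abbreviation "I \<equiv> {1..n} - {p - 1, p}"

lemma xx_fixed:
  assumes "w \<in> I" "\<not> (p < w \<and> w \<le> M)"
  shows "xx w \<in> A" "f (xx w) = tri p (p - 1) w" "cj t (xx w) = xx w"
proof -
  have w: "w \<in> {1..p} \<union> {n}" "w \<noteq> p" "w \<noteq> p - 1" using assms M by auto
  then have s: "tri p (p - 1) w \<in> Alt ({1..p} \<union> {n})" using p3 by (intro tri_in_Alt) auto
  moreover have "Alt ({1..p} \<union> {n}) \<subseteq> Alt Om" by (rule Alt_mono) (auto simp: Om_def)
  ultimately have "tri p (p - 1) w \<in> f ` A" using f_A(1) by blast
  then show x: "xx w \<in> A" "f (xx w) = tri p (p - 1) w"
    using assms(2) unfolding xx_def by (auto intro: inv_into_into f_inv_into_f simp del: One_nat_def)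
  have "f (cj t (xx w)) = tri (f t p) (f t (p - 1)) (f t w)"
    using x carrier A_carrier by (intro f_cj_tri) auto
  also have "\<dots> = tri p (p - 1) w" using assms w by (auto simp: ft cyc_def)
  finally show "cj t (xx w) = xx w" using x cj_t_A[of "xx w"] s by (intro A_eqI) auto
qed

lemma f_xx: "w \<in> I \<Longrightarrow> f (xx w) = tri p (p - 1) w"
proof (cases "p < w \<and> w \<le> M")
  case True
  let ?i = "w - p - 1"
  have "f (xx w) = tri (f (t [^] ?i) p) (f (t [^] ?i) (p - 1)) (f (t [^] ?i) (p + 1))"
    using True xP xP_carrier carrier by (auto simp: xx_def simp del: One_nat_def intro!: f_cj_tri)
  also have "f (t [^] ?i) = cyc (p + 1) M ^^ ?i" using carrier ft by (simp add: f_pow)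
  also have "(cyc (p + 1) M ^^ ?i) p = p" by (rule cyc_funpow_outside) simp
  also have "(cyc (p + 1) M ^^ ?i) (p - 1) = p - 1" by (rule cyc_funpow_outside) arith
  also have "(cyc (p + 1) M ^^ ?i) (p + 1) = w" using True cyc_funpow_add[of "p + 1" "p + 1" ?i M] by simp
  finally show ?thesis .
qed (rule xx_fixed)

lemma xx_W: "p < w \<Longrightarrow> w \<le> M \<Longrightarrow> xx w \<in> W"
  using t_pow_xP_W by (simp add: xx_def)

lemma xx_carrier: "w \<in> I \<Longrightarrow> xx w \<in> carrier G"
  using xx_fixed(1)[of w] xx_W[of w] A_carrier by (cases "p < w \<and> w \<le> M") (auto simp: W_def)

lemma xx_cube: "w \<in> I \<Longrightarrow> xx w \<otimes> xx w \<otimes> xx w = \<one>"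
proof -
  assume w: "w \<in> I"
  have ne: "p \<noteq> p - 1" "p - 1 \<noteq> w" "p \<noteq> w" using w p3 by auto
  have "f (xx w \<otimes> xx w \<otimes> xx w) = f (xx w) \<circ> f (xx w) \<circ> f (xx w)"
    using xx_carrier[OF w] by (simp only: f_mult m_closed)
  also have "\<dots> = id" unfolding f_xx[OF w] by (rule tri_cube[OF ne])
  finally have id: "f (xx w \<otimes> xx w \<otimes> xx w) = id" .
  show ?thesis
  proof (cases "p < w \<and> w \<le> M")
    case True
    then have "xx w \<in> W" using xx_W by simp
    then show ?thesis using id by (intro W_eq_one W_closed(1))
  next
    case False
    then have "xx w \<in> A" using xx_fixed(1) w by simp
    then show ?thesis using id by (intro A_eq_one A_closed(1))
  qed
qed

lemma xx_pair:
  assumes "w \<in> I" "w' \<in> I" "w \<noteq> w'"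
  shows "xx w \<otimes> xx w' \<otimes> xx w \<otimes> xx w' = \<one>"
proof -
  have fid: "f (xx w \<otimes> xx w' \<otimes> xx w \<otimes> xx w') = id" if "w \<in> I" "w' \<in> I" "w \<noteq> w'" for w w'
  proof -
    have ne: "distinct [p, p - 1, w, w']" using that p3 by auto
    have "f (xx w \<otimes> xx w' \<otimes> xx w \<otimes> xx w') = f (xx w) \<circ> f (xx w') \<circ> f (xx w) \<circ> f (xx w')"
      using xx_carrier[OF that(1)] xx_carrier[OF that(2)] by (simp only: f_mult m_closed)
    also have "\<dots> = id" unfolding f_xx[OF that(1)] f_xx[OF that(2)] by (rule tri_pair[OF ne])
    finally show ?thesis .
  qed
  \<comment> \<open>A generator for a letter fixed by \<open>t\<close> commutes with
    \<open>t\<close>, so conjugating back by a power of \<open>t\<close> replaces the other one by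
    \<open>xP\<close>, and both are in \<open>A\<close>.\<close>
  have mixed: "xx w \<otimes> xx w' \<otimes> xx w \<otimes> xx w' = \<one>"
    if w: "w \<in> I" "w' \<in> I" "w \<noteq> w'" and 1: "p < w \<and> w \<le> M" and 2: "\<not> (p < w' \<and> w' \<le> M)" for w w'
  proof -
    let ?i = "w - p - 1"
    have x: "xx w' \<in> A" "cj t (xx w') = xx w'" "xx w' \<in> carrier G"
      using xx_fixed[OF w(2) 2] A_carrier by auto
    have "t [^] ?i \<otimes> xx w' = xx w' \<otimes> t [^] ?i"
      using x carrier cj_eq_iff by (intro pow_commute) auto
    then have t': "cj (t [^] ?i) (xx w') = xx w'" using x carrier cj_eq_iff by auto
    have ne: "distinct [p, p - 1, p + 1, w']" using w 2 p3 n_bounds by auto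
    have "f (xP \<otimes> xx w' \<otimes> xP \<otimes> xx w') = f xP \<circ> f (xx w') \<circ> f xP \<circ> f (xx w')"
      using xP_carrier x(3) by (simp only: f_mult m_closed)
    also have "\<dots> = id" unfolding f_xx[OF w(2)] xP(2) by (rule tri_pair[OF ne])
    finally have "f (xP \<otimes> xx w' \<otimes> xP \<otimes> xx w') = id" .
    then have *: "xP \<otimes> xx w' \<otimes> xP \<otimes> xx w' = \<one>"
      using xP(1) x(1) by (intro A_eq_one A_closed(1))
    have "xx w \<otimes> xx w' \<otimes> xx w \<otimes> xx w' = cj (t [^] ?i) (xP \<otimes> xx w' \<otimes> xP \<otimes> xx w')"
      using 1 carrier xP_carrier x(3) t' by (simp add: xx_def[of w] cj_mult)
    then show ?thesis unfolding * using carrier by simp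
  qed
  consider "p < w \<and> w \<le> M" "p < w' \<and> w' \<le> M" | "\<not> (p < w \<and> w \<le> M)" "\<not> (p < w' \<and> w' \<le> M)"
    | "p < w \<and> w \<le> M" "\<not> (p < w' \<and> w' \<le> M)" | "\<not> (p < w \<and> w \<le> M)" "p < w' \<and> w' \<le> M"
    by blast
  then show ?thesis
  proof cases
    case 1
    then have "xx w \<in> W" "xx w' \<in> W" using xx_W by simp_all
    then show ?thesis using fid[OF assms] by (intro W_eq_one W_closed(1))
  next
    case 2
    then have "xx w \<in> A" "xx w' \<in> A" using xx_fixed(1) assms by simp_all
    then show ?thesis using fid[OF assms] by (intro A_eq_one A_closed(1))
  next
    case 3
    then show ?thesis using mixed assms by blast
  next
    case 4
    then show ?thesis
      using mixed[of w' w] assms xx_carrier by (simp add: pair_swap(1)[of "xx w'" "xx w"])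
  qed
qed

section \<open>The subgroup generated for all letters, and its normality\<close>

definition N :: "'a set" where "N = generate G (xx ` I)"

lemma N_finite_card: "finite N" "2 * card N \<le> fact n"
proof -
  have "finite N \<and> 2 * card N \<le> fact (card I + 2)"
    unfolding N_def using xx_carrier xx_cube xx_pair by (intro carmichael_bound) auto
  moreover have "card I + 2 = n"
  proof -
    have "card I = card {1..n} - card {p - 1, p}" using p3 n_bounds by (intro card_Diff_subset) auto
    then show ?thesis using p3 n_bounds by simp
  qed
  ultimately show "finite N" "2 * card N \<le> fact n" by metis+
qed

lemma xx_image: "xx ` I \<subseteq> carrier G"
  using xx_carrier by (rule image_subsetI)

lemma N_subgroup: "subgroup N G"
  unfolding N_def by (rule generate_is_subgroup[OF xx_image])

lemma N_carrier: "x \<in> N \<Longrightarrow> x \<in> carrier G"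
  using subgroup.subset[OF N_subgroup] by blast

lemma xx_N: "w \<in> I \<Longrightarrow> xx w \<in> N"
  by (simp add: N_def generate.incl)

lemma xx_P: "xx (p + 1) = xP" "p + 1 \<in> I"
  using n_bounds xP_carrier by (auto simp: xx_def)

text \<open>If \<open>r\<close> is trivial, then \<open>t\<close> itself lies in \<open>W\<close>,
  where an element over the identity is trivial.\<close>

lemma t_pow_L: "t [^] (M - p) = \<one>"
  using tL
proof
  assume "r = \<one>"
  then have "t \<in> W" using W_mem carrier by simp
  then have "t [^] i \<in> W" for i :: nat using W_closed by (induction i) auto
  moreover have "f (t [^] (M - p)) = id"
    using carrier cyc_funpow_length[of "p + 1" M] n_bounds by (simp add: f_pow ft Suc_diff_Suc)
  ultimately show ?thesis using W_eq_one by blast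
qed

text \<open>For \<open>M = n\<close> the letter \<open>n\<close> belongs to the support of
  \<open>t\<close>, and \<open>xx n\<close> is a conjugate of \<open>xP\<close> by definition. One
  more application of \<open>t\<close> closes the cycle: the element of \<open>A\<close> over
  \<open>(p p-1 n)\<close> is conjugated by \<open>t\<close> to \<open>xP\<close>, and
  \<open>t [^] (M - p) = \<one>\<close> identifies it with \<open>xx n\<close>.\<close>

lemma xx_n: "xx n \<in> A"
proof (cases "M = n")
  case True
  have "tri p (p - 1) n \<in> Alt Om" using p3 n_bounds by (intro tri_in_Alt) (auto simp: Om_def)
  then obtain x where x: "x \<in> A" "f x = tri p (p - 1) n" by (rule A_ex)
  have xc: "x \<in> carrier G" using x A_carrier by blast
  have "f x \<in> Alt ({1..p} \<union> {n})" unfolding x(2) using p3 n_bounds by (intro tri_in_Alt) auto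
  then have "cj t x \<in> A" using cj_t_A x by blast
  moreover have "f (cj t x) = tri (f t p) (f t (p - 1)) (f t n)"
    using x carrier A_carrier by (intro f_cj_tri) auto
  moreover have "\<dots> = tri p (p - 1) (p + 1)" using True n_bounds p3 by (auto simp: ft cyc_def)
  ultimately have "cj t x = xP" using xP by (intro A_eqI) auto
  then have "xx n = cj (t [^] (n - p - 1)) (cj t x)"
    using True n_bounds unfolding xx_def by simp
  also have "\<dots> = cj (t [^] (n - p - 1) \<otimes> t) x" using carrier xc by (simp add: cj_cj)
  also have "t [^] (n - p - 1) \<otimes> t = t [^] Suc (n - p - 1)" by simp
  also have "Suc (n - p - 1) = M - p" using True n_bounds by simp
  finally show ?thesis using t_pow_L x xc by simp
next
  case False
  then show ?thesis using M n_bounds p3 by (intro xx_fixed) auto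
qed

text \<open>The generators \<open>xx w\<close> for the letters of \<open>Om\<close> all lie in
  \<open>A\<close>. Hence \<open>A \<inter> N\<close> already has the full image, and injectivity on
  \<open>A\<close> does the rest.\<close>

lemma A_subset_N: "A \<subseteq> N"
proof
  fix x assume x: "x \<in> A"
  have "Alt Om \<subseteq> f ` (A \<inter> N)"
  proof (rule Alt_subset_subgroup[OF f_image_subgroup[OF subgroups_Inter_pair[OF A_subgroup N_subgroup]] Om(3), of p "p - 1"])
    fix w assume w: "w \<in> Om" "w \<noteq> p" "w \<noteq> p - 1"
    then have wI: "w \<in> I" using Om(3) by auto
    have "w \<le> p \<or> w = p + 1 \<or> w = n" using w by (auto simp: Om_def)
    then consider "w \<le> p" | "w = p + 1" | "w = n" by blast
    then have "xx w \<in> A"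
    proof cases
      case 1
      then show ?thesis using wI by (intro xx_fixed) auto
    next
      case 2
      then show ?thesis using xx_P xP by simp
    next
      case 3
      then show ?thesis using xx_n by simp
    qed
    then have "xx w \<in> A \<inter> N" using xx_N wI by blast
    then show "tri p (p - 1) w \<in> f ` (A \<inter> N)" using f_xx[OF wI] by (metis imageI)
  qed (use p3 in \<open>auto simp: Om_def\<close>)
  moreover have "f x \<in> Alt Om" using f_A(1) x by blast
  ultimately have "f x \<in> f ` (A \<inter> N)" by (rule subsetD)
  then obtain x' where x': "x' \<in> A \<inter> N" "f x = f x'" by (elim imageE)
  then have "x = x'" using x by (intro A_eqI) auto
  then show "x \<in> N" using x' by simp
qed

lemma cj_t_N: "x \<in> N \<Longrightarrow> cj t x \<in> N"
proof -
  assume "x \<in> N"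
  show ?thesis
  proof (rule cj_generate_closed[OF carrier(2) xx_image N_subgroup])
    show "x \<in> generate G (xx ` I)" using \<open>x \<in> N\<close> by (simp add: N_def)
    fix x assume "x \<in> xx ` I"
    then obtain w where w: "w \<in> I" "x = xx w" by blast
    show "cj t x \<in> N"
    proof (cases "p < w \<and> w \<le> M")
      case True
      have "cj t x = cj (t \<otimes> t [^] (w - p - 1)) xP"
        using True w carrier xP_carrier by (simp add: xx_def cj_cj)
      also have "t \<otimes> t [^] (w - p - 1) = t [^] Suc (w - p - 1)"
        using nat_pow_Suc2[OF carrier(2)] by simp
      finally have *: "cj t x = cj (t [^] Suc (w - p - 1)) xP" .
      show ?thesis
      proof (cases "w = M")
        case eq: True
        then have "Suc (w - p - 1) = M - p" using True by simp
        then have "cj t x = xP" using * t_pow_L xP_carrier by simp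
        then show ?thesis using xx_P xx_N[of "p + 1"] by simp
      next
        case False
        then have "cj t x = xx (Suc w)" using * True by (simp add: xx_def Suc_diff_Suc Suc_diff_le)
        then show ?thesis using xx_N[of "Suc w"] True False n_bounds by auto
      qed
    next
      case False
      then show ?thesis using w xx_fixed(3) xx_N by simp
    qed
  qed
qed

text \<open>The group \<open>A\<close> is invariant under \<open>u\<close> and contained in
  \<open>N\<close>; the other generators are conjugates of \<open>xP\<close> under powers of
  \<open>t\<close>, which commute with \<open>u\<close>.\<close>

lemma cj_u_N: "x \<in> N \<Longrightarrow> cj u x \<in> N"
proof -
  assume "x \<in> N"
  show ?thesis
  proof (rule cj_generate_closed[OF carrier(1) xx_image N_subgroup])
    show "x \<in> generate G (xx ` I)" using \<open>x \<in> N\<close> by (simp add: N_def)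
    fix x assume "x \<in> xx ` I"
    then obtain w where w: "w \<in> I" "x = xx w" by blast
    show "cj u x \<in> N"
    proof (cases "p < w \<and> w \<le> M")
      case True
      let ?i = "w - p - 1"
      have "t [^] ?i \<otimes> u = u \<otimes> t [^] ?i" using carrier ut by (intro pow_commute) auto
      then have "cj u x = cj (t [^] ?i) (cj u xP)"
        using True w carrier xP_carrier by (simp add: xx_def cj_cj)
      moreover have "cj u xP \<in> N" by (rule subsetD[OF A_subset_N cj_u_A[OF xP(1)]])
      then have "cj (t [^] ?i) (cj u xP) \<in> N"
        using carrier(2) cj_t_N subgroup.subset[OF N_subgroup] by (intro cj_pow_closed) simp_all
      ultimately show ?thesis by simp
    next
      case False
      then have "xx w \<in> A" using w by (intro xx_fixed)
      then show ?thesis unfolding w(2) by (rule subsetD[OF A_subset_N cj_u_A])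
    qed
  qed
qed

text \<open>Both \<open>b\<close> and \<open>a\<close> belong to \<open>N\<close>, and
  \<open>N\<close> is invariant under \<open>b\<close> and \<open>t\<close>, hence under
  \<open>c\<close>.\<close>

lemma tr_N: "t \<otimes> r \<in> N"
proof -
  have b': "b \<in> N" by (rule subsetD[OF A_subset_N b(1)])
  have "cj c x \<in> N" if "x \<in> N" for x
  proof -
    have "cj c x = b \<otimes> cj t x \<otimes> inv b"
      using that N_carrier[OF that] N_carrier[OF b'] carrier by (simp add: cj_cj[symmetric]) (simp add: cj_def)
    then show ?thesis using cj_t_N[OF that] b' subgroup.m_closed[OF N_subgroup] subgroup.m_inv_closed[OF N_subgroup]
      by simp
  qed
  then show ?thesis
    unfolding a(2) using subsetD[OF A_subset_N a(1)] subgroup.subset[OF N_subgroup] c_carrier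
    by (intro cj_pow_closed) simp_all
qed

lemma z_N: "z \<in> N"
proof (rule subsetD[OF A_subset_N])
  have "cj (u [^] (0::nat)) z \<in> A"
    unfolding A_def by (rule generate.incl) (use p3 in \<open>auto intro!: image_eqI[of _ _ 0]\<close>)
  then show "z \<in> A" using carrier by simp
qed

lemma normal_N:
  assumes gen: "carrier G = generate G {u \<otimes> t, z}"
  shows "N \<lhd> G"
proof (rule normal_invI[OF N_subgroup])
  note zN = z_N
  \<comment> \<open>Because \<open>u\<close> and \<open>t\<close> have finite order, their inverses
    are positive powers, so invariance under \<open>u\<close> and \<open>t\<close> also gives
    invariance under the inverse of \<open>u \<otimes> t\<close>.\<close>
  have inv_pow: "inv g = g [^] (m - 1)" if "g \<in> carrier G" "g [^] m = \<one>" "0 < m" for g and m :: nat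
    using that nat_pow_Suc[of g "m - 1"] by (intro inv_equality) auto
  have iu: "inv u = u [^] (p - 1)" using inv_pow[OF carrier(1) up] p3 by simp
  have it: "inv t = t [^] (M - p - 1)" using inv_pow[OF carrier(2) t_pow_L] n_bounds by simp
  have pow: "cj (u [^] i) x \<in> N" "cj (t [^] i) x \<in> N" if "x \<in> N" for i :: nat and x
    using cj_pow_closed[of u N x i] cj_pow_closed[of t N x i] cj_u_N cj_t_N carrier that
      subgroup.subset[OF N_subgroup] by simp_all
  have "cj g x \<in> N" if "g \<in> generate G {u \<otimes> t, z}" "x \<in> N" for g x
    using that
  proof (induction g arbitrary: x rule: generate.induct)
    case one
    then show ?case using N_carrier by simp
  next
    case (incl g)
    then have "g = u \<otimes> t \<or> g = z" by simp
    then show ?case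
    proof
      assume g: "g = u \<otimes> t"
      have "cj g x = cj u (cj t x)" unfolding g using carrier N_carrier[OF incl(2)] by (simp add: cj_cj)
      then show ?thesis using cj_u_N cj_t_N incl(2) by simp
    qed (use zN incl subgroup.m_closed[OF N_subgroup] subgroup.m_inv_closed[OF N_subgroup] in \<open>simp add: cj_def\<close>)
  next
    case (inv g)
    then have "g = u \<otimes> t \<or> g = z" by simp
    then show ?case
    proof
      assume g: "g = u \<otimes> t"
      have "cj (inv g) x = cj (inv t) (cj (inv u) x)"
        unfolding g using carrier N_carrier[OF inv(2)] by (simp add: cj_cj inv_mult_group)
      also have "\<dots> = cj (t [^] (M - p - 1)) (cj (u [^] (p - 1)) x)" by (simp only: iu it)
      finally have "cj (inv g) x = cj (t [^] (M - p - 1)) (cj (u [^] (p - 1)) x)" .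
      then show ?thesis using pow inv(2) by simp
    qed (use zN inv subgroup.m_closed[OF N_subgroup] subgroup.m_inv_closed[OF N_subgroup] N_carrier in \<open>simp add: cj_def\<close>)
  next
    case (eng g h)
    have "g \<in> carrier G" "h \<in> carrier G" using eng gen by auto
    then have "cj (g \<otimes> h) x = cj g (cj h x)" using N_carrier[OF eng(5)] by (simp add: cj_cj)
    then show ?case using eng by simp
  qed
  then show "g \<otimes> x \<otimes> inv g \<in> N" if "g \<in> carrier G" "x \<in> N" for g x
    using that gen by (simp add: cj_def)
qed

text \<open>Modulo \<open>N\<close> the group is generated by the image of \<open>u \<otimes> t\<close>, hence abelian.\<close>

lemma u_commutes_mod_N:
  assumes gen: "carrier G = generate G {u \<otimes> t, z}" and "g \<in> carrier G"
  shows "cj g u \<otimes> inv u \<in> N"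
proof -
  interpret N: normal N G by (rule normal_N[OF gen])
  have cj: "cj g x \<in> N" if "g \<in> carrier G" "x \<in> N" for g x
    using that N.inv_op_closed2 by (simp add: cj_def)
  have base: "cj g u \<otimes> inv u \<in> N" if "g = u \<otimes> t \<or> g = z" for g
    using that
  proof
    assume g: "g = u \<otimes> t"
    have "u \<otimes> t \<otimes> u = u \<otimes> (u \<otimes> t)" using carrier by (simp add: m_assoc flip: ut)
    then have "cj g u = u" unfolding g using carrier cj_eq_iff by simp
    then show ?thesis using carrier by simp
  next
    assume "g = z"
    then have "cj g u \<otimes> inv u = z \<otimes> cj u (inv z)" using carrier by (simp add: cj_def m_assoc)
    then show ?thesis using z_N cj carrier by simp
  qed
  have "cj g u \<otimes> inv u \<in> N" if "g \<in> generate G {u \<otimes> t, z}" for g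
    using that
  proof (induction g rule: generate.induct)
    case one
    then show ?case using carrier by simp
  next
    case (incl g)
    then show ?case using base by simp
  next
    case (inv g)
    then have g: "g \<in> carrier G" using carrier by auto
    have "cj (inv g) u \<otimes> inv u = cj (inv g) (u \<otimes> cj g (inv u))"
      using g carrier by (simp add: cj_mult)
    also have "u \<otimes> cj g (inv u) = inv (cj g u \<otimes> inv u)"
      using g carrier by (simp add: inv_mult_group cj_inv)
    finally show ?case using cj[of "inv g" "inv (cj g u \<otimes> inv u)"] g base[of g] inv by simp
  next
    case (eng g h)
    have c: "g \<in> carrier G" "h \<in> carrier G" using eng gen by auto
    have X: "cj h u = (cj h u \<otimes> inv u) \<otimes> u" using c carrier by (simp add: m_assoc)
    have "cj (g \<otimes> h) u = cj g (cj h u)" using c carrier by (simp add: cj_cj)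
    also have "\<dots> = cj g ((cj h u \<otimes> inv u) \<otimes> u)" by (simp only: X[symmetric])
    also have "\<dots> = cj g (cj h u \<otimes> inv u) \<otimes> cj g u" using c carrier by (intro cj_mult) auto
    finally have "cj (g \<otimes> h) u \<otimes> inv u = cj g (cj h u \<otimes> inv u) \<otimes> (cj g u \<otimes> inv u)"
      using c carrier by (simp add: m_assoc)
    then show ?case using cj[OF c(1)] eng by simp
  qed
  then show ?thesis using assms by blast
qed

text \<open>Modulo \<open>N\<close> the element \<open>u\<close> is central, so
  \<open>h u = u [^] s h\<close> becomes \<open>u [^] (s - 1) = \<one>\<close> there. Together with
  \<open>u [^] p = \<one>\<close> and a Bezout relation this puts \<open>u\<close> into
  \<open>N\<close>.\<close>

lemma u_N:
  assumes gen: "carrier G = generate G {u \<otimes> t, z}"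
    and h: "h \<in> carrier G" "h \<otimes> u = u [^] s \<otimes> h" and s: "1 < s" "coprime (s - 1) p"
  shows "u \<in> N"
proof -
  have "cj h u = u [^] s" using h carrier by (simp add: cj_def m_assoc)
  then have "u [^] s \<otimes> inv u \<in> N" using u_commutes_mod_N[OF gen h(1)] by simp
  moreover have "u [^] s \<otimes> inv u = u [^] (s - 1)"
    using carrier s nat_pow_Suc[of u "s - 1"] by (simp add: m_assoc del: nat_pow_Suc)
  ultimately have us: "u [^] (s - 1) \<in> N" by simp
  obtain i j where "(s - 1) * i = p * j + 1"
  proof -
    have "s - 1 \<noteq> 0" "gcd (s - 1) p = 1" using s(1) coprime_imp_gcd_eq_1[OF s(2)] by simp_all
    then show thesis using bezout_nat[of "s - 1" p] that by metis
  qed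
  then have "(u [^] (s - 1)) [^] i = (u [^] p) [^] j \<otimes> u"
    using carrier by (simp add: nat_pow_pow)
  then have "(u [^] (s - 1)) [^] i = u" using up carrier by simp
  moreover have "(u [^] (s - 1)) [^] i \<in> N"
    using us subgroup.m_closed[OF N_subgroup] subgroup.one_closed[OF N_subgroup] by (induction i) auto
  ultimately show ?thesis by simp
qed

lemma carrier_bound_even:
  assumes gen: "carrier G = generate G {u \<otimes> t, z}" and "u \<in> N" "r = \<one>"
  shows "finite (carrier G) \<and> 2 * card (carrier G) \<le> fact n"
proof -
  have "t \<in> N" using tr_N assms(3) carrier by simp
  then have "u \<otimes> t \<in> N" using assms(2) subgroup.m_closed[OF N_subgroup] by blast
  then have "carrier G \<subseteq> N"
    unfolding gen using z_N by (intro generate_subgroup_incl[OF _ N_subgroup]) auto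
  then have "carrier G = N" using subgroup.subset[OF N_subgroup] by blast
  then show ?thesis using N_finite_card by simp
qed

text \<open>Modulo \<open>N\<close> the factor \<open>r\<close> equals \<open>t\<close>, so
  \<open>t \<otimes> r \<in> N\<close> says that the square of \<open>t\<close> lies in
  \<open>N\<close>, and the group is covered by \<open>N\<close> and the coset of
  \<open>t\<close>.\<close>

lemma carrier_bound_odd:
  assumes gen: "carrier G = generate G {u \<otimes> t, z}" and "u \<in> N"
    and r: "r = t \<otimes> v \<otimes> v'" "v \<in> N" "v' \<in> N"
  shows "finite (carrier G) \<and> card (carrier G) \<le> fact n"
proof -
  interpret N: normal N G by (rule normal_N[OF gen])
  have [simp]: "u \<in> carrier G" "t \<in> carrier G" "z \<in> carrier G" using carrier by auto
  have tt: "t \<otimes> t \<in> N"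
  proof -
    have "t \<otimes> r \<otimes> inv (v \<otimes> v') = t \<otimes> t"
      using r N_carrier by (simp add: m_assoc inv_mult_group)
    moreover have "t \<otimes> r \<otimes> inv (v \<otimes> v') \<in> N" using tr_N r by simp
    ultimately show ?thesis by simp
  qed
  have cj_t: "x \<in> N \<Longrightarrow> t \<otimes> x \<otimes> inv t \<in> N" for x using N.inv_op_closed2 by simp
  let ?S = "N \<union> (\<lambda>x. x \<otimes> t) ` N"
  have "generate G {u \<otimes> t, z} \<subseteq> ?S"
  proof (rule generate_subset_right_closed)
    have t_right: "x \<otimes> t \<otimes> x' \<in> ?S" if "x \<in> N" "x' \<in> N" for x x'
    proof -
      have "x \<otimes> t \<otimes> x' = x \<otimes> (t \<otimes> x' \<otimes> inv t) \<otimes> t"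
        using that N_carrier by (simp add: m_assoc)
      then show ?thesis using cj_t that by simp
    qed
    have right: "s \<otimes> x \<in> ?S" if "s \<in> ?S" "x \<in> N" for s x
      using that t_right by auto
    have rt: "s \<otimes> t \<in> ?S" if "s \<in> ?S" for s
      using that tt N_carrier by (auto simp: m_assoc)
    have rt': "s \<otimes> inv t \<in> ?S" if s: "s \<in> ?S" for s
    proof -
      have sc: "s \<in> carrier G" using s N_carrier by auto
      have "s \<otimes> inv t = s \<otimes> inv (t \<otimes> t) \<otimes> t" using sc by (simp add: m_assoc inv_mult_group)
      moreover have "s \<otimes> inv (t \<otimes> t) \<in> ?S" using right s tt by simp
      ultimately show ?thesis using rt by metis
    qed
    fix s x assume s: "s \<in> ?S" and x: "x \<in> {u \<otimes> t, z}"
    have sc: "s \<in> carrier G" using s N_carrier by auto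
    from x have "x = u \<otimes> t \<or> x = z" by simp
    then show "s \<otimes> x \<in> ?S"
    proof
      assume "x = u \<otimes> t"
      moreover have "s \<otimes> u \<otimes> t \<in> ?S" by (rule rt[OF right[OF s assms(2)]])
      moreover have "s \<otimes> (u \<otimes> t) = s \<otimes> u \<otimes> t" using sc by (simp add: m_assoc)
      ultimately show ?thesis by (simp only:)
    next
      assume "x = z"
      then show ?thesis using right[OF s z_N] by (simp only:)
    qed
    from x have "x = u \<otimes> t \<or> x = z" by simp
    then show "s \<otimes> inv x \<in> ?S"
    proof
      assume x: "x = u \<otimes> t"
      have "s \<otimes> inv t \<otimes> inv u \<in> ?S" by (rule right[OF rt'[OF s] N.m_inv_closed[OF assms(2)]])
      moreover have "s \<otimes> inv x = s \<otimes> inv t \<otimes> inv u" using sc x by (simp add: m_assoc inv_mult_group)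
      ultimately show ?thesis by (simp only:)
    next
      assume "x = z"
      then show ?thesis using right[OF s N.m_inv_closed[OF z_N]] by (simp only:)
    qed
  qed (use N_carrier in auto)
  then have *: "carrier G \<subseteq> ?S" using gen by simp
  have fin: "finite ?S" using N_finite_card by simp
  have "card (carrier G) \<le> card ?S" by (rule card_mono[OF fin *])
  also have "\<dots> \<le> card N + card ((\<lambda>x. x \<otimes> t) ` N)" by (rule card_Un_le)
  also have "\<dots> \<le> 2 * card N" using card_image_le[OF N_finite_card(1), of "\<lambda>x. x \<otimes> t"] by simp
  finally show ?thesis using N_finite_card finite_subset[OF * fin] by simp
qed

end

section \<open>Presentations with few cosets\<close>

definition eval_letter :: "('g, 'm) monoid_scheme \<Rightarrow> ('x \<Rightarrow> 'g) \<Rightarrow> 'x \<times> bool \<Rightarrow> 'g"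
  where "eval_letter G f l = (if snd l then f (fst l) else inv\<^bsub>G\<^esub> f (fst l))"

text \<open>On reduced words this is the homomorphism from the free group that extends
  \<open>f\<close>; it is defined on unreduced words too, so that invariance under reduction can be
  stated.\<close>

definition eval_word :: "('g, 'm) monoid_scheme \<Rightarrow> ('x \<Rightarrow> 'g) \<Rightarrow> 'x word \<Rightarrow> 'g"
  where "eval_word G f w = foldr (\<lambda>l g. eval_letter G f l \<otimes>\<^bsub>G\<^esub> g) w \<one>\<^bsub>G\<^esub>"

lemma eval_word_simps [simp]:
  "eval_word G f [] = \<one>\<^bsub>G\<^esub>"
  "eval_word G f (l # w) = eval_letter G f l \<otimes>\<^bsub>G\<^esub> eval_word G f w"
  by (simp_all add: eval_word_def)

context group
begin

lemma eval_letter_closed: "f ` X \<subseteq> carrier G \<Longrightarrow> fst l \<in> X \<Longrightarrow> eval_letter G f l \<in> carrier G"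
  by (auto simp: eval_letter_def)

lemma eval_word_closed: "f ` X \<subseteq> carrier G \<Longrightarrow> fst ` set w \<subseteq> X \<Longrightarrow> eval_word G f w \<in> carrier G"
  by (induction w) (auto simp: eval_letter_closed)

lemma eval_word_append:
  "f ` X \<subseteq> carrier G \<Longrightarrow> fst ` set v \<subseteq> X \<Longrightarrow> fst ` set w \<subseteq> X \<Longrightarrow>
    eval_word G f (v @ w) = eval_word G f v \<otimes> eval_word G f w"
  by (induction v) (auto simp: m_assoc eval_letter_closed eval_word_closed)

lemma eval_push_letter:
  assumes "f ` X \<subseteq> carrier G" "fst l \<in> X" "fst ` set w \<subseteq> X"
  shows "eval_word G f (push_letter l w) = eval_letter G f l \<otimes> eval_word G f w"
proof (cases w)
  case (Cons m v)
  show ?thesis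
  proof (cases "m = inv_letter l")
    case True
    have v: "eval_word G f v \<in> carrier G" and l: "f (fst l) \<in> carrier G"
      using assms Cons by (auto intro: eval_word_closed)
    then have "eval_letter G f l \<otimes> (eval_letter G f m \<otimes> eval_word G f v) = eval_word G f v"
      by (auto simp: True eval_letter_def inv_letter_def simp flip: m_assoc)
    then show ?thesis using Cons True by simp
  qed (use Cons in simp)
qed simp

lemma eval_free_reduce:
  assumes "f ` X \<subseteq> carrier G"
  shows "fst ` set w \<subseteq> X \<Longrightarrow> eval_word G f (free_reduce w) = eval_word G f w"
proof (induction w)
  case (Cons l w)
  then have "fst ` set (free_reduce w) \<subseteq> X" using letters_free_reduce[of w] by auto
  with Cons show ?case using eval_push_letter[OF assms, of l "free_reduce w"]
    by (simp add: free_reduce_def)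
qed (simp add: free_reduce_def)

lemma eval_word_hom:
  assumes "f ` X \<subseteq> carrier G"
  shows "eval_word G f \<in> hom (free_group X) G"
proof (rule homI)
  fix v w assume "v \<in> carrier (free_group X)" "w \<in> carrier (free_group X)"
  then show "eval_word G f (v \<otimes>\<^bsub>free_group X\<^esub> w) = eval_word G f v \<otimes> eval_word G f w"
    using assms eval_free_reduce[of f X "v @ w"] by (simp add: free_group_def eval_word_append image_Un)
qed (use assms in \<open>auto simp: free_group_def intro: eval_word_closed\<close>)

lemma eval_word_generator: "f x \<in> carrier G \<Longrightarrow> eval_word G f [(x, True)] = f x"
  by (simp add: eval_letter_def)

lemma eval_word_replicate:
  assumes "f x \<in> carrier G"
  shows "eval_word G f (replicate m (x, True)) = f x [^] m"
proof (induction m)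
  case (Suc m)
  then show ?case using assms nat_pow_Suc2[of "f x" m] by (simp add: eval_letter_def)
qed simp

end

section \<open>Generators and kernels of the free group\<close>

lemma generator_in_free_group: "x \<in> X \<Longrightarrow> [(x, True)] \<in> carrier (free_group X)"
  by (simp add: free_group_def)

lemma generate_free_group:
  "generate (free_group X) ((\<lambda>x. [(x, True)]) ` X) = carrier (free_group X)"
proof
  interpret F: group "free_group X" by (rule group_free_group)
  let ?g = "(\<lambda>x. [(x, True)]) ` X"
  have g: "?g \<subseteq> carrier (free_group X)" by (auto intro: generator_in_free_group)
  then show "generate (free_group X) ?g \<subseteq> carrier (free_group X)" by (rule F.generate_incl)
  have "w \<in> generate (free_group X) ?g" if "reduced w" "fst ` set w \<subseteq> X" for w
    using that
  proof (induction w)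
    case Nil
    then show ?case using generate.one[of "free_group X" ?g] by (simp add: free_group_def)
  next
    case (Cons l w)
    then have w: "w \<in> generate (free_group X) ?g" using reduced_ConsD[OF Cons.prems(1)] by auto
    have l: "[l] \<in> generate (free_group X) ?g"
    proof (cases l)
      case (Pair x s)
      then have x: "x \<in> X" using Cons by auto
      have "inv\<^bsub>free_group X\<^esub> [(x, True)] = [(x, False)]"
        using x by (intro F.inv_equality) (auto simp: free_group_def free_reduce_def inv_letter_def)
      then show ?thesis
        using x Pair generate.incl[of "[(x, True)]" ?g] generate.inv[of "[(x, True)]" ?g "free_group X"]
        by (cases s) auto
    qed
    have "push_letter l w = l # w" using Cons.prems by (cases w) auto
    moreover have "free_reduce w = w" using Cons.prems reduced_ConsD free_reduce_reduced by blast
    ultimately have "[l] \<otimes>\<^bsub>free_group X\<^esub> w = l # w"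
      by (simp add: free_group_def free_reduce_def)
    then show ?case using generate.eng[OF l w] by simp
  qed
  then show "carrier (free_group X) \<subseteq> generate (free_group X) ?g"
    by (auto simp: free_group_def)
qed

text \<open>Powers of one generator whose exponents are multiples of the group order. They guarantee
  a supply of additional relators when a presentation has to be padded.\<close>

lemma infinite_kernel_free_group:
  assumes "group G" "finite (carrier G)" "f ` X \<subseteq> carrier G" "X \<noteq> {}"
  shows "infinite (kernel (free_group X) G (eval_word G f))"
proof -
  interpret group G by fact
  obtain x where x: "x \<in> X" using assms by blast
  then have fx: "f x \<in> carrier G" using assms by blast
  have red: "reduced (replicate m (x, True))" for m
  proof (induction m)
    case (Suc m)
    then show ?case by (cases m) (auto simp: inv_letter_def)
  qed simp
  let ?w = "\<lambda>i. replicate (order G * i) (x, True)"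
  have "?w i \<in> kernel (free_group X) G (eval_word G f)" for i
  proof -
    have "eval_word G f (?w i) = (f x [^]\<^bsub>G\<^esub> order G) [^]\<^bsub>G\<^esub> i"
      using fx eval_word_replicate[of f x, OF fx] by (simp add: nat_pow_pow)
    also have "\<dots> = \<one>\<^bsub>G\<^esub>" using pow_order_eq_1[OF fx] by simp
    finally show ?thesis using red x by (auto simp: kernel_def free_group_def)
  qed
  moreover have "inj ?w"
  proof (rule injI)
    fix i j assume "?w i = ?w j"
    then have "order G * i = order G * j" by (metis length_replicate)
    then show "i = j" using assms(2) order_gt_0_iff_finite by simp
  qed
  ultimately show ?thesis
    by (meson finite_imageD finite_subset image_subsetI infinite_UNIV_nat)
qed

lemma normal_closure_mono: "R \<subseteq> R' \<Longrightarrow> normal_closure F R \<subseteq> normal_closure F R'"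
  by (auto simp: normal_closure_def)

lemma normal_closure_subset: "N \<lhd> F \<Longrightarrow> R \<subseteq> N \<Longrightarrow> normal_closure F R \<subseteq> N"
  by (auto simp: normal_closure_def)

lemma subset_normal_closure: "R \<subseteq> normal_closure F R"
  by (auto simp: normal_closure_def)

text \<open>The quotient by the normal closure maps onto \<open>G\<close>. With at most as many
  cosets as \<open>G\<close> has elements this map is injective, so the normal closure is the whole
  kernel; enlarging the relators within the kernel keeps it so and reaches the exact number
  \<open>m\<close>.\<close>

lemma presentation_via_if_few_cosets:
  assumes G: "group G" "finite (carrier G)" and f: "f ` X \<subseteq> carrier G" and "X \<noteq> {}"
    and gen: "generate G (f ` X) = carrier G"
    and R: "R \<subseteq> kernel (free_group X) G (eval_word G f)" "finite R" "card R \<le> m"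
    and few: "finite (rcosets\<^bsub>free_group X\<^esub> normal_closure (free_group X) R)"
      "card (rcosets\<^bsub>free_group X\<^esub> normal_closure (free_group X) R) \<le> card (carrier G)"
  shows "\<exists>R'. card R' = m \<and> is_presentation_via G X R' f"
proof -
  let ?F = "free_group X" and ?\<phi> = "eval_word G f"
  interpret G: group G by fact
  interpret F: group ?F by (rule group_free_group)
  interpret \<phi>: group_hom ?F G ?\<phi>
    using G.eval_word_hom[OF f] by (intro group_hom.intro group_hom_axioms.intro F.group_axioms G.group_axioms)
  define K where "K = kernel ?F G ?\<phi>"
  define N where "N = normal_closure ?F R"
  have K: "K \<lhd> ?F" unfolding K_def by (rule \<phi>.normal_kernel)
  have RF: "R \<subseteq> carrier ?F" using R by (auto simp: kernel_def)
  have N: "N \<lhd> ?F" unfolding N_def by (rule F.normal_normal_closure[OF RF])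
  have NK: "N \<subseteq> K" unfolding N_def using normal_closure_subset[OF K] R by (simp add: K_def)
  have N_sub: "subgroup N ?F" by (rule normal_imp_subgroup[OF N])
  have gen_eval: "?\<phi> [(x, True)] = f x" if "x \<in> X" for x
    by (rule G.eval_word_generator[of f x]) (use f that in auto)
  have surj: "?\<phi> ` carrier ?F = carrier G"
  proof -
    have "?\<phi> ` generate ?F ((\<lambda>x. [(x, True)]) ` X) = generate G (?\<phi> ` (\<lambda>x. [(x, True)]) ` X)"
      by (rule \<phi>.generate_img[symmetric]) (auto simp: generator_in_free_group)
    also have "?\<phi> ` (\<lambda>x. [(x, True)]) ` X = f ` X" using gen_eval by force
    finally show ?thesis using gen by (simp add: generate_free_group)
  qed
  have "K \<subseteq> N"
  proof
    fix w assume w: "w \<in> K"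
    obtain g where g: "\<And>x. x \<in> carrier ?F \<Longrightarrow> g (N #>\<^bsub>?F\<^esub> x) = ?\<phi> x"
      using \<phi>.FactGroup_universal_kernel[OF N NK[unfolded K_def]] by blast
    have "carrier G \<subseteq> g ` (rcosets\<^bsub>?F\<^esub> N)"
    proof
      fix y assume "y \<in> carrier G"
      then obtain x where "x \<in> carrier ?F" "y = ?\<phi> x" using surj by blast
      then show "y \<in> g ` (rcosets\<^bsub>?F\<^esub> N)"
        using g F.rcosetsI[of N x] subgroup.subset[OF N_sub] by (metis imageI)
    qed
    moreover have fin: "finite (rcosets\<^bsub>?F\<^esub> N)" using few by (simp add: N_def)
    ultimately have "card (carrier G) \<le> card (g ` (rcosets\<^bsub>?F\<^esub> N))"
      by (intro card_mono) auto
    then have "card (g ` (rcosets\<^bsub>?F\<^esub> N)) = card (rcosets\<^bsub>?F\<^esub> N)"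
      using few(2) card_image_le[OF fin, of g] by (simp add: N_def)
    then have inj: "inj_on g (rcosets\<^bsub>?F\<^esub> N)" by (rule eq_card_imp_inj_on[OF fin])
    have wF: "w \<in> carrier ?F" "?\<phi> w = \<one>\<^bsub>G\<^esub>" using w by (auto simp: K_def kernel_def)
    have "g (N #>\<^bsub>?F\<^esub> w) = g (N #>\<^bsub>?F\<^esub> \<one>\<^bsub>?F\<^esub>)"
      using g wF by simp
    then have "N #>\<^bsub>?F\<^esub> w = N #>\<^bsub>?F\<^esub> \<one>\<^bsub>?F\<^esub>"
      using inj F.rcosetsI subgroup.subset[OF N_sub] wF F.one_closed by (metis inj_onD)
    then show "w \<in> N"
      using F.rcos_self[OF wF(1) N_sub] F.coset_mult_one subgroup.subset[OF N_sub] by metis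
  qed
  then have NK: "N = K" using NK by blast
  \<comment> \<open>The kernel is infinite, so there is room for redundant relators.\<close>
  have "infinite (K - R)"
    using infinite_kernel_free_group[OF G f \<open>X \<noteq> {}\<close>] R(2) by (simp add: K_def)
  then obtain T where T: "T \<subseteq> K - R" "finite T" "card T = m - card R"
    using infinite_arbitrarily_large by blast
  define R' where "R' = R \<union> T"
  have "R \<inter> T = {}" using T by blast
  then have R': "card R' = m" "R' \<subseteq> K"
    using T R by (auto simp: R'_def K_def card_Un_disjoint)
  have nc: "normal_closure ?F R' = K"
  proof
    show "normal_closure ?F R' \<subseteq> K" by (rule normal_closure_subset[OF K R'(2)])
    show "K \<subseteq> normal_closure ?F R'"
      unfolding NK[symmetric] N_def by (rule normal_closure_mono) (simp add: R'_def)
  qed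
  let ?\<psi> = "\<lambda>C. the_elem (?\<phi> ` C)"
  have "?\<psi> \<in> iso (presented_group X R') G"
    unfolding presented_group_def nc K_def by (rule \<phi>.FactGroup_iso_set[OF surj])
  moreover have "?\<psi> (presented_generator X R' x) = f x" if "x \<in> X" for x
  proof -
    let ?x = "[(x, True)]"
    have x: "?x \<in> carrier ?F" using that by (rule generator_in_free_group)
    have "?\<phi> ` (K #>\<^bsub>?F\<^esub> ?x) = {?\<phi> ?x}"
    proof -
      have "?\<phi> (h \<otimes>\<^bsub>?F\<^esub> ?x) = ?\<phi> ?x" if "h \<in> K" for h
        using that x \<phi>.hom_closed[OF x] by (auto simp: K_def kernel_def simp del: eval_word_simps)
      moreover have "K \<noteq> {}" using subgroup.one_closed[OF N_sub] NK by blast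
      ultimately have "(\<lambda>h. ?\<phi> (h \<otimes>\<^bsub>?F\<^esub> ?x)) ` K = {?\<phi> ?x}"
        by (simp add: image_constant_conv del: eval_word_simps cong: image_cong)
      moreover have "K #>\<^bsub>?F\<^esub> ?x = (\<lambda>h. h \<otimes>\<^bsub>?F\<^esub> ?x) ` K" by (auto simp: r_coset_def)
      ultimately show ?thesis by (simp only: image_image)
    qed
    then show ?thesis unfolding presented_generator_def nc using gen_eval[OF that] by (simp del: eval_word_simps)
  qed
  moreover have "R' \<subseteq> carrier ?F" using R'(2) by (auto simp: K_def kernel_def)
  ultimately show ?thesis
    unfolding is_presentation_via_def using R'(1)
    by (intro exI[of _ R'] conjI bexI[of _ ?\<psi>] ballI)
qed

section \<open>Multiplication by a primitive root\<close>

text \<open>Multiplication by \<open>s\<close> on residues modulo \<open>p\<close>. The letter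
  \<open>p\<close> stands for the residue 0 and is fixed, as are all letters beyond it.\<close>

definition mulperm :: "nat \<Rightarrow> nat \<Rightarrow> nat \<Rightarrow> nat"
  where "mulperm p s i = (if i \<in> {1..<p} then (s * i) mod p else i)"

lemma odd_prime_ge_3: "prime (p::nat) \<Longrightarrow> odd p \<Longrightarrow> 3 \<le> p"
  using prime_ge_2_nat[of p] by (cases "p = 2") auto

context
  fixes p s :: nat
  assumes p: "prime p" "odd p" and s: "residue_primroot p s"
begin

lemma primroot_not_dvd: "\<not> p dvd s" "1 < s" "coprime (s - 1) p"
proof -
  have c: "coprime p s" and o: "ord p s = p - 1"
    using s p(1) by (auto simp: residue_primroot_def totient_prime)
  show nd: "\<not> p dvd s" using c odd_prime_ge_3[OF p] by (metis coprime_absorb_left not_prime_unit p(1))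
  have "\<not> [s = 1] (mod p)"
  proof
    assume "[s = 1] (mod p)"
    then have "ord p s dvd 1" using ord_divides[of s 1 p] by simp
    then show False using o odd_prime_ge_3[OF p] by simp
  qed
  moreover have "s \<noteq> 0" using nd by (metis dvd_0_right)
  ultimately show "1 < s" by (cases "s = 1") auto
  then have "\<not> p dvd s - 1" using \<open>\<not> [s = 1] (mod p)\<close> by (simp add: cong_altdef_nat cong_sym_eq)
  then show "coprime (s - 1) p" using p(1) by (metis coprime_commute prime_imp_coprime)
qed

lemma primroot_power:
  assumes "0 < j" "j < p" shows "\<exists>i. j = s ^ i mod p"
proof -
  have "j \<in> totatives p" using assms p(1) by (simp add: totatives_prime)
  then have "j \<in> (\<lambda>i. s ^ i mod p) ` {..<totient p}"
    using residue_primroot_is_generator[OF _ s] odd_prime_ge_3[OF p] by (auto simp: bij_betw_def)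
  then show ?thesis by blast
qed

lemma mulperm_permutes: "mulperm p s permutes {1..<p}"
proof (rule bij_imp_permutes)
  have "inj_on (mulperm p s) {1..<p}"
  proof (rule inj_onI)
    fix i j assume ij: "i \<in> {1..<p}" "j \<in> {1..<p}" "mulperm p s i = mulperm p s j"
    then have "[s * i = s * j] (mod p)" by (simp add: mulperm_def cong_def)
    moreover have "coprime s p" using primroot_not_dvd(1) p(1) by (metis coprime_commute prime_imp_coprime)
    ultimately have "[i = j] (mod p)" by (simp add: cong_mult_lcancel_nat)
    then show "i = j" using ij by (simp add: cong_def)
  qed
  moreover have "mulperm p s ` {1..<p} \<subseteq> {1..<p}"
  proof
    fix x assume "x \<in> mulperm p s ` {1..<p}"
    then obtain i where "i \<in> {1..<p}" "x = mulperm p s i" by blast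
    then have i: "0 < i" "i < p" "x = (s * i) mod p" by (auto simp: mulperm_def)
    have "\<not> p dvd i" using i by (simp add: nat_dvd_not_less)
    then have "\<not> p dvd s * i" using primroot_not_dvd(1) p(1) by (simp add: prime_dvd_mult_iff)
    then show "x \<in> {1..<p}" using i odd_prime_ge_3[OF p] by (auto simp: dvd_eq_mod_eq_0)
  qed
  ultimately show "bij_betw (mulperm p s) {1..<p} {1..<p}"
    by (simp add: bij_betw_def endo_inj_surj)
qed (auto simp: mulperm_def)

text \<open>The discrete exponential \<open>g\<close> conjugates multiplication by \<open>s\<close>
  to the cycle on the \<open>p - 1\<close> exponents, whose length is even.\<close>

lemma odd_mulperm: "\<not> evenperm (mulperm p s)"
proof -
  define g where "g i = (if i \<in> {1..<p} then s ^ i mod p else i)" for i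
  have cop: "coprime s p" using primroot_not_dvd(1) p(1) by (metis coprime_commute prime_imp_coprime)
  have sub: "g ` {1..<p} \<subseteq> {1..<p}"
  proof
    fix x assume "x \<in> g ` {1..<p}"
    then obtain i where i: "x = s ^ i mod p" by (auto simp: g_def)
    have "\<not> p dvd s ^ i" using primroot_not_dvd(1) p(1) prime_dvd_power by blast
    then show "x \<in> {1..<p}" using i odd_prime_ge_3[OF p] by (auto simp: dvd_eq_mod_eq_0)
  qed
  have "{1..<p} \<subseteq> g ` {1..<p}"
  proof
    fix j assume j: "j \<in> {1..<p}"
    then obtain i where i: "j = s ^ i mod p" using primroot_power[of j] by auto
    have f: "[s ^ (p - 1) = 1] (mod p)" using fermat_theorem[OF p(1) primroot_not_dvd(1)] .
    \<comment> \<open>Exponents are letters from 1 to \<open>p - 1\<close>, so by Fermat's theorem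
      the exponent 0 is replaced by \<open>p - 1\<close>.\<close>
    define m where "m = (if i mod (p - 1) = 0 then p - 1 else i mod (p - 1))"
    have m: "m \<in> {1..<p}" using odd_prime_ge_3[OF p] mod_less_divisor[of "p - 1" i] by (auto simp: m_def simp del: mod_less_divisor)
    have "[s ^ i = s ^ (i mod (p - 1))] (mod p)"
    proof -
      have "s ^ i = (s ^ (p - 1)) ^ (i div (p - 1)) * s ^ (i mod (p - 1))"
        by (simp flip: power_mult power_add)
      moreover have "[(s ^ (p - 1)) ^ (i div (p - 1)) * s ^ (i mod (p - 1)) = 1 ^ (i div (p - 1)) * s ^ (i mod (p - 1))] (mod p)"
        by (intro cong_mult cong_pow f cong_refl)
      ultimately show ?thesis by simp
    qed
    then have "[s ^ i = s ^ m] (mod p)"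
      using f unfolding m_def cong_def by (cases "i mod (p - 1) = 0") simp_all
    then have "g m = j" using m i by (simp add: g_def cong_def)
    then show "j \<in> g ` {1..<p}" using m by blast
  qed
  with sub have img: "g ` {1..<p} = {1..<p}" by blast
  have g: "g permutes {1..<p}"
  proof (rule bij_imp_permutes)
    have "inj_on g {1..<p}" by (rule eq_card_imp_inj_on) (simp_all add: img del: One_nat_def)
    then show "bij_betw g {1..<p} {1..<p}" by (simp add: bij_betw_def img del: One_nat_def)
  qed (auto simp: g_def)
  let ?c = "cyc 1 (p - 1)"
  have "{1..p - 1} = {1..<p}" using odd_prime_ge_3[OF p] by auto
  then have c: "?c permutes {1..<p}" using cyc_permutes[of 1 "p - 1"] odd_prime_ge_3[OF p] by simp
  have "mulperm p s \<circ> g = g \<circ> ?c"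
  proof
    fix i
    show "(mulperm p s \<circ> g) i = (g \<circ> ?c) i"
    proof (cases "i \<in> {1..<p}")
      case True
      then have gi: "g i \<in> {1..<p}" using sub by blast
      have "mulperm p s (g i) = s ^ Suc i mod p"
        using gi True by (simp add: mulperm_def g_def mod_mult_right_eq)
      moreover have "g (?c i) = s ^ Suc i mod p"
      proof (cases "i = p - 1")
        case eq: True
        have "[s ^ p = s] (mod p)"
          using cong_mult[OF fermat_theorem[OF p(1) primroot_not_dvd(1)] cong_refl[of s p]] odd_prime_ge_3[OF p]
          by (simp flip: power_Suc2)
        then show ?thesis using eq odd_prime_ge_3[OF p] by (simp add: cyc_def g_def cong_def)
      qed (use True in \<open>auto simp: cyc_def g_def\<close>)
      ultimately show ?thesis by simp
    qed (auto simp: mulperm_def g_def cyc_def)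
  qed
  then have "mulperm p s = g \<circ> ?c \<circ> inv' g"
    by (metis comp_assoc comp_id g permutes_inv_o(1))
  moreover have "evenperm (g \<circ> ?c \<circ> inv' g) \<longleftrightarrow> evenperm ?c"
    using permutes_imp_permutation[OF _ g] permutes_imp_permutation[OF _ c]
    by (auto simp: evenperm_comp evenperm_inv permutation_inverse permutation_compose)
  moreover have "evenperm ?c \<longleftrightarrow> even (p - 1 - 1)" using odd_prime_ge_3[OF p] by (intro evenperm_cyc) simp
  ultimately show ?thesis using p odd_prime_ge_3[OF p] by simp
qed

lemma mulperm_cyc: "mulperm p s \<circ> cyc 1 p = cyc 1 p ^^ s \<circ> mulperm p s"
proof
  fix i
  show "(mulperm p s \<circ> cyc 1 p) i = (cyc 1 p ^^ s \<circ> mulperm p s) i"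
  proof (cases "1 \<le> i \<and> i \<le> p")
    case False
    then have "i < 1 \<or> p < i" by auto
    then show ?thesis using cyc_funpow_outside[of i 1 p s] by (auto simp: mulperm_def cyc_def)
  next
    case True
    \<comment> \<open>The letter in \<open>{1..p}\<close> that represents a residue. In these terms
      the cycle adds 1 and \<open>mulperm\<close> multiplies by \<open>s\<close>, and the claim is
      the distributive law.\<close>
    define e where "e i = (if i mod p = 0 then p else i mod p)" for i :: nat
    have eS: "e (Suc m) = 1 + m mod p" for m by (simp add: e_def mod_Suc)
    have pow: "(cyc 1 p ^^ j) (e x) = e (x + j)" for x j
    proof -
      have ex: "1 \<le> e x" "e x \<le> p" using odd_prime_ge_3[OF p] by (auto simp: e_def less_imp_le)
      have "(cyc 1 p ^^ j) (e x) = 1 + (e x - 1 + j) mod p" using cyc_funpow[OF ex, of j] odd_prime_ge_3[OF p] by simp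
      also have "\<dots> = e (Suc (e x - 1 + j))" by (simp only: eS)
      also have "Suc (e x - 1 + j) = e x + j" using ex by simp
      also have "e (e x + j) = e (x + j)"
      proof -
        have "e x mod p = x mod p" by (simp add: e_def)
        then have "(e x + j) mod p = (x + j) mod p" by (metis mod_add_left_eq)
        then show ?thesis by (simp only: e_def[of "e x + j"] e_def[of "x + j"])
      qed
      finally show ?thesis .
    qed
    have ei: "e i = i" if "1 \<le> i" "i \<le> p" for i using that by (cases "i = p") (simp_all add: e_def)
    have mul: "mulperm p s (e x) = e (s * x)" for x
    proof (cases "x mod p = 0")
      case True
      then show ?thesis by (auto simp: e_def mulperm_def)
    next
      case False
      then have "\<not> p dvd x" by (simp add: dvd_eq_mod_eq_0)
      then have "\<not> p dvd s * x" using primroot_not_dvd(1) p(1) by (simp add: prime_dvd_mult_iff)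
      then have "(s * x) mod p \<noteq> 0" by (simp add: dvd_eq_mod_eq_0)
      then show ?thesis using False odd_prime_ge_3[OF p] by (auto simp: e_def mulperm_def mod_mult_right_eq)
    qed
    have "mulperm p s (cyc 1 p i) = mulperm p s (e (i + 1))" using pow[of 1 i] ei[of i] True by simp
    also have "\<dots> = e (s * i + s)" by (simp add: mul algebra_simps)
    also have "\<dots> = (cyc 1 p ^^ s) (mulperm p s i)" using mul[of i] ei[of i] True by (simp add: pow del: One_nat_def)
    finally show ?thesis by simp
  qed
qed

end

section \<open>Seven relators\<close>

text \<open>The normal subgroup is left arbitrary, so that further relators can be added to \<open>R\<close>.\<close>

definition few_cosets ::
    "('f, 'm) monoid_scheme \<Rightarrow> ('f \<Rightarrow> (nat \<Rightarrow> nat)) \<Rightarrow> 'f set \<Rightarrow> 'f set \<Rightarrow> nat \<Rightarrow> bool"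
  where "few_cosets F \<phi> V R m \<longleftrightarrow>
    (\<forall>N. N \<lhd> F \<longrightarrow> R \<subseteq> N \<longrightarrow> (\<forall>x \<in> N. \<phi> x = id) \<longrightarrow> generate F (V \<union> N) = carrier F \<longrightarrow>
      finite (rcosets\<^bsub>F\<^esub> N) \<and> card (rcosets\<^bsub>F\<^esub> N) \<le> m)"

text \<open>Passing to the factor group by \<open>N\<close>: the relators become trivial, \<phi>
  factors as \<open>f\<close> after the projection \<open>q\<close>, and the images of
  \<open>V\<close> generate. Counting cosets becomes bounding the order of a group in which the
  locales above can be interpreted.\<close>

lemma few_cosetsI:
  fixes F :: "'f monoid"
  assumes F: "group F" and \<phi>: "\<phi> \<in> hom F (sym_group n)" and V: "V \<subseteq> carrier F"
    and bound: "\<And>(H :: 'f set monoid) q f. group H \<Longrightarrow> q \<in> hom F H \<Longrightarrow> f \<in> hom H (sym_group n) \<Longrightarrow>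
      (\<And>x. x \<in> carrier F \<Longrightarrow> f (q x) = \<phi> x) \<Longrightarrow> (\<And>x. x \<in> R \<Longrightarrow> q x = \<one>\<^bsub>H\<^esub>) \<Longrightarrow>
      carrier H = generate H (q ` V) \<Longrightarrow> finite (carrier H) \<and> card (carrier H) \<le> m"
  shows "few_cosets F \<phi> V R m"
  unfolding few_cosets_def
proof (intro allI impI)
  fix N assume N: "N \<lhd> F" "R \<subseteq> N" "\<forall>x \<in> N. \<phi> x = id" and gen: "generate F (V \<union> N) = carrier F"
  interpret F: group F by fact
  interpret N: normal N F by fact
  interpret \<phi>: group_hom F "sym_group n" \<phi>
    using F \<phi> sym_group_is_group by (intro group_hom.intro group_hom_axioms.intro)
  let ?H = "F Mod N" and ?q = "\<lambda>x. N #>\<^bsub>F\<^esub> x"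
  have H: "group ?H" by (rule N.factorgroup_is_group)
  then interpret H: group ?H .
  have q: "?q \<in> hom F ?H" by (rule N.r_coset_hom_Mod)
  interpret q: group_hom F ?H ?q
    using F H q by (intro group_hom.intro group_hom_axioms.intro)
  have "N \<subseteq> kernel F (sym_group n) \<phi>" using N(3) N.subset by (auto simp: kernel_def sym_group_one)
  then obtain f where f: "f \<in> hom ?H (sym_group n)" "\<And>x. x \<in> carrier F \<Longrightarrow> f (?q x) = \<phi> x"
    using \<phi>.FactGroup_universal_kernel[OF N(1)] by blast
  have one: "?q x = \<one>\<^bsub>?H\<^esub>" if "x \<in> N" for x
    using that F.coset_join2[OF _ N.subgroup_axioms] N.subset by (auto simp: FactGroup_def)
  have qV: "?q ` V \<subseteq> carrier ?H" using V q.hom_closed by blast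
  have carrier: "carrier ?H = ?q ` carrier F" by (auto simp: FactGroup_def RCOSETS_def)
  also have "\<dots> = generate ?H (?q ` (V \<union> N))"
    unfolding gen[symmetric] using V N.subset by (intro q.generate_img[symmetric]) auto
  also have "\<dots> \<subseteq> generate ?H (?q ` V)"
  proof (rule H.generate_subgroup_incl[OF _ H.generate_is_subgroup[OF qV]])
    have "?q x \<in> generate ?H (?q ` V)" if "x \<in> V \<union> N" for x
      using that one[of x] generate.one[of ?H "?q ` V"] generate.incl[of "?q x" "?q ` V" ?H] by auto
    then show "?q ` (V \<union> N) \<subseteq> generate ?H (?q ` V)" by (rule image_subsetI)
  qed
  finally have "carrier ?H = generate ?H (?q ` V)" using H.generate_incl[OF qV] by blast
  then have "finite (carrier ?H) \<and> card (carrier ?H) \<le> m"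
    using bound[OF H q f] one N(2) by blast
  then show "finite (rcosets\<^bsub>F\<^esub> N) \<and> card (rcosets\<^bsub>F\<^esub> N) \<le> m" by (simp add: FactGroup_def)
qed

lemma (in group_hom) hom_relator_iff:
  assumes "X \<in> carrier G" "Y \<in> carrier G"
  shows "h (X \<otimes>\<^bsub>G\<^esub> inv\<^bsub>G\<^esub> Y) = \<one>\<^bsub>H\<^esub> \<longleftrightarrow> h X = h Y"
  using assms H.inv_solve_right'[of "\<one>\<^bsub>H\<^esub>" "h X" "h Y"] by auto

lemma (in group_hom) hom_relatorD:
  "h (X \<otimes>\<^bsub>G\<^esub> inv\<^bsub>G\<^esub> Y) = \<one>\<^bsub>H\<^esub> \<Longrightarrow> X \<in> carrier G \<Longrightarrow> Y \<in> carrier G \<Longrightarrow> h X = h Y"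
  using hom_relator_iff by blast

context group
begin

lemma cj_pow: "g \<in> carrier G \<Longrightarrow> x \<in> carrier G \<Longrightarrow> cj g (x [^] (i::nat)) = cj g x [^] i"
  by (induction i) (simp_all add: cj_mult)

lemma pow_eq_if_cong:
  assumes "x \<in> carrier G" "x [^] (m::nat) = \<one>" "[i = j] (mod m)"
  shows "x [^] i = x [^] j"
proof -
  have *: "x [^] i = x [^] (i mod m)" for i
  proof -
    have "x [^] i = x [^] (m * (i div m) + i mod m)" by simp
    also have "\<dots> = (x [^] m) [^] (i div m) \<otimes> x [^] (i mod m)"
      using assms(1) by (simp only: nat_pow_pow nat_pow_mult)
    finally show ?thesis using assms by simp
  qed
  show ?thesis using *[of i] *[of j] assms(3) by (simp add: cong_def)
qed

text \<open>Conjugation by \<open>h\<close> turns the relation for the exponent \<open>m\<close>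
  into the one for \<open>s * m\<close>; when \<open>h\<close> inverts \<open>z\<close>, it arrives
  inverted and is read backwards. From the exponent 1 the powers of \<open>s\<close> reach every
  nonzero residue modulo \<open>p\<close>.\<close>

lemma pairs_by_primitive_root:
  assumes c: "u \<in> carrier G" "z \<in> carrier G" "h \<in> carrier G"
    and p: "prime p" "odd p" "residue_primroot p s"
    and up: "u [^] p = \<one>" and hu: "h \<otimes> u = u [^] s \<otimes> h" and hz: "cj h z = z \<or> cj h z = inv z"
    and pair: "z \<otimes> cj u z \<otimes> z \<otimes> cj u z = \<one>" and j: "0 < j" "j < p"
  shows "z \<otimes> cj (u [^] j) z \<otimes> z \<otimes> cj (u [^] j) z = \<one>"
proof -
  have hu': "cj h u = u [^] s" using c hu by (simp add: cj_def m_assoc)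
  have step: "z \<otimes> cj (u [^] (s * m)) z \<otimes> z \<otimes> cj (u [^] (s * m)) z = \<one>"
    if "z \<otimes> cj (u [^] m) z \<otimes> z \<otimes> cj (u [^] m) z = \<one>" for m
  proof -
    let ?x = "cj (u [^] m) z" and ?y = "cj (u [^] (s * m)) z"
    have cy: "cj h ?x = cj (u [^] (s * m)) (cj h z)"
    proof -
      have "h \<otimes> u [^] m = u [^] (s * m) \<otimes> h"
        using cj_pow[OF c(3,1), of m] c hu' nat_pow_pow[OF c(1), of s m]
        by (metis cj_def inv_solve_right' m_closed nat_pow_closed)
      then show ?thesis using c by (simp add: cj_cj)
    qed
    have "cj h (z \<otimes> ?x \<otimes> z \<otimes> ?x) = \<one>" using that c by simp
    then have e: "cj h z \<otimes> cj h ?x \<otimes> cj h z \<otimes> cj h ?x = \<one>" using c by (simp add: cj_mult)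
    from hz show ?thesis
    proof
      assume "cj h z = z"
      then show ?thesis using e cy by simp
    next
      assume z: "cj h z = inv z"
      have "cj h ?x = inv ?y" using cy z c by (simp add: cj_inv)
      then have "inv z \<otimes> inv ?y \<otimes> inv z \<otimes> inv ?y = \<one>" using e z by simp
      then have "inv (?y \<otimes> z \<otimes> ?y \<otimes> z) = \<one>" using c by (simp add: inv_mult_group m_assoc)
      then have "?y \<otimes> z \<otimes> ?y \<otimes> z = \<one>" using c by (metis cj_closed inv_eq_1_iff m_closed nat_pow_closed)
      then show ?thesis using c by (simp add: pair_swap(1)[of ?y z])
    qed
  qed
  have pow: "z \<otimes> cj (u [^] (s ^ i)) z \<otimes> z \<otimes> cj (u [^] (s ^ i)) z = \<one>" for i
  proof (induction i)
    case 0
    then show ?case using pair c by simp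
  next
    case (Suc i)
    then show ?case using step[of "s ^ i"] by simp
  qed
  obtain i where "j = s ^ i mod p" using primroot_power[OF p j] by blast
  then have "[j = s ^ i] (mod p)" unfolding cong_def by (metis mod_mod_trivial)
  then have "u [^] j = u [^] (s ^ i)" using c up by (intro pow_eq_if_cong)
  then show ?thesis using pow by simp
qed

end

text \<open>Here \<open>U\<close>, \<open>T\<close>, \<open>Z\<close> are preimages of the three
  permutations in a group \<open>F\<close>, later the free group, with no relations imposed among
  them. The words that enter the relators are chosen at this level, before any quotient is
  formed.\<close>

locale generator_lifts = group F for F :: "'f monoid" (structure) +
  fixes n p k M :: nat and \<phi> and U T Z :: 'f
  assumes \<phi>_hom: "\<phi> \<in> hom F (sym_group n)"
    and p3: "3 \<le> p" and odd_p: "odd p" and n_eq: "n = p + 2 + k" and k_le: "k + 2 \<le> p"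
    and M: "M = n - 1 \<or> M = n"
    and carrier: "U \<in> carrier F" "T \<in> carrier F" "Z \<in> carrier F"
    and \<phi>U: "\<phi> U = cyc 1 p" and \<phi>T: "\<phi> T = cyc (p + 1) M" and \<phi>Z: "\<phi> Z = tri (p + 1) n p"
begin

sublocale \<phi>: group_hom F "sym_group n" \<phi>
  using \<phi>_hom sym_group_is_group group_axioms by (intro group_hom.intro group_hom_axioms.intro)

declare \<phi>.hom_mult [simp del] \<phi>.hom_one [simp del] \<phi>.hom_inv [simp del]

lemma \<phi>_mult: "x \<in> carrier F \<Longrightarrow> x' \<in> carrier F \<Longrightarrow> \<phi> (x \<otimes> x') = \<phi> x \<circ> \<phi> x'"
  using \<phi>.hom_mult[of x x'] by (simp add: sym_group_mult)

lemma \<phi>_one: "\<phi> \<one> = id"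
  using \<phi>.hom_one by (simp add: sym_group_one)

lemma \<phi>_permutes: "x \<in> carrier F \<Longrightarrow> \<phi> x permutes {1..n}"
  using \<phi>.hom_closed by (simp add: sym_group_carrier)

lemma \<phi>_inv: "x \<in> carrier F \<Longrightarrow> \<phi> (inv x) = inv' (\<phi> x)"
  using \<phi>.hom_inv \<phi>.hom_closed by simp

lemma \<phi>_pow: "x \<in> carrier F \<Longrightarrow> \<phi> (x [^] (i::nat)) = \<phi> x ^^ i"
  by (induction i) (simp_all add: \<phi>_one \<phi>_mult funpow_Suc_right del: funpow.simps(2))

lemma \<phi>_cj: "g \<in> carrier F \<Longrightarrow> x \<in> carrier F \<Longrightarrow> \<phi> (cj g x) = \<phi> g \<circ> \<phi> x \<circ> inv' (\<phi> g)"
  by (simp add: cj_def \<phi>_mult \<phi>_inv)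

lemma \<phi>_relator: "x \<in> carrier F \<Longrightarrow> x' \<in> carrier F \<Longrightarrow> \<phi> x = \<phi> x' \<Longrightarrow> \<phi> (x \<otimes> inv x') = id"
  using \<phi>.hom_relator_iff by (simp add: sym_group_one)

text \<open>Words are chosen in this subgroup so that in every quotient their images lie in the
  group \<open>A\<close> of \<open>alternating_base\<close>; in \<open>F\<close> itself it only
  needs to map onto the alternating group.\<close>

definition AF :: "'f set"
  where "AF = generate F ((\<lambda>j. cj (U [^] j) Z) ` {..<p})"

lemma AF_gens: "(\<lambda>j. cj (U [^] j) Z) ` {..<p} \<subseteq> carrier F"
  using carrier by auto

lemma AF_carrier: "x \<in> AF \<Longrightarrow> x \<in> carrier F"
  using generate_in_carrier[OF AF_gens] by (simp add: AF_def)

lemma \<phi>_Zj: "\<phi> (cj (U [^] j) Z) = tri (p + 1) n (1 + (p - 1 + j) mod p)"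
proof -
  have "\<phi> (cj (U [^] j) Z) = \<phi> (U [^] j) \<circ> tri (p + 1) n p \<circ> inv' (\<phi> (U [^] j))"
    using carrier \<phi>Z by (simp add: \<phi>_cj)
  also have "\<dots> = tri (\<phi> (U [^] j) (p + 1)) (\<phi> (U [^] j) n) (\<phi> (U [^] j) p)"
    using carrier by (intro tri_conj_inv[OF \<phi>_permutes]) simp
  also have "\<phi> (U [^] j) = cyc 1 p ^^ j" using carrier \<phi>U by (simp add: \<phi>_pow)
  also have "(cyc 1 p ^^ j) (p + 1) = p + 1" by (rule cyc_funpow_outside) simp
  also have "(cyc 1 p ^^ j) n = n" using n_eq by (intro cyc_funpow_outside) simp
  also have "(cyc 1 p ^^ j) p = 1 + (p - 1 + j) mod p"
    using p3 cyc_funpow[of 1 p p j] by simp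
  finally show ?thesis .
qed

lemma lift_Alt:
  assumes "\<sigma> \<in> Alt ({1..p + 1} \<union> {n})"
  obtains X where "X \<in> AF" "\<phi> X = \<sigma>"
proof -
  have sub: "subgroup (\<phi> ` AF) (sym_group n)"
    unfolding AF_def by (rule \<phi>.subgroup_img_is_subgroup[OF generate_is_subgroup[OF AF_gens]])
  have "Alt ({1..p + 1} \<union> {n}) \<subseteq> \<phi> ` AF"
  proof (rule Alt_subset_subgroup[OF sub, of _ "p + 1" n])
    fix w assume w: "w \<in> {1..p + 1} \<union> {n}" "w \<noteq> p + 1" "w \<noteq> n"
    define j where "j = (if w = p then 0 else w)"
    have j: "j < p" using w p3 by (auto simp: j_def)
    have "1 + (p - 1 + j) mod p = w"
    proof (cases "w = p")
      case False
      then have "p - 1 + j = (w - 1) + p" "w - 1 < p" using w p3 by (auto simp: j_def)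
      then have "(p - 1 + j) mod p = w - 1" by (simp only: mod_add_self2 mod_less)
      then show ?thesis using w by simp
    qed (use p3 in \<open>simp add: j_def\<close>)
    then have "\<phi> (cj (U [^] j) Z) = tri (p + 1) n w" using \<phi>_Zj[of j] by simp
    moreover have "cj (U [^] j) Z \<in> AF" using j by (auto simp: AF_def intro: generate.incl)
    ultimately show "tri (p + 1) n w \<in> \<phi> ` AF" by (metis imageI)
  qed (use n_eq in auto)
  then show thesis using assms that by blast
qed

lemma \<phi>_pair: "\<phi> (Z \<otimes> cj U Z \<otimes> Z \<otimes> cj U Z) = id"
proof -
  have "\<phi> (cj U Z) = tri (p + 1) n 1" using \<phi>_Zj[of 1] carrier p3 by simp
  then show ?thesis
    using carrier \<phi>Z n_eq p3 tri_pair[of "p + 1" n p 1] by (simp add: \<phi>_mult del: One_nat_def)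
qed

lemma \<phi>_cube: "\<phi> (Z \<otimes> Z \<otimes> Z) = id"
  using carrier \<phi>Z n_eq by (simp add: \<phi>_mult tri_cube)

lemma \<phi>_commute: "\<phi> (U \<otimes> T) = \<phi> (T \<otimes> U)"
proof -
  have "cyc 1 p \<circ> cyc (p + 1) M = cyc (p + 1) M \<circ> cyc 1 p"
    by (auto simp: cyc_def fun_eq_iff)
  then show ?thesis using carrier \<phi>U \<phi>T by (simp add: \<phi>_mult)
qed

text \<open>The words \<open>Y\<close>, \<open>Y'\<close>, \<open>B\<close> and \<open>X\<close> take the values needed in \<open>alternating_extension\<close>.\<close>

lemma obtain_words:
  obtains Y Y' B where "Y \<in> AF" "Y' \<in> AF" "B \<in> AF" "\<phi> Y = tri 1 2 n" "\<phi> (cj T Y) = \<phi> Y'"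
    "\<phi> B \<circ> \<phi> T = cyc 1 (2 * n - 1 - M)"
proof -
  have n: "p + 2 \<le> n" using n_eq by simp
  have "tri 1 2 n \<in> Alt ({1..p + 1} \<union> {n})" using p3 n by (intro tri_in_Alt) auto
  then obtain Y where Y: "Y \<in> AF" "\<phi> Y = tri 1 2 n" by (rule lift_Alt)
  have "tri 1 2 (\<phi> T n) \<in> Alt ({1..p + 1} \<union> {n})"
    using p3 n M by (intro tri_in_Alt) (auto simp: \<phi>T cyc_def)
  then obtain Y' where Y': "Y' \<in> AF" "\<phi> Y' = tri 1 2 (\<phi> T n)" by (rule lift_Alt)
  have "\<phi> (cj T Y) = tri (\<phi> T 1) (\<phi> T 2) (\<phi> T n)"
    using Y AF_carrier carrier tri_conj_inv[OF \<phi>_permutes[OF carrier(2)], of 1 2 n] by (simp add: \<phi>_cj)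
  also have "\<phi> T 1 = 1" unfolding \<phi>T using p3 by (intro cyc_outside) simp
  also have "\<phi> T 2 = 2" unfolding \<phi>T using p3 by (intro cyc_outside) simp
  finally have YY: "\<phi> (cj T Y) = \<phi> Y'" using Y' by simp
  obtain B where B: "B \<in> AF" "\<phi> B = cyc 1 (2 * n - 1 - M) \<circ> inv' (cyc (p + 1) M)"
    using turn_in_Alt[OF odd_p n M] by (rule lift_Alt)
  have "\<phi> B \<circ> \<phi> T = cyc 1 (2 * n - 1 - M)"
    using permutes_inv_o(2)[OF \<phi>_permutes[OF carrier(2)]] by (simp add: B(2) \<phi>T comp_assoc)
  then show thesis using that Y Y' B YY by blast
qed

text \<open>The word \<open>X\<close> becomes the element \<open>a\<close> of
  \<open>alternating_extension\<close>: the two sides of the second equation are the two sides of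
  the relator that places \<open>t \<otimes> r\<close> in \<open>W\<close>.\<close>

lemma obtain_window_word:
  assumes B: "B \<in> AF" "\<phi> B \<circ> \<phi> T = cyc 1 (2 * n - 1 - M)"
    and r: "r \<in> carrier F" "\<phi> r permutes {p - 1, p}" "evenperm (\<phi> T \<circ> \<phi> r)"
  obtains X where "X \<in> AF" "\<phi> (T \<otimes> r) = \<phi> (cj ((B \<otimes> T) [^] k) X)"
proof -
  let ?g = "cyc 1 (2 * n - 1 - M) ^^ k"
  obtain X where X: "X \<in> AF" "\<phi> X = inv' ?g \<circ> (cyc (p + 1) M \<circ> \<phi> r) \<circ> ?g"
    using window_in_Alt[OF p3 n_eq k_le M r(2)] r(3) \<phi>T by (metis lift_Alt)
  have c: "B \<otimes> T \<in> carrier F" using B AF_carrier carrier by simp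
  have g: "\<phi> ((B \<otimes> T) [^] k) = ?g" using c B AF_carrier carrier by (simp add: \<phi>_pow \<phi>_mult)
  then have gp: "?g permutes {1..n}" using \<phi>_permutes[of "(B \<otimes> T) [^] k"] c by simp
  have "\<phi> (cj ((B \<otimes> T) [^] k) X) = ?g \<circ> (inv' ?g \<circ> (\<phi> T \<circ> \<phi> r) \<circ> ?g) \<circ> inv' ?g"
    using c X AF_carrier g by (simp add: \<phi>_cj \<phi>T)
  also have "\<dots> = (?g \<circ> inv' ?g) \<circ> (\<phi> T \<circ> \<phi> r) \<circ> (?g \<circ> inv' ?g)" by (simp only: comp_assoc)
  also have "\<dots> = \<phi> T \<circ> \<phi> r" by (simp only: permutes_inv_o[OF gp] comp_id id_comp)
  finally show thesis using that X carrier r by (simp add: \<phi>_mult)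
qed

lemma Alt_subset_image:
  assumes K: "subgroup K F" "Z \<in> K" "\<And>x. x \<in> K \<Longrightarrow> cj U x \<in> K" "\<And>x. x \<in> K \<Longrightarrow> cj T x \<in> K"
  shows "Alt {1..n} \<subseteq> \<phi> ` K"
proof (rule Alt_subset_conj_closed[OF \<phi>.subgroup_img_is_subgroup[OF K(1)] p3 _ M])
  have Kc: "x \<in> carrier F" if "x \<in> K" for x using subgroup.subset[OF K(1)] that by blast
  show "tri (p + 1) n p \<in> \<phi> ` K" using K(2) \<phi>Z by (metis imageI)
  show "cyc 1 p \<circ> \<sigma> \<circ> inv' (cyc 1 p) \<in> \<phi> ` K" if s: "\<sigma> \<in> \<phi> ` K" for \<sigma>
  proof -
    obtain x where x: "x \<in> K" "\<sigma> = \<phi> x" using s by blast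
    then have "\<phi> (cj U x) = cyc 1 p \<circ> \<sigma> \<circ> inv' (cyc 1 p)" using Kc carrier \<phi>U by (simp add: \<phi>_cj)
    then show ?thesis using K(3)[OF x(1)] by (metis imageI)
  qed
  show "cyc (p + 1) M \<circ> \<sigma> \<circ> inv' (cyc (p + 1) M) \<in> \<phi> ` K" if s: "\<sigma> \<in> \<phi> ` K" for \<sigma>
  proof -
    obtain x where x: "x \<in> K" "\<sigma> = \<phi> x" using s by blast
    then have "\<phi> (cj T x) = cyc (p + 1) M \<circ> \<sigma> \<circ> inv' (cyc (p + 1) M)" using Kc carrier \<phi>T by (simp add: \<phi>_cj)
    then show ?thesis using K(4)[OF x(1)] by (metis imageI)
  qed
qed (use n_eq in simp)

lemma image_AF:
  assumes "group H" "q \<in> hom F H"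
  shows "q ` AF = generate H ((\<lambda>j. group.cj H (q U [^]\<^bsub>H\<^esub> j) (q Z)) ` {..<p})"
proof -
  interpret q: group_hom F H q using assms group_axioms by (intro group_hom.intro group_hom_axioms.intro)
  have "q ` AF = generate H (q ` (\<lambda>j. cj (U [^] j) Z) ` {..<p})"
    unfolding AF_def by (rule q.generate_img[OF AF_gens, symmetric])
  moreover have "q (cj (U [^] j) Z) = group.cj H (q U [^]\<^bsub>H\<^esub> j) (q Z)" for j :: nat
    using carrier by (simp add: q.hom_cj q.hom_nat_pow)
  ultimately show ?thesis by (simp add: image_image)
qed

lemma base_in_quotient:
  assumes H: "group H" "q \<in> hom F H" "f \<in> hom H (sym_group n)" "\<And>x. x \<in> carrier F \<Longrightarrow> f (q x) = \<phi> x"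
    and Y: "Y \<in> AF" "\<phi> Y = tri 1 2 n" "Y' \<in> AF"
    and "q U [^]\<^bsub>H\<^esub> p = \<one>\<^bsub>H\<^esub>" "q U \<otimes>\<^bsub>H\<^esub> q T = q T \<otimes>\<^bsub>H\<^esub> q U"
      "q Z \<otimes>\<^bsub>H\<^esub> q Z \<otimes>\<^bsub>H\<^esub> q Z = \<one>\<^bsub>H\<^esub>"
      "\<And>j. 0 < j \<Longrightarrow> j < p \<Longrightarrow> q Z \<otimes>\<^bsub>H\<^esub> group.cj H (q U [^]\<^bsub>H\<^esub> j) (q Z) \<otimes>\<^bsub>H\<^esub> q Z \<otimes>\<^bsub>H\<^esub>
        group.cj H (q U [^]\<^bsub>H\<^esub> j) (q Z) = \<one>\<^bsub>H\<^esub>"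
    and TY: "group.cj H (q T) (q Y) = q Y'"
  shows "alternating_base H n p k M f (q U) (q T) (q Z) (q Y)"
proof (rule alternating_base.intro[OF H(1) alternating_base_axioms.intro])
  have "q x \<in> carrier H" if "x \<in> carrier F" for x using H(2) that by (auto simp: hom_def)
  then show "q U \<in> carrier H" "q T \<in> carrier H" "q Z \<in> carrier H" using carrier by auto
  show "q Y \<in> generate H ((\<lambda>j. group.cj H (q U [^]\<^bsub>H\<^esub> j) (q Z)) ` {..<p})"
    "group.cj H (q T) (q Y) \<in> generate H ((\<lambda>j. group.cj H (q U [^]\<^bsub>H\<^esub> j) (q Z)) ` {..<p})"
    using Y TY image_AF[OF H(1,2)] by auto
  show "f (q Y) = tri 1 2 n" using H(4)[OF AF_carrier[OF Y(1)]] Y by simp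
qed (use assms p3 n_eq k_le M carrier \<phi>U \<phi>T \<phi>Z in auto)

lemma extension_in_quotient:
  assumes H: "group H" "q \<in> hom F H" "f \<in> hom H (sym_group n)" "\<And>x. x \<in> carrier F \<Longrightarrow> f (q x) = \<phi> x"
    and base: "alternating_base H n p k M f (q U) (q T) (q Z) (q Y)"
    and B: "B \<in> AF" "\<phi> B \<circ> \<phi> T = cyc 1 (2 * n - 1 - M)" and X: "X \<in> AF"
    and r: "r \<in> carrier H" "q T \<otimes>\<^bsub>H\<^esub> r = group.cj H ((q B \<otimes>\<^bsub>H\<^esub> q T) [^]\<^bsub>H\<^esub> k) (q X)"
      "r \<otimes>\<^bsub>H\<^esub> q T = q T \<otimes>\<^bsub>H\<^esub> r"
      "\<And>x. x \<in> q ` AF \<Longrightarrow> f x = tri p (p - 1) (p + 1) \<Longrightarrow> group.cj H r x = x \<or> group.cj H r x = inv\<^bsub>H\<^esub> x"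
      "q T [^]\<^bsub>H\<^esub> (M - p) = \<one>\<^bsub>H\<^esub> \<or> r = \<one>\<^bsub>H\<^esub>"
  shows "alternating_extension H n p k M f (q U) (q T) (q Z) (q Y) (q B) (q X) r"
proof (rule alternating_extension.intro[OF base alternating_extension_axioms.intro])
  show "q B \<in> generate H ((\<lambda>j. group.cj H (q U [^]\<^bsub>H\<^esub> j) (q Z)) ` {..<p})"
    "q X \<in> generate H ((\<lambda>j. group.cj H (q U [^]\<^bsub>H\<^esub> j) (q Z)) ` {..<p})"
    using B X image_AF[OF H(1,2)] by auto
  show "f (q B) \<circ> f (q T) = cyc 1 (2 * n - 1 - M)"
    using H(4)[OF AF_carrier[OF B(1)]] H(4)[OF carrier(2)] B(2) by simp
  show "group.cj H r x = x \<or> group.cj H r x = inv\<^bsub>H\<^esub> x"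
    if "x \<in> generate H ((\<lambda>j. group.cj H (q U [^]\<^bsub>H\<^esub> j) (q Z)) ` {..<p})"
      "f x = tri p (p - 1) (p + 1)" for x
    using that r(4) image_AF[OF H(1,2)] by simp
qed (use r in auto)

end

lemma card_le_7: "card {a, b, c, d, e, f, g} \<le> 7"
  using card_insert_le_m1[of 7 "{b, c, d, e, f, g}" a] card_insert_le_m1[of 6 "{c, d, e, f, g}" b]
    card_insert_le_m1[of 5 "{d, e, f, g}" c] card_insert_le_m1[of 4 "{e, f, g}" d]
    card_insert_le_m1[of 3 "{f, g}" e] card_insert_le_m1[of 2 "{g}" f] by simp

definition seven_relators :: "'f monoid \<Rightarrow> nat \<Rightarrow> (nat \<Rightarrow> nat) set \<Rightarrow> (nat \<Rightarrow> nat) \<Rightarrow> (nat \<Rightarrow> nat) \<Rightarrow> bool"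
  where "seven_relators F n C w z \<longleftrightarrow>
    (\<forall>\<phi> W Z. \<phi> \<in> hom F (sym_group n) \<longrightarrow> W \<in> carrier F \<longrightarrow> Z \<in> carrier F \<longrightarrow> \<phi> W = w \<longrightarrow> \<phi> Z = z \<longrightarrow>
      (\<exists>R \<subseteq> carrier F. finite R \<and> card R \<le> 7 \<and> (\<forall>x \<in> R. \<phi> x = id) \<and> few_cosets F \<phi> {W, Z} R (card C)))"

section \<open>The two cycles as powers of their product\<close>

lemma funpow_eq_if_cong:
  fixes g :: "'a \<Rightarrow> 'a"
  assumes "g ^^ m = id" "[i = j] (mod m)"
  shows "g ^^ i = g ^^ j"
proof -
  have red: "g ^^ i = g ^^ (i mod m)" for i
  proof -
    have "g ^^ i = g ^^ (m * (i div m) + i mod m)" by simp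
    also have "\<dots> = (g ^^ m) ^^ (i div m) \<circ> g ^^ (i mod m)" by (simp only: funpow_add funpow_mult)
    also have "(g ^^ m) ^^ (i div m) = id" using assms(1) by (simp add: id_funpow)
    finally show ?thesis by simp
  qed
  show ?thesis using red[of i] red[of j] assms(2) by (simp add: cong_def)
qed

lemma funpow_comp_commute:
  assumes "f \<circ> g = g \<circ> f"
  shows "(f \<circ> g) ^^ j = f ^^ j \<circ> g ^^ j"
proof -
  have *: "g \<circ> f ^^ j = f ^^ j \<circ> g" for j
  proof (induction j)
    case (Suc j)
    have "g \<circ> f ^^ Suc j = (g \<circ> f) \<circ> f ^^ j" by (simp add: comp_assoc)
    also have "\<dots> = (f \<circ> g) \<circ> f ^^ j" by (simp only: assms)
    also have "\<dots> = f \<circ> (g \<circ> f ^^ j)" by (simp only: comp_assoc)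
    finally show ?case unfolding Suc by (simp only: funpow.simps comp_assoc)
  qed simp
  show ?thesis
  proof (induction j)
    case (Suc j)
    have "(f \<circ> g) ^^ Suc j = (f \<circ> g) \<circ> (f ^^ j \<circ> g ^^ j)" by (simp only: funpow.simps Suc)
    also have "\<dots> = f \<circ> (g \<circ> f ^^ j) \<circ> g ^^ j" by (simp only: comp_assoc)
    also have "\<dots> = f ^^ Suc j \<circ> g ^^ Suc j" unfolding * by (simp only: funpow.simps comp_assoc)
    finally show ?case .
  qed simp
qed

text \<open>Chinese remainder exponents for the lengths \<open>p\<close> and \<open>M - p\<close>.
  These are coprime since \<open>M < 2 * p\<close> makes the second cycle shorter than the prime
  \<open>p\<close>.\<close>

locale cycle_powers =
  fixes p M \<alpha> \<beta> :: nat
  assumes p: "prime p" and M: "p < M" "M < 2 * p"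
    and \<alpha>: "[\<alpha> = 1] (mod p)" "[\<alpha> = 0] (mod (M - p))"
    and \<beta>: "[\<beta> = 0] (mod p)" "[\<beta> = 1] (mod (M - p))"
begin

lemma coprime_lengths: "coprime p (M - p)"
  using p M by (intro prime_imp_coprime) (auto dest: dvd_imp_le)

lemma cong_product: "[i = j] (mod p) \<Longrightarrow> [i = j] (mod (M - p)) \<Longrightarrow> [i = j] (mod (p * (M - p)))"
  using coprime_lengths by (rule coprime_cong_mult_nat[rotated 2])

lemma sum_cong: "[\<alpha> + \<beta> = 1] (mod (p * (M - p)))"
  using cong_add[OF \<alpha>(1) \<beta>(1)] cong_add[OF \<alpha>(2) \<beta>(2)] by (intro cong_product) simp_all

text \<open>The single relation on the order of \<open>w\<close> replaces four: the orders of both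
  factors, their commuting, and the factorisation of \<open>w\<close>.\<close>

lemma (in group) split_power:
  assumes "cycle_powers p M \<alpha> \<beta>" and w: "w \<in> carrier G" "w [^] (p * (M - p)) = \<one>"
  shows "(w [^] \<alpha>) [^] p = \<one>" "(w [^] \<beta>) [^] (M - p) = \<one>" "w [^] \<alpha> \<otimes> w [^] \<beta> = w"
    "w [^] \<alpha> \<otimes> w [^] \<beta> = w [^] \<beta> \<otimes> w [^] \<alpha>"
proof -
  interpret cycle_powers p M \<alpha> \<beta> by fact
  have "[\<alpha> * p = 0] (mod (p * (M - p)))" "[\<beta> * (M - p) = 0] (mod (p * (M - p)))"
    using \<alpha>(2) \<beta>(1) by (auto simp: cong_0_iff mult.commute intro: mult_dvd_mono)
  then have "w [^] (\<alpha> * p) = w [^] (0::nat)" "w [^] (\<beta> * (M - p)) = w [^] (0::nat)"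
    using pow_eq_if_cong[OF w] by blast+
  then show "(w [^] \<alpha>) [^] p = \<one>" "(w [^] \<beta>) [^] (M - p) = \<one>"
    using w by (auto simp: nat_pow_pow)
  have "w [^] (\<alpha> + \<beta>) = w [^] (1::nat)" using w sum_cong by (intro pow_eq_if_cong)
  then show "w [^] \<alpha> \<otimes> w [^] \<beta> = w" using w by (simp add: nat_pow_mult)
  show "w [^] \<alpha> \<otimes> w [^] \<beta> = w [^] \<beta> \<otimes> w [^] \<alpha>" using w by (simp add: nat_pow_mult add.commute)
qed

lemma cycle_power: "(cyc 1 p \<circ> cyc (p + 1) M) ^^ \<alpha> = cyc 1 p" "(cyc 1 p \<circ> cyc (p + 1) M) ^^ \<beta> = cyc (p + 1) M"
  "(cyc 1 p \<circ> cyc (p + 1) M) ^^ (p * (M - p)) = id"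
proof -
  have comm: "cyc 1 p \<circ> cyc (p + 1) M = cyc (p + 1) M \<circ> cyc 1 p"
    by (auto simp: cyc_def fun_eq_iff)
  have pow: "(cyc 1 p \<circ> cyc (p + 1) M) ^^ j = cyc 1 p ^^ j \<circ> cyc (p + 1) M ^^ j" for j
    by (rule funpow_comp_commute[OF comm])
  have "1 \<le> p" using p prime_ge_1_nat by blast
  then have id1: "cyc 1 p ^^ p = id" using cyc_funpow_length[of 1 p] by simp
  have id2: "cyc (p + 1) M ^^ (M - p) = id" using cyc_funpow_length[of "p + 1" M] M by (simp add: Suc_diff_Suc)
  show "(cyc 1 p \<circ> cyc (p + 1) M) ^^ \<alpha> = cyc 1 p"
    unfolding pow using funpow_eq_if_cong[OF id1 \<alpha>(1)] funpow_eq_if_cong[OF id2 \<alpha>(2)] by simp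
  show "(cyc 1 p \<circ> cyc (p + 1) M) ^^ \<beta> = cyc (p + 1) M"
    unfolding pow using funpow_eq_if_cong[OF id1 \<beta>(1)] funpow_eq_if_cong[OF id2 \<beta>(2)] by simp
  have "[p * (M - p) = 0] (mod p)" "[p * (M - p) = 0] (mod (M - p))" by (simp_all add: cong_0_iff)
  then show "(cyc 1 p \<circ> cyc (p + 1) M) ^^ (p * (M - p)) = id"
    using funpow_eq_if_cong[OF id1] funpow_eq_if_cong[OF id2] unfolding pow by (metis comp_id funpow_0 id_apply eq_id_iff)
qed

end

lemma obtain_cycle_powers:
  assumes "prime p" "p < M" "M < 2 * p"
  obtains \<alpha> \<beta> where "cycle_powers p M \<alpha> \<beta>"
proof -
  have "coprime p (M - p)" using assms by (intro prime_imp_coprime) (auto dest: dvd_imp_le)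
  then obtain \<alpha> \<beta> where "[\<alpha> = 1] (mod p)" "[\<alpha> = 0] (mod (M - p))" "[\<beta> = 0] (mod p)" "[\<beta> = 1] (mod (M - p))"
    using binary_chinese_remainder_nat[of p "M - p"] by metis
  then show thesis using assms that by (simp add: cycle_powers_def)
qed

lemma hom_sym_group_pow:
  assumes "group F" "\<phi> \<in> hom F (sym_group n)" "x \<in> carrier F"
  shows "\<phi> (x [^]\<^bsub>F\<^esub> (i::nat)) = \<phi> x ^^ i"
proof -
  interpret \<phi>: group_hom F "sym_group n" \<phi>
    using assms sym_group_is_group by (intro group_hom.intro group_hom_axioms.intro)
  have "\<sigma> [^]\<^bsub>sym_group n\<^esub> i = \<sigma> ^^ i" for \<sigma>
    by (induction i) (simp_all add: sym_group_one sym_group_mult funpow_Suc_right del: funpow.simps(2))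
  then show ?thesis using \<phi>.hom_nat_pow[OF assms(3), of i] by simp
qed

lemma (in group) cj_closed_subgroup:
  "subgroup K G \<Longrightarrow> g \<in> K \<Longrightarrow> x \<in> K \<Longrightarrow> cj g x \<in> K"
  by (simp add: cj_def subgroup.m_closed subgroup.m_inv_closed)

lemma (in group) subgroup_nat_pow_closed: "subgroup K G \<Longrightarrow> x \<in> K \<Longrightarrow> x [^] (i::nat) \<in> K"
  by (induction i) (simp_all add: subgroup.one_closed subgroup.m_closed)

text \<open>Composing multiplication by the primitive root with the transposition of
  \<open>p + 1\<close> and \<open>n\<close> makes it even, so it is the value of a word
  \<open>H\<close> in \<open>W\<close> and \<open>Z\<close>. The transposition commutes with
  \<open>u\<close>, so the action on \<open>u\<close> is unchanged, and it inverts \<open>z\<close>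
  because \<open>p\<close> is fixed. As \<open>t\<close> is even, \<open>r\<close> is
  trivial.\<close>

lemma seven_relators_even:
  fixes F :: "'f monoid"
  assumes F: "group F" and p: "prime p" "odd p" and n: "p + 2 \<le> n" and M: "M = n - 1 \<or> M = n" "M < 2 * p"
    and even: "even (M - (p + 1))"
  shows "seven_relators F n (Alt {1..n}) (cyc 1 p \<circ> cyc (p + 1) M) (tri (p + 1) n p)"
  unfolding seven_relators_def
proof (intro allI impI)
  fix \<phi> W Z
  assume \<phi>: "\<phi> \<in> hom F (sym_group n)" and WZ: "W \<in> carrier F" "Z \<in> carrier F"
    and \<phi>W: "\<phi> W = cyc 1 p \<circ> cyc (p + 1) M" and \<phi>Z: "\<phi> Z = tri (p + 1) n p"
  interpret F: group F by fact
  obtain s where s: "residue_primroot p s" using prime_primitive_root_exists[of p] p(1) prime_gt_1_nat[of p] by auto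
  have "p < M" using M n by auto
  then obtain \<alpha> \<beta> where ab: "cycle_powers p M \<alpha> \<beta>" by (rule obtain_cycle_powers[OF p(1) _ M(2)])
  interpret cp: cycle_powers p M \<alpha> \<beta> by fact
  define U T k L where "U = W [^]\<^bsub>F\<^esub> \<alpha>" and "T = W [^]\<^bsub>F\<^esub> \<beta>" and "k = n - p - 2" and "L = p * (M - p)"
  interpret generator_lifts F n p k M \<phi> U T Z
    using \<phi> p n M WZ \<phi>Z hom_sym_group_pow[OF F \<phi> WZ(1)] cp.cycle_power odd_prime_ge_3[OF p]
    by unfold_locales (auto simp: U_def T_def k_def \<phi>W)
  have "mulperm p s permutes {1..n}"
    using n by (intro permutes_subset[OF mulperm_permutes[OF p s]]) auto
  moreover have "transpose (p + 1) n permutes {1..n}" using n by (intro permutes_swap_id) auto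
  moreover have "evenperm (mulperm p s \<circ> transpose (p + 1) n)"
    using odd_mulperm[OF p s] n permutes_imp_permutation[OF _ mulperm_permutes[OF p s]]
    by (subst evenperm_comp) (auto simp: evenperm_swap permutation_swap_id)
  ultimately have h0: "mulperm p s \<circ> transpose (p + 1) n \<in> Alt {1..n}"
    by (simp add: Alt_def permutes_compose)
  have K: "subgroup (generate F {W, Z}) F" using WZ by (intro F.generate_is_subgroup) auto
  have WK: "W \<in> generate F {W, Z}" "Z \<in> generate F {W, Z}" by (auto intro: generate.incl)
  have UT: "U \<in> generate F {W, Z}" "T \<in> generate F {W, Z}"
    unfolding U_def T_def using WK by (auto intro: F.subgroup_nat_pow_closed[OF K])
  have "Alt {1..n} \<subseteq> \<phi> ` generate F {W, Z}"
    using WK UT by (intro Alt_subset_image[OF K]) (auto intro: F.cj_closed_subgroup[OF K])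
  then obtain H where "H \<in> generate F {W, Z}" and \<phi>H: "\<phi> H = mulperm p s \<circ> transpose (p + 1) n"
    using h0 by (metis imageE subsetD)
  then have H: "H \<in> carrier F" using subgroup.subset[OF K] by blast
  obtain Y Y' B where Y: "Y \<in> AF" "Y' \<in> AF" "\<phi> Y = tri 1 2 n" "\<phi> (F.cj T Y) = \<phi> Y'"
    and B: "B \<in> AF" "\<phi> B \<circ> \<phi> T = cyc 1 (2 * n - 1 - M)" by (rule obtain_words)
  have "evenperm (\<phi> T \<circ> \<phi> \<one>\<^bsub>F\<^esub>)" using even n M evenperm_cyc[of "p + 1" M] by (auto simp: \<phi>_one \<phi>T)
  then obtain X where X: "X \<in> AF" "\<phi> (T \<otimes>\<^bsub>F\<^esub> \<one>\<^bsub>F\<^esub>) = \<phi> (F.cj ((B \<otimes>\<^bsub>F\<^esub> T) [^]\<^bsub>F\<^esub> k) X)"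
    by (rule obtain_window_word[OF B F.one_closed, rotated]) (auto simp: \<phi>_one permutes_id)
  note c = carrier WZ H AF_carrier[OF Y(1)] AF_carrier[OF Y(2)] AF_carrier[OF B(1)] AF_carrier[OF X(1)]
  let ?C = "F.cj ((B \<otimes>\<^bsub>F\<^esub> T) [^]\<^bsub>F\<^esub> k) X"
  \<comment> \<open>In order: the order of \<open>w\<close>, the action of \<open>h\<close> on
    \<open>u\<close>, the cube of \<open>z\<close>, the action of \<open>h\<close> on
    \<open>z\<close>, one pair relation, the action of \<open>t\<close> on \<open>y\<close>, and the
    position of \<open>t\<close> in the window.\<close>
  let ?R = "{W [^]\<^bsub>F\<^esub> L, (H \<otimes>\<^bsub>F\<^esub> U) \<otimes>\<^bsub>F\<^esub> inv\<^bsub>F\<^esub> (U [^]\<^bsub>F\<^esub> s \<otimes>\<^bsub>F\<^esub> H),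
    Z \<otimes>\<^bsub>F\<^esub> Z \<otimes>\<^bsub>F\<^esub> Z, (H \<otimes>\<^bsub>F\<^esub> Z) \<otimes>\<^bsub>F\<^esub> inv\<^bsub>F\<^esub> (inv\<^bsub>F\<^esub> Z \<otimes>\<^bsub>F\<^esub> H),
    Z \<otimes>\<^bsub>F\<^esub> F.cj U Z \<otimes>\<^bsub>F\<^esub> Z \<otimes>\<^bsub>F\<^esub> F.cj U Z, F.cj T Y \<otimes>\<^bsub>F\<^esub> inv\<^bsub>F\<^esub> Y', T \<otimes>\<^bsub>F\<^esub> inv\<^bsub>F\<^esub> ?C}"
  have "few_cosets F \<phi> {W, Z} ?R (card (Alt {1..n}))"
  proof (rule few_cosetsI[OF F \<phi>])
    fix H' :: "'f set monoid" and q f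
    assume H': "group H'" "q \<in> hom F H'" "f \<in> hom H' (sym_group n)" "\<And>x. x \<in> carrier F \<Longrightarrow> f (q x) = \<phi> x"
      and rel: "\<And>x. x \<in> ?R \<Longrightarrow> q x = \<one>\<^bsub>H'\<^esub>" and gen: "carrier H' = generate H' (q ` {W, Z})"
    interpret H: group H' by fact
    interpret q: group_hom F H' q using H' F by (intro group_hom.intro group_hom_axioms.intro)
    have "q (W [^]\<^bsub>F\<^esub> L) = \<one>\<^bsub>H'\<^esub>" by (rule rel) simp
    then have wL: "q W [^]\<^bsub>H'\<^esub> L = \<one>\<^bsub>H'\<^esub>" using c by (simp add: q.hom_nat_pow)
    have "q (H \<otimes>\<^bsub>F\<^esub> U) = q (U [^]\<^bsub>F\<^esub> s \<otimes>\<^bsub>F\<^esub> H)"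
      by (rule q.hom_relatorD[OF rel]) (use c in simp_all)
    then have hu: "q H \<otimes>\<^bsub>H'\<^esub> q U = q U [^]\<^bsub>H'\<^esub> s \<otimes>\<^bsub>H'\<^esub> q H" using c by (simp add: q.hom_nat_pow)
    have "q (Z \<otimes>\<^bsub>F\<^esub> Z \<otimes>\<^bsub>F\<^esub> Z) = \<one>\<^bsub>H'\<^esub>" by (rule rel) simp
    then have zzz: "q Z \<otimes>\<^bsub>H'\<^esub> q Z \<otimes>\<^bsub>H'\<^esub> q Z = \<one>\<^bsub>H'\<^esub>" using c by simp
    have "q (H \<otimes>\<^bsub>F\<^esub> Z) = q (inv\<^bsub>F\<^esub> Z \<otimes>\<^bsub>F\<^esub> H)"
      by (rule q.hom_relatorD[OF rel]) (use c in simp_all)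
    then have hz: "H.cj (q H) (q Z) = inv\<^bsub>H'\<^esub> q Z" using c by (simp add: H.cj_def H.m_assoc)
    have "q (Z \<otimes>\<^bsub>F\<^esub> F.cj U Z \<otimes>\<^bsub>F\<^esub> Z \<otimes>\<^bsub>F\<^esub> F.cj U Z) = \<one>\<^bsub>H'\<^esub>" by (rule rel) simp
    then have pair: "q Z \<otimes>\<^bsub>H'\<^esub> H.cj (q U) (q Z) \<otimes>\<^bsub>H'\<^esub> q Z \<otimes>\<^bsub>H'\<^esub> H.cj (q U) (q Z) = \<one>\<^bsub>H'\<^esub>"
      using c by (simp add: q.hom_cj)
    have "q (F.cj T Y) = q Y'"
      by (rule q.hom_relatorD[OF rel]) (use c in simp_all)
    then have ty: "H.cj (q T) (q Y) = q Y'" using c by (simp add: q.hom_cj)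
    have "q T = q ?C" by (rule q.hom_relatorD[OF rel]) (use c in simp_all)
    then have tC: "q T \<otimes>\<^bsub>H'\<^esub> \<one>\<^bsub>H'\<^esub> = H.cj ((q B \<otimes>\<^bsub>H'\<^esub> q T) [^]\<^bsub>H'\<^esub> k) (q X)"
      using c by (simp add: q.hom_cj q.hom_nat_pow)
    have qU: "q U = q W [^]\<^bsub>H'\<^esub> \<alpha>" and qT: "q T = q W [^]\<^bsub>H'\<^esub> \<beta>"
      unfolding U_def T_def using WZ by (simp_all add: q.hom_nat_pow)
    note split = H.split_power[OF ab q.hom_closed[OF WZ(1)] wL[unfolded L_def], folded qU qT]
    have qc: "q x \<in> carrier H'" if "x \<in> carrier F" for x using that by (rule q.hom_closed)
    have pairs: "q Z \<otimes>\<^bsub>H'\<^esub> H.cj (q U [^]\<^bsub>H'\<^esub> j) (q Z) \<otimes>\<^bsub>H'\<^esub> q Z \<otimes>\<^bsub>H'\<^esub>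
        H.cj (q U [^]\<^bsub>H'\<^esub> j) (q Z) = \<one>\<^bsub>H'\<^esub>" if "0 < j" "j < p" for j
      by (rule H.pairs_by_primitive_root[OF qc qc qc p s split(1) hu disjI2[OF hz] pair that]) (rule c)+
    have base: "alternating_base H' n p k M f (q U) (q T) (q Z) (q Y)"
      by (rule base_in_quotient[OF H' Y(1,3,2) split(1,4) zzz pairs ty])
    interpret alternating_extension H' n p k M f "q U" "q T" "q Z" "q Y"
        "generate H' ((\<lambda>j. H.cj (q U [^]\<^bsub>H'\<^esub> j) (q Z)) ` {..<p})" "q B" "q X" "\<one>\<^bsub>H'\<^esub>"
      by (rule extension_in_quotient[OF H' base B X(1) H.one_closed tC]) (use qc c AF_carrier in auto)
    have gen': "carrier H' = generate H' {q U \<otimes>\<^bsub>H'\<^esub> q T, q Z}" using gen by (simp add: split(3))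
    have "q U \<in> N" by (rule u_N[OF gen' qc hu primroot_not_dvd(2,3)[OF p s]]) (rule H)
    then have "finite (carrier H') \<and> 2 * card (carrier H') \<le> fact n" by (rule carrier_bound_even[OF gen' _ refl])
    moreover have "2 * card (Alt {1..n}) = fact n" using n card_Alt[of "{1..n}"] by simp
    ultimately show "finite (carrier H') \<and> card (carrier H') \<le> card (Alt {1..n})" by linarith
  qed (use WZ in auto)
  moreover have "\<phi> x = id" if "x \<in> ?R" for x
  proof -
    have HU: "\<phi> (H \<otimes>\<^bsub>F\<^esub> U) = \<phi> (U [^]\<^bsub>F\<^esub> s \<otimes>\<^bsub>F\<^esub> H)"
    proof -
      have "transpose (p + 1) n \<circ> cyc 1 p = cyc 1 p \<circ> transpose (p + 1) n"
        using n by (auto simp: fun_eq_iff transpose_def cyc_def)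
      then have "mulperm p s \<circ> transpose (p + 1) n \<circ> cyc 1 p = mulperm p s \<circ> cyc 1 p \<circ> transpose (p + 1) n"
        by (simp only: comp_assoc)
      also have "\<dots> = cyc 1 p ^^ s \<circ> (mulperm p s \<circ> transpose (p + 1) n)"
        by (simp only: mulperm_cyc[OF p s] comp_assoc)
      finally show ?thesis using c by (simp add: \<phi>_mult \<phi>_pow \<phi>H \<phi>U)
    qed
    have HZ: "\<phi> (H \<otimes>\<^bsub>F\<^esub> Z) = \<phi> (inv\<^bsub>F\<^esub> Z \<otimes>\<^bsub>F\<^esub> H)"
    proof -
      have "\<phi> H \<circ> tri (p + 1) n p = tri (\<phi> H (p + 1)) (\<phi> H n) (\<phi> H p) \<circ> \<phi> H"
        by (rule tri_conj[OF permutes_inj[OF \<phi>_permutes[OF H]]])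
      also have "tri (\<phi> H (p + 1)) (\<phi> H n) (\<phi> H p) = tri n (p + 1) p"
        using n by (simp add: \<phi>H mulperm_def)
      also have "tri n (p + 1) p = inv' (tri (p + 1) n p)"
        using n tri_comp_reverse[of "p + 1" n p] tri_comp_reverse[of n "p + 1" p] by (intro inv_unique_comp[symmetric]) auto
      finally have e: "\<phi> H \<circ> tri (p + 1) n p = inv' (tri (p + 1) n p) \<circ> \<phi> H" .
      show ?thesis using c by (simp only: \<phi>_mult \<phi>_inv \<phi>Z e F.inv_closed)
    qed
    have "\<phi> (W [^]\<^bsub>F\<^esub> L) = id" using cp.cycle_power(3) hom_sym_group_pow[OF F \<phi> WZ(1)] by (simp add: L_def \<phi>W)
    moreover have "\<phi> T = \<phi> ?C" using X(2) c by simp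
    moreover have "?C \<in> carrier F" using c by simp
    ultimately show ?thesis
      using that c HU HZ \<phi>_cube \<phi>_pair Y(4) by (elim insertE emptyE) (simp_all add: \<phi>_relator)
  qed
  moreover have "?R \<subseteq> carrier F" using c by simp
  ultimately show "\<exists>R \<subseteq> carrier F. finite R \<and> card R \<le> 7 \<and> (\<forall>x \<in> R. \<phi> x = id) \<and> few_cosets F \<phi> {W, Z} R (card (Alt {1..n}))"
    using card_le_7 by (intro exI[of _ ?R] conjI ballI) auto
qed

section \<open>The symmetric group, with an odd second cycle\<close>

lemma cyc_commute_disjoint:
  assumes "\<pi> permutes {1..p}"
  shows "cyc (p + 1) M \<circ> \<pi> = \<pi> \<circ> cyc (p + 1) M"
proof
  fix i
  show "(cyc (p + 1) M \<circ> \<pi>) i = (\<pi> \<circ> cyc (p + 1) M) i"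
  proof (cases "i \<in> {1..p}")
    case True
    then have "\<pi> i \<in> {1..p}" using permutes_in_image[OF assms] by blast
    then have "cyc (p + 1) M (\<pi> i) = \<pi> i" by (intro cyc_outside) auto
    moreover have "cyc (p + 1) M i = i" using True by (intro cyc_outside) auto
    ultimately show ?thesis by (simp only: comp_apply)
  next
    case False
    then have "cyc (p + 1) M i \<notin> {1..p}" by (auto simp: cyc_def)
    then have "\<pi> (cyc (p + 1) M i) = cyc (p + 1) M i" by (rule permutes_not_in[OF assms])
    moreover have "\<pi> i = i" using False by (rule permutes_not_in[OF assms])
    ultimately show ?thesis by (simp only: comp_apply)
  qed
qed

text \<open>The word \<open>H\<close> lies over multiplication by the primitive root, which fixes
  \<open>z\<close>, and has the form \<open>T V\<close> with \<open>V\<close> falling into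
  \<open>N\<close>. The factor \<open>r = H P\<close>, where \<open>P\<close> comes from
  \<open>AF\<close>, lies over the transposition of \<open>p\<close> and \<open>p - 1\<close>; so
  \<open>t r\<close> is even, while modulo \<open>N\<close> the factor \<open>r\<close> equals
  \<open>t\<close>, as the order bound requires.\<close>

lemma seven_relators_odd:
  fixes F :: "'f monoid"
  assumes F: "group F" and p: "prime p" "odd p" and n: "p + 2 \<le> n" "n \<le> 2 * p" and M: "M = n - 1 \<or> M = n" "M < 2 * p"
    and odd: "odd (M - (p + 1))"
  shows "seven_relators F n {\<sigma>. \<sigma> permutes {1..n}} (cyc 1 p \<circ> cyc (p + 1) M) (tri (p + 1) n p)"
  unfolding seven_relators_def
proof (intro allI impI)
  fix \<phi> W Z
  assume \<phi>: "\<phi> \<in> hom F (sym_group n)" and WZ: "W \<in> carrier F" "Z \<in> carrier F"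
    and \<phi>W: "\<phi> W = cyc 1 p \<circ> cyc (p + 1) M" and \<phi>Z: "\<phi> Z = tri (p + 1) n p"
  interpret F: group F by fact
  obtain s where s: "residue_primroot p s" using prime_primitive_root_exists[of p] p(1) prime_gt_1_nat[of p] by auto
  have "p < M" using M n by auto
  then obtain \<alpha> \<beta> where ab: "cycle_powers p M \<alpha> \<beta>" by (rule obtain_cycle_powers[OF p(1) _ M(2)])
  interpret cp: cycle_powers p M \<alpha> \<beta> by fact
  \<comment> \<open>With this exponent one relator \<open>H W = W [^] e H\<close> says both that
    \<open>h\<close> raises \<open>u\<close> to the power \<open>s\<close> and that \<open>h\<close>
    commutes with \<open>t\<close>.\<close>
  obtain e where e: "[e = s] (mod p)" "[e = 1] (mod (M - p))"
    using binary_chinese_remainder_nat[OF cp.coprime_lengths] by metis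
  define U T k L where "U = W [^]\<^bsub>F\<^esub> \<alpha>" and "T = W [^]\<^bsub>F\<^esub> \<beta>" and "k = n - p - 2" and "L = p * (M - p)"
  interpret generator_lifts F n p k M \<phi> U T Z
    using \<phi> p n M WZ \<phi>Z hom_sym_group_pow[OF F \<phi> WZ(1)] cp.cycle_power odd_prime_ge_3[OF p]
    by unfold_locales (auto simp: U_def T_def k_def \<phi>W)
  let ?h = "mulperm p s"
  have hn: "?h permutes {1..n}"
    using n by (intro permutes_subset[OF mulperm_permutes[OF p s]]) auto
  have hp: "permutation ?h" using permutes_imp_permutation[OF _ hn] by simp
  have tn: "cyc (p + 1) M permutes {1..n}"
    using n M by (intro permutes_subset[OF cyc_permutes]) auto
  have t_odd: "\<not> evenperm (cyc (p + 1) M)" using odd n M evenperm_cyc[of "p + 1" M] by auto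
  have h0: "inv' (cyc (p + 1) M) \<circ> ?h \<in> Alt {1..n}"
    using hn tn odd_mulperm[OF p s] t_odd hp permutes_imp_permutation[OF _ tn]
    by (auto simp: Alt_def evenperm_comp evenperm_inv permutation_inverse intro!: permutes_compose permutes_inv)
  \<comment> \<open>Words in these conjugates of \<open>Z\<close> fall into the normal subgroup
    \<open>N\<close>, whereas \<open>W\<close> has an odd value. They still represent every even
    permutation.\<close>
  let ?V = "(\<lambda>i::nat. F.cj (W [^]\<^bsub>F\<^esub> i) Z) ` UNIV"
  have VF: "?V \<subseteq> carrier F" using WZ by auto
  have K: "subgroup (generate F ?V) F" by (rule F.generate_is_subgroup[OF VF])
  have W_pow: "F.cj (W [^]\<^bsub>F\<^esub> (j::nat)) x \<in> generate F ?V" if "x \<in> generate F ?V" for x j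
  proof (rule F.cj_generate_closed[OF _ VF K _ that])
    fix x assume "x \<in> ?V"
    then obtain i where "x = F.cj (W [^]\<^bsub>F\<^esub> (i::nat)) Z" by blast
    then have "F.cj (W [^]\<^bsub>F\<^esub> j) x = F.cj (W [^]\<^bsub>F\<^esub> (j + i)) Z"
      using WZ by (simp add: F.cj_cj F.nat_pow_mult)
    then show "F.cj (W [^]\<^bsub>F\<^esub> j) x \<in> generate F ?V" by (auto intro: generate.incl)
  qed (use WZ in simp)
  have "Z = F.cj (W [^]\<^bsub>F\<^esub> (0::nat)) Z" using WZ by simp
  then have "Z \<in> generate F ?V" by (metis generate.incl rangeI)
  then have "Alt {1..n} \<subseteq> \<phi> ` generate F ?V"
    by (rule Alt_subset_image[OF K]) (simp_all only: U_def T_def W_pow)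
  then have "inv' (cyc (p + 1) M) \<circ> ?h \<in> \<phi> ` generate F ?V" using h0 by (rule subsetD)
  then obtain V where V: "V \<in> generate F ?V" "inv' (cyc (p + 1) M) \<circ> ?h = \<phi> V" by (rule imageE)
  then have VC: "V \<in> carrier F" using subgroup.subset[OF K] by blast
  define H where "H = T \<otimes>\<^bsub>F\<^esub> V"
  have H: "H \<in> carrier F" using VC carrier by (simp add: H_def)
  have \<phi>H: "\<phi> H = ?h"
    using carrier VC permutes_inv_o(1)[OF tn] by (simp add: H_def \<phi>_mult \<phi>T V(2)[symmetric] flip: comp_assoc)
  let ?\<rho> = "transpose p (p - 1)"
  have \<rho>: "?\<rho> permutes {p - 1, p}" "\<not> evenperm ?\<rho>"
    using p3 by (auto simp: evenperm_swap intro: permutes_swap_id)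
  have \<rho>p: "?\<rho> permutes {1..p}" using p3 by (intro permutes_swap_id) auto
  have hpp: "?h permutes {1..p}" by (rule permutes_subset[OF mulperm_permutes[OF p s]]) auto
  have pi0: "inv' ?h \<circ> ?\<rho> \<in> Alt {1..p}"
    using hpp \<rho>p \<rho>(2) odd_mulperm[OF p s] hp
    by (auto simp: Alt_def evenperm_comp evenperm_inv permutation_inverse permutation_swap_id
        intro!: permutes_compose permutes_inv)
  then have "inv' ?h \<circ> ?\<rho> \<in> Alt ({1..p + 1} \<union> {n})" by (rule subsetD[OF Alt_mono, rotated]) auto
  then obtain P where P: "P \<in> AF" "\<phi> P = inv' ?h \<circ> ?\<rho>" by (rule lift_Alt)
  define r where "r = H \<otimes>\<^bsub>F\<^esub> P"
  have PC: "P \<in> carrier F" by (rule AF_carrier[OF P(1)])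
  have rC: "r \<in> carrier F" using H PC by (simp add: r_def)
  have \<phi>r: "\<phi> r = ?\<rho>"
    using H PC permutes_inv_o(1)[OF hn] by (simp add: r_def \<phi>_mult \<phi>H P(2) flip: comp_assoc)
  obtain Y Y' B where Y: "Y \<in> AF" "Y' \<in> AF" "\<phi> Y = tri 1 2 n" "\<phi> (F.cj T Y) = \<phi> Y'"
    and B: "B \<in> AF" "\<phi> B \<circ> \<phi> T = cyc 1 (2 * n - 1 - M)" by (rule obtain_words)
  have "evenperm (\<phi> T \<circ> \<phi> r)"
    using t_odd \<rho>(2) permutes_imp_permutation[OF _ tn]
    by (simp add: \<phi>T \<phi>r evenperm_comp permutation_swap_id)
  then obtain X where X: "X \<in> AF" "\<phi> (T \<otimes>\<^bsub>F\<^esub> r) = \<phi> (F.cj ((B \<otimes>\<^bsub>F\<^esub> T) [^]\<^bsub>F\<^esub> k) X)"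
    by (rule obtain_window_word[OF B rC \<rho>(1)[folded \<phi>r]])
  note c = carrier WZ H VC PC rC AF_carrier[OF Y(1)] AF_carrier[OF Y(2)] AF_carrier[OF B(1)] AF_carrier[OF X(1)]
  let ?C = "F.cj ((B \<otimes>\<^bsub>F\<^esub> T) [^]\<^bsub>F\<^esub> k) X"
  let ?R = "{W [^]\<^bsub>F\<^esub> L, (H \<otimes>\<^bsub>F\<^esub> W) \<otimes>\<^bsub>F\<^esub> inv\<^bsub>F\<^esub> (W [^]\<^bsub>F\<^esub> e \<otimes>\<^bsub>F\<^esub> H),
    Z \<otimes>\<^bsub>F\<^esub> Z \<otimes>\<^bsub>F\<^esub> Z, (H \<otimes>\<^bsub>F\<^esub> Z) \<otimes>\<^bsub>F\<^esub> inv\<^bsub>F\<^esub> (Z \<otimes>\<^bsub>F\<^esub> H),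
    Z \<otimes>\<^bsub>F\<^esub> F.cj U Z \<otimes>\<^bsub>F\<^esub> Z \<otimes>\<^bsub>F\<^esub> F.cj U Z, F.cj T Y \<otimes>\<^bsub>F\<^esub> inv\<^bsub>F\<^esub> Y', (T \<otimes>\<^bsub>F\<^esub> r) \<otimes>\<^bsub>F\<^esub> inv\<^bsub>F\<^esub> ?C}"
  have "few_cosets F \<phi> {W, Z} ?R (card {\<sigma>. \<sigma> permutes {1..n}})"
  proof (rule few_cosetsI[OF F \<phi>])
    fix H' :: "'f set monoid" and q f
    assume H': "group H'" "q \<in> hom F H'" "f \<in> hom H' (sym_group n)" "\<And>x. x \<in> carrier F \<Longrightarrow> f (q x) = \<phi> x"
      and rel: "\<And>x. x \<in> ?R \<Longrightarrow> q x = \<one>\<^bsub>H'\<^esub>" and gen: "carrier H' = generate H' (q ` {W, Z})"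
    interpret H: group H' by fact
    interpret q: group_hom F H' q using H' F by (intro group_hom.intro group_hom_axioms.intro)
    have qc: "q x \<in> carrier H'" if "x \<in> carrier F" for x using that by (rule q.hom_closed)
    have "q (W [^]\<^bsub>F\<^esub> L) = \<one>\<^bsub>H'\<^esub>" by (rule rel) simp
    then have wL: "q W [^]\<^bsub>H'\<^esub> L = \<one>\<^bsub>H'\<^esub>" using c by (simp add: q.hom_nat_pow)
    have "q (H \<otimes>\<^bsub>F\<^esub> W) = q (W [^]\<^bsub>F\<^esub> e \<otimes>\<^bsub>F\<^esub> H)"
      by (rule q.hom_relatorD[OF rel]) (use c in simp_all)
    then have "q H \<otimes>\<^bsub>H'\<^esub> q W = q W [^]\<^bsub>H'\<^esub> e \<otimes>\<^bsub>H'\<^esub> q H" using c by (simp add: q.hom_nat_pow)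
    then have hw: "H.cj (q H) (q W) = q W [^]\<^bsub>H'\<^esub> e" using c by (simp add: H.cj_def H.m_assoc)
    have hw_pow: "H.cj (q H) (q W [^]\<^bsub>H'\<^esub> i) = q W [^]\<^bsub>H'\<^esub> (e * i)" for i :: nat
      using c hw by (simp add: H.cj_pow H.nat_pow_pow)
    have "q (Z \<otimes>\<^bsub>F\<^esub> Z \<otimes>\<^bsub>F\<^esub> Z) = \<one>\<^bsub>H'\<^esub>" by (rule rel) simp
    then have zzz: "q Z \<otimes>\<^bsub>H'\<^esub> q Z \<otimes>\<^bsub>H'\<^esub> q Z = \<one>\<^bsub>H'\<^esub>" using c by simp
    have "q (H \<otimes>\<^bsub>F\<^esub> Z) = q (Z \<otimes>\<^bsub>F\<^esub> H)"
      by (rule q.hom_relatorD[OF rel]) (use c in simp_all)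
    then have hz: "H.cj (q H) (q Z) = q Z" using c by (simp add: H.cj_def H.m_assoc)
    have "q (Z \<otimes>\<^bsub>F\<^esub> F.cj U Z \<otimes>\<^bsub>F\<^esub> Z \<otimes>\<^bsub>F\<^esub> F.cj U Z) = \<one>\<^bsub>H'\<^esub>" by (rule rel) simp
    then have pair: "q Z \<otimes>\<^bsub>H'\<^esub> H.cj (q U) (q Z) \<otimes>\<^bsub>H'\<^esub> q Z \<otimes>\<^bsub>H'\<^esub> H.cj (q U) (q Z) = \<one>\<^bsub>H'\<^esub>"
      using c by (simp add: q.hom_cj)
    have "q (F.cj T Y) = q Y'"
      by (rule q.hom_relatorD[OF rel]) (use c in simp_all)
    then have ty: "H.cj (q T) (q Y) = q Y'" using c by (simp add: q.hom_cj)
    have "q (T \<otimes>\<^bsub>F\<^esub> r) = q ?C" by (rule q.hom_relatorD[OF rel]) (use c in simp_all)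
    then have tC: "q T \<otimes>\<^bsub>H'\<^esub> q r = H.cj ((q B \<otimes>\<^bsub>H'\<^esub> q T) [^]\<^bsub>H'\<^esub> k) (q X)"
      using c by (simp add: q.hom_cj q.hom_nat_pow)
    have qU: "q U = q W [^]\<^bsub>H'\<^esub> \<alpha>" and qT: "q T = q W [^]\<^bsub>H'\<^esub> \<beta>"
      unfolding U_def T_def using WZ by (simp_all add: q.hom_nat_pow)
    note split = H.split_power[OF ab q.hom_closed[OF WZ(1)] wL[unfolded L_def], folded qU qT]
    have "[e * \<alpha> = \<alpha> * s] (mod p)" using cong_mult[OF e(1) cong_refl[of \<alpha>]] by (simp add: mult.commute)
    moreover have "[e * \<alpha> = \<alpha> * s] (mod (M - p))"
    proof -
      have "M - p dvd \<alpha>" using cp.\<alpha>(2) by (simp only: cong_0_iff)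
      then have "M - p dvd e * \<alpha>" "M - p dvd \<alpha> * s" by (rule dvd_mult, rule dvd_mult2)
      then show ?thesis by (simp only: cong_def dvd_eq_mod_eq_0)
    qed
    ultimately have "[e * \<alpha> = \<alpha> * s] (mod L)" unfolding L_def by (rule cp.cong_product)
    then have "H.cj (q H) (q U) = q U [^]\<^bsub>H'\<^esub> s"
      using H.pow_eq_if_cong[OF qc[OF WZ(1)] wL] WZ qc by (simp add: qU hw_pow H.nat_pow_pow)
    then have hu: "q H \<otimes>\<^bsub>H'\<^esub> q U = q U [^]\<^bsub>H'\<^esub> s \<otimes>\<^bsub>H'\<^esub> q H"
      using c qc by (metis H.cj_def H.inv_solve_right' H.m_closed H.nat_pow_closed)
    have "[e * \<beta> = \<beta>] (mod (M - p))" using cong_mult[OF e(2) cong_refl[of \<beta>]] by simp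
    moreover have "[e * \<beta> = \<beta>] (mod p)"
    proof -
      have "p dvd \<beta>" using cp.\<beta>(1) by (simp only: cong_0_iff)
      then have "p dvd e * \<beta>" "p dvd \<beta>" by (rule dvd_mult, assumption)
      then show ?thesis by (simp only: cong_def dvd_eq_mod_eq_0)
    qed
    ultimately have "[e * \<beta> = \<beta>] (mod L)" unfolding L_def by (intro cp.cong_product)
    then have "H.cj (q H) (q T) = q T"
      using H.pow_eq_if_cong[OF qc[OF WZ(1)] wL] by (simp add: qT hw_pow)
    then have ht: "q H \<otimes>\<^bsub>H'\<^esub> q T = q T \<otimes>\<^bsub>H'\<^esub> q H" using c qc H.cj_eq_iff by simp
    have pairs: "q Z \<otimes>\<^bsub>H'\<^esub> H.cj (q U [^]\<^bsub>H'\<^esub> j) (q Z) \<otimes>\<^bsub>H'\<^esub> q Z \<otimes>\<^bsub>H'\<^esub>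
        H.cj (q U [^]\<^bsub>H'\<^esub> j) (q Z) = \<one>\<^bsub>H'\<^esub>" if "0 < j" "j < p" for j
      by (rule H.pairs_by_primitive_root[OF qc qc qc p s split(1) hu disjI1[OF hz] pair that]) (rule c)+
    have base: "alternating_base H' n p k M f (q U) (q T) (q Z) (q Y)"
      by (rule base_in_quotient[OF H' Y(1,3,2) split(1,4) zzz pairs ty])
    let ?A = "generate H' ((\<lambda>j. H.cj (q U [^]\<^bsub>H'\<^esub> j) (q Z)) ` {..<p})"
    have qAF: "q ` AF = ?A" by (rule image_AF[OF H'(1,2)])
    interpret b: alternating_base H' n p k M f "q U" "q T" "q Z" "q Y" ?A by (rule base)
    have f: "f (q x) = \<phi> x" if "x \<in> carrier F" for x using that by (rule H'(4))
    have PA: "q P \<in> ?A" using P(1) qAF by blast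
    have "f (q P) \<in> Alt {1..p}" using f[OF PC] P(2) pi0 by simp
    then have fP: "f (q P) \<in> Alt ({1..p} \<union> {n})" by (rule subsetD[OF Alt_mono, rotated]) auto
    \<comment> \<open>The permutation below \<open>P\<close> moves only letters up to
      \<open>p\<close>, so \<open>t\<close> conjugates \<open>q P\<close> into \<open>A\<close>,
      where the permutation decides equality.\<close>
    have "H.cj (q T) (q P) = q P"
    proof (rule b.A_eqI[OF b.cj_t_A[OF PA fP] PA])
      have "cyc (p + 1) M \<circ> (inv' ?h \<circ> ?\<rho>) = (inv' ?h \<circ> ?\<rho>) \<circ> cyc (p + 1) M"
        by (rule cyc_commute_disjoint[OF AltD(1)[OF pi0]])
      then have "\<phi> (F.cj T P) = \<phi> P"
        using c permutes_inv_o(1)[OF tn] by (simp add: \<phi>_cj \<phi>T P(2) comp_assoc)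
      then show "f (H.cj (q T) (q P)) = f (q P)" using f c by (simp flip: q.hom_cj)
    qed
    then have "q T \<otimes>\<^bsub>H'\<^esub> q P = q P \<otimes>\<^bsub>H'\<^esub> q T" using c qc H.cj_eq_iff by simp
    then have "q H \<otimes>\<^bsub>H'\<^esub> q P \<otimes>\<^bsub>H'\<^esub> q T = q H \<otimes>\<^bsub>H'\<^esub> q T \<otimes>\<^bsub>H'\<^esub> q P" using c qc by (simp add: H.m_assoc)
    also have "\<dots> = q T \<otimes>\<^bsub>H'\<^esub> (q H \<otimes>\<^bsub>H'\<^esub> q P)" unfolding ht using c qc by (simp add: H.m_assoc)
    finally have rt: "q r \<otimes>\<^bsub>H'\<^esub> q T = q T \<otimes>\<^bsub>H'\<^esub> q r" using c by (simp add: r_def)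
    \<comment> \<open>Since \<open>h\<close> fixes \<open>z\<close> and raises \<open>u\<close> to a
      power, it maps the generators of \<open>A\<close> into \<open>A\<close>. Therefore
      \<open>r\<close> also preserves \<open>A\<close>, and its effect on an element of
      \<open>A\<close> can be read off from the permutations.\<close>
    have hA: "H.cj (q H) x \<in> ?A" if "x \<in> ?A" for x
    proof (rule H.cj_generate_closed[OF qc[OF H] b.gens b.A_subgroup _ that])
      fix x assume "x \<in> (\<lambda>j. H.cj (q U [^]\<^bsub>H'\<^esub> j) (q Z)) ` {..<p}"
      then obtain j where j: "j < p" "x = H.cj (q U [^]\<^bsub>H'\<^esub> j) (q Z)" by auto
      have "H.cj (q H) (q U [^]\<^bsub>H'\<^esub> j) = q U [^]\<^bsub>H'\<^esub> (s * j)"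
        using \<open>H.cj (q H) (q U) = q U [^]\<^bsub>H'\<^esub> s\<close> c qc by (simp add: H.cj_pow H.nat_pow_pow)
      then have "q H \<otimes>\<^bsub>H'\<^esub> q U [^]\<^bsub>H'\<^esub> j = q U [^]\<^bsub>H'\<^esub> (s * j) \<otimes>\<^bsub>H'\<^esub> q H"
        using c qc by (metis H.cj_def H.inv_solve_right' H.m_closed H.nat_pow_closed)
      then have "H.cj (q H) x = H.cj (q U [^]\<^bsub>H'\<^esub> (s * j)) (H.cj (q H) (q Z))"
        using c qc j by (simp add: H.cj_cj)
      also have "\<dots> = H.cj (q U [^]\<^bsub>H'\<^esub> (s * j)) (H.cj (q U [^]\<^bsub>H'\<^esub> (0::nat)) (q Z))"
        using c qc hz by simp
      also have "\<dots> \<in> ?A"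
        using p3 by (intro b.cj_u_pow_A generate.incl) (auto intro!: image_eqI[of _ _ 0])
      finally show "H.cj (q H) x \<in> ?A" .
    qed
    have rx: "H.cj (q r) x = x \<or> H.cj (q r) x = inv\<^bsub>H'\<^esub> x"
      if x: "x \<in> q ` AF" "f x = tri p (p - 1) (p + 1)" for x
    proof -
      have xA: "x \<in> ?A" using x(1) qAF by simp
      have xc: "x \<in> carrier H'" by (rule b.A_carrier[OF xA])
      have "H.cj (q r) x = H.cj (q H) (H.cj (q P) x)" using c qc xc by (simp add: r_def H.cj_cj)
      moreover have "H.cj (q P) x \<in> ?A"
        using PA xA H.cj_closed_subgroup[OF b.A_subgroup] by blast
      ultimately have rxA: "H.cj (q r) x \<in> ?A" using hA by simp
      have "f (H.cj (q r) x) = tri (f (q r) p) (f (q r) (p - 1)) (f (q r) (p + 1))"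
        using qc[OF rC] xc x(2) by (rule b.f_cj_tri)
      also have "\<dots> = tri (p - 1) p (p + 1)"
      proof -
        have "?\<rho> p = p - 1" "?\<rho> (p - 1) = p" "?\<rho> (p + 1) = p + 1" using p3 by (auto simp: transpose_def)
        then show ?thesis by (simp only: f[OF rC] \<phi>r)
      qed
      also have "\<dots> = inv' (tri p (p - 1) (p + 1))"
        using p3 tri_comp_reverse[of "p - 1" p "p + 1"] tri_comp_reverse[of p "p - 1" "p + 1"]
        by (intro inv_unique_comp[symmetric]) auto
      also have "\<dots> = f (inv\<^bsub>H'\<^esub> x)" using b.f_inv[OF xc] x(2) by simp
      finally have "H.cj (q r) x = inv\<^bsub>H'\<^esub> x"
        by (intro b.A_eqI rxA b.A_closed(2) xA)
      then show ?thesis ..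
    qed
    interpret alternating_extension H' n p k M f "q U" "q T" "q Z" "q Y" ?A "q B" "q X" "q r"
      by (rule extension_in_quotient[OF H' base B X(1) qc[OF rC] tC rt rx disjI1[OF split(2)]])
    have gen': "carrier H' = generate H' {q U \<otimes>\<^bsub>H'\<^esub> q T, q Z}" using gen by (simp add: split(3))
    interpret N: normal N H' by (rule normal_N[OF gen'])
    have "q U \<in> N" by (rule u_N[OF gen' qc hu primroot_not_dvd(2,3)[OF p s]]) (rule H)
    moreover have "q V \<in> N"
    proof -
      have "q V \<in> q ` generate F ?V" using V(1) by (rule imageI)
      also have "\<dots> = generate H' (q ` ?V)" by (rule q.generate_img[OF VF, symmetric])
      also have "\<dots> \<subseteq> N"
      proof (rule H.generate_subgroup_incl[OF _ N_subgroup])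
        have "q (F.cj (W [^]\<^bsub>F\<^esub> (i::nat)) Z) \<in> N" for i
          using N.inv_op_closed2[OF qc[of "W [^]\<^bsub>F\<^esub> i"] z_N] c by (simp add: q.hom_cj H.cj_def)
        then show "q ` ?V \<subseteq> N" by blast
      qed
      finally show ?thesis .
    qed
    moreover have "q P \<in> N" using subsetD[OF A_subset_N PA] .
    moreover have "q r = q T \<otimes>\<^bsub>H'\<^esub> q V \<otimes>\<^bsub>H'\<^esub> q P" using c by (simp add: r_def H_def)
    ultimately have "finite (carrier H') \<and> card (carrier H') \<le> fact n"
      by (intro carrier_bound_odd[OF gen'])
    moreover have "card {\<sigma>. \<sigma> permutes {1..n}} = fact n" by (rule card_permutations) auto
    ultimately show "finite (carrier H') \<and> card (carrier H') \<le> card {\<sigma>. \<sigma> permutes {1..n}}" by simp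
  qed (use WZ in auto)
  moreover have "\<phi> x = id" if "x \<in> ?R" for x
  proof -
    have HW: "\<phi> (H \<otimes>\<^bsub>F\<^esub> W) = \<phi> (W [^]\<^bsub>F\<^esub> e \<otimes>\<^bsub>F\<^esub> H)"
    proof -
      have hu: "?h \<circ> cyc 1 p = cyc 1 p ^^ e \<circ> ?h"
      proof -
        have "cyc 1 p ^^ p = id" using cyc_funpow_length[of 1 p] p3 by simp
        then have "cyc 1 p ^^ e = cyc 1 p ^^ s" using e(1) by (rule funpow_eq_if_cong)
        then show ?thesis using mulperm_cyc[OF p s] by simp
      qed
      have ht: "?h \<circ> cyc (p + 1) M = cyc (p + 1) M ^^ e \<circ> ?h"
      proof -
        have "cyc (p + 1) M ^^ (M - p) = id"
        proof -
          have "M - p = M - (p + 1) + 1" using cp.M(1) by arith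
          then show ?thesis using cyc_funpow_length[of "p + 1" M] cp.M(1) by simp
        qed
        then have "cyc (p + 1) M ^^ e = cyc (p + 1) M ^^ 1" using e(2) by (rule funpow_eq_if_cong)
        then show ?thesis using cyc_commute_disjoint[OF hpp, of M] by simp
      qed
      have comm: "cyc 1 p \<circ> cyc (p + 1) M = cyc (p + 1) M \<circ> cyc 1 p"
        by (auto simp: cyc_def fun_eq_iff)
      have "?h \<circ> (cyc 1 p \<circ> cyc (p + 1) M) = cyc 1 p ^^ e \<circ> (?h \<circ> cyc (p + 1) M)"
        using hu by (simp only: comp_assoc[symmetric])
      also have "\<dots> = (cyc 1 p \<circ> cyc (p + 1) M) ^^ e \<circ> ?h"
        unfolding ht funpow_comp_commute[OF comm] by (simp only: comp_assoc)
      finally show ?thesis using c by (simp only: \<phi>_mult \<phi>_pow \<phi>H \<phi>W F.nat_pow_closed)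
    qed
    have HZ: "\<phi> (H \<otimes>\<^bsub>F\<^esub> Z) = \<phi> (Z \<otimes>\<^bsub>F\<^esub> H)"
    proof -
      have "\<phi> H \<circ> tri (p + 1) n p = tri (\<phi> H (p + 1)) (\<phi> H n) (\<phi> H p) \<circ> \<phi> H"
        by (rule tri_conj[OF permutes_inj[OF \<phi>_permutes[OF H]]])
      also have "tri (\<phi> H (p + 1)) (\<phi> H n) (\<phi> H p) = tri (p + 1) n p"
        using n by (simp add: \<phi>H mulperm_def)
      finally have e: "\<phi> H \<circ> tri (p + 1) n p = tri (p + 1) n p \<circ> \<phi> H" .
      show ?thesis using c by (simp only: \<phi>_mult \<phi>Z e)
    qed
    have "\<phi> (W [^]\<^bsub>F\<^esub> L) = id" using cp.cycle_power(3) hom_sym_group_pow[OF F \<phi> WZ(1)] by (simp add: L_def \<phi>W)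
    moreover have "?C \<in> carrier F" using c by simp
    ultimately show ?thesis
      using that c HW HZ \<phi>_cube \<phi>_pair Y(4) X(2) by (elim insertE emptyE) (simp_all add: \<phi>_relator)
  qed
  moreover have "?R \<subseteq> carrier F" using c by simp
  ultimately show "\<exists>R \<subseteq> carrier F. finite R \<and> card R \<le> 7 \<and> (\<forall>x \<in> R. \<phi> x = id) \<and>
      few_cosets F \<phi> {W, Z} R (card {\<sigma>. \<sigma> permutes {1..n}})"
    using card_le_7 by (intro exI[of _ ?R] conjI ballI) auto
qed

section \<open>The alternating group of degree six\<close>

lemma Alt_6_subset_subgroup:
  assumes K: "subgroup K (sym_group 6)" and "tri 4 6 3 \<in> K" "tri 5 4 1 \<in> K" "tri 6 5 2 \<in> K"
  shows "Alt {1..6} \<subseteq> K"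
proof (rule Alt_subset_subgroup[OF K, of _ 4 5])
  have K': "f \<circ> g \<in> K" if "f \<in> K" "g \<in> K" for f g
    using subgroup.m_closed[OF K that] by (simp add: sym_group_mult)
  have 1: "tri 4 5 1 = tri 5 4 1 \<circ> tri 5 4 1" by (auto simp: fun_eq_iff tri_apply)
  have 2: "tri 4 5 2 = tri 4 6 3 \<circ> tri 4 6 3 \<circ> tri 6 5 2 \<circ> tri 4 6 3" by (auto simp: fun_eq_iff tri_apply)
  have 3: "tri 4 5 3 = tri 6 5 2 \<circ> tri 4 6 3 \<circ> tri 6 5 2 \<circ> tri 6 5 2" by (auto simp: fun_eq_iff tri_apply)
  have 6: "tri 4 5 6 = tri 4 6 3 \<circ> tri 4 6 3 \<circ> tri 4 5 3" by (auto simp: fun_eq_iff tri_apply)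
  have m: "tri 4 5 1 \<in> K" "tri 4 5 2 \<in> K" "tri 4 5 3 \<in> K" unfolding 1 2 3 by (intro K' assms)+
  then have m6: "tri 4 5 6 \<in> K" unfolding 6 by (intro K' assms)
  fix w :: nat assume "w \<in> {1..6}" "w \<noteq> 4" "w \<noteq> 5"
  then have "w = 1 \<or> w = 2 \<or> w = 3 \<or> w = 6" by auto
  then show "tri 4 5 w \<in> K" using m m6 by blast
qed auto

text \<open>The conjugates of \<open>(4 6 3)\<close> under the first three powers of
  \<open>w\<close>, from 0 to 2, are the three cycles required by
  \<open>Alt_6_subset_subgroup\<close>.\<close>

lemma Alt_6_subset_image:
  fixes F :: "'f monoid"
  assumes F: "group F" and \<phi>: "\<phi> \<in> hom F (sym_group 6)" and WZ: "W \<in> carrier F" "Z \<in> carrier F"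
    and \<phi>W: "\<phi> W = cyc 1 3 \<circ> cyc 4 6" and \<phi>Z: "\<phi> Z = tri 4 6 3"
  shows "Alt {1..6} \<subseteq> \<phi> ` generate F ((\<lambda>i::nat. group.cj F (W [^]\<^bsub>F\<^esub> i) Z) ` UNIV)"
proof -
  interpret F: group F by fact
  interpret hom: group_hom F "sym_group 6" \<phi>
    using F \<phi> sym_group_is_group by (intro group_hom.intro group_hom_axioms.intro)
  let ?V = "(\<lambda>i::nat. F.cj (W [^]\<^bsub>F\<^esub> i) Z) ` UNIV"
  have VF: "?V \<subseteq> carrier F" using WZ by auto
  have K: "subgroup (generate F ?V) F" by (rule F.generate_is_subgroup[OF VF])
  have \<phi>V: "tri ((\<phi> W ^^ i) 4) ((\<phi> W ^^ i) 6) ((\<phi> W ^^ i) 3) \<in> \<phi> ` generate F ?V" for i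
  proof -
    let ?g = "W [^]\<^bsub>F\<^esub> i"
    have g: "?g \<in> carrier F" using WZ by simp
    have gp: "\<phi> ?g permutes {1..6}" using hom.hom_closed[OF g] by (simp add: sym_group_carrier)
    have "\<phi> (F.cj ?g Z) = \<phi> ?g \<circ> tri 4 6 3 \<circ> inv' (\<phi> ?g)"
      using WZ g hom.hom_closed[OF g] by (simp add: F.cj_def sym_group_mult \<phi>Z)
    also have "\<dots> = tri (\<phi> ?g 4) (\<phi> ?g 6) (\<phi> ?g 3)" by (rule tri_conj_inv[OF gp])
    finally have "tri (\<phi> ?g 4) (\<phi> ?g 6) (\<phi> ?g 3) = \<phi> (F.cj ?g Z)" ..
    moreover have "F.cj ?g Z \<in> generate F ?V" by (intro generate.incl) simp
    ultimately show ?thesis using hom_sym_group_pow[OF F \<phi> WZ(1)] by simp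
  qed
  show ?thesis
    using \<phi>V[of 0] \<phi>V[of 1] \<phi>V[of 2]
    by (intro Alt_6_subset_subgroup hom.subgroup_img_is_subgroup[OF K]) (simp_all add: \<phi>W cyc_def numeral_2_eq_2)
qed

text \<open>Both cycles have length 3, so neither is a power of \<open>w\<close>. Instead
  \<open>U\<close> and \<open>T\<close> are words in conjugates of \<open>Z\<close>, tied to
  \<open>W\<close> by a relator of their own; this choice also puts \<open>u\<close> into
  \<open>N\<close>. For \<open>p = 3\<close> the only exponents are 1 and 2, and the pair relation
  for 2 is a conjugate of the one for 1.\<close>

lemma seven_relators_6:
  fixes F :: "'f monoid"
  assumes F: "group F"
  shows "seven_relators F 6 (Alt {1..6}) (cyc 1 3 \<circ> cyc 4 6) (tri 4 6 3)"
  unfolding seven_relators_def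
proof (intro allI impI)
  fix \<phi> W Z
  assume \<phi>: "\<phi> \<in> hom F (sym_group 6)" and WZ: "W \<in> carrier F" "Z \<in> carrier F"
    and \<phi>W: "\<phi> W = cyc 1 3 \<circ> cyc 4 6" and \<phi>Z: "\<phi> Z = tri 4 6 3"
  interpret F: group F by fact
  let ?V = "(\<lambda>i::nat. F.cj (W [^]\<^bsub>F\<^esub> i) Z) ` UNIV"
  have VF: "?V \<subseteq> carrier F" using WZ by auto
  have K: "subgroup (generate F ?V) F" by (rule F.generate_is_subgroup[OF VF])
  note img = Alt_6_subset_image[OF F \<phi> WZ \<phi>W \<phi>Z]
  have "cyc 1 3 \<in> Alt {1..6}" "cyc 4 6 \<in> Alt {1..6}"
    using evenperm_cyc[of 1 3] evenperm_cyc[of 4 6]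
    by (auto simp: Alt_def intro: permutes_subset[OF cyc_permutes])
  note this[THEN subsetD[OF img]]
  then obtain U T where UT: "U \<in> generate F ?V" "\<phi> U = cyc 1 3" "T \<in> generate F ?V" "\<phi> T = cyc 4 6"
    by (elim imageE) metis
  have UTc: "U \<in> carrier F" "T \<in> carrier F" using UT subgroup.subset[OF K] by blast+
  define n p k M :: nat where "n = 6" and "p = 3" and "k = 1" and "M = 6"
  note v = this
  interpret generator_lifts F n p k M \<phi> U T Z
    using \<phi> WZ \<phi>Z UT UTc by unfold_locales (auto simp: v)
  obtain Y Y' B where Y: "Y \<in> AF" "Y' \<in> AF" "\<phi> Y = tri 1 2 n" "\<phi> (F.cj T Y) = \<phi> Y'"
    and B: "B \<in> AF" "\<phi> B \<circ> \<phi> T = cyc 1 (2 * n - 1 - M)" by (rule obtain_words)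
  have "evenperm (\<phi> T \<circ> \<phi> \<one>\<^bsub>F\<^esub>)" using evenperm_cyc[of 4 6] by (auto simp: \<phi>_one UT)
  then obtain X where X: "X \<in> AF" "\<phi> (T \<otimes>\<^bsub>F\<^esub> \<one>\<^bsub>F\<^esub>) = \<phi> (F.cj ((B \<otimes>\<^bsub>F\<^esub> T) [^]\<^bsub>F\<^esub> k) X)"
    by (rule obtain_window_word[OF B F.one_closed, rotated]) (auto simp: \<phi>_one permutes_id)
  note c = carrier WZ AF_carrier[OF Y(1)] AF_carrier[OF Y(2)] AF_carrier[OF B(1)] AF_carrier[OF X(1)]
  let ?C = "F.cj ((B \<otimes>\<^bsub>F\<^esub> T) [^]\<^bsub>F\<^esub> k) X"
  let ?R = "{U [^]\<^bsub>F\<^esub> p, (U \<otimes>\<^bsub>F\<^esub> T) \<otimes>\<^bsub>F\<^esub> inv\<^bsub>F\<^esub> (T \<otimes>\<^bsub>F\<^esub> U),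
    Z \<otimes>\<^bsub>F\<^esub> Z \<otimes>\<^bsub>F\<^esub> Z, Z \<otimes>\<^bsub>F\<^esub> F.cj U Z \<otimes>\<^bsub>F\<^esub> Z \<otimes>\<^bsub>F\<^esub> F.cj U Z,
    F.cj T Y \<otimes>\<^bsub>F\<^esub> inv\<^bsub>F\<^esub> Y', T \<otimes>\<^bsub>F\<^esub> inv\<^bsub>F\<^esub> ?C, W \<otimes>\<^bsub>F\<^esub> inv\<^bsub>F\<^esub> (U \<otimes>\<^bsub>F\<^esub> T)}"
  have \<phi>n: "\<phi> \<in> hom F (sym_group n)" using \<phi> by (simp add: v)
  have "few_cosets F \<phi> {W, Z} ?R (card (Alt {1..n}))"
  proof (rule few_cosetsI[OF F \<phi>n])
    fix H' :: "'f set monoid" and q f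
    assume H': "group H'" "q \<in> hom F H'" "f \<in> hom H' (sym_group n)" "\<And>x. x \<in> carrier F \<Longrightarrow> f (q x) = \<phi> x"
      and rel: "\<And>x. x \<in> ?R \<Longrightarrow> q x = \<one>\<^bsub>H'\<^esub>" and gen: "carrier H' = generate H' (q ` {W, Z})"
    interpret H: group H' by fact
    interpret q: group_hom F H' q using H' F by (intro group_hom.intro group_hom_axioms.intro)
    have qc: "q x \<in> carrier H'" if "x \<in> carrier F" for x using that by (rule q.hom_closed)
    have "q (U [^]\<^bsub>F\<^esub> p) = \<one>\<^bsub>H'\<^esub>" by (rule rel) simp
    then have up: "q U [^]\<^bsub>H'\<^esub> p = \<one>\<^bsub>H'\<^esub>" using c by (simp add: q.hom_nat_pow)
    have "q (U \<otimes>\<^bsub>F\<^esub> T) = q (T \<otimes>\<^bsub>F\<^esub> U)"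
      by (rule q.hom_relatorD[OF rel]) (use c in simp_all)
    then have ut: "q U \<otimes>\<^bsub>H'\<^esub> q T = q T \<otimes>\<^bsub>H'\<^esub> q U" using c by simp
    have "q (Z \<otimes>\<^bsub>F\<^esub> Z \<otimes>\<^bsub>F\<^esub> Z) = \<one>\<^bsub>H'\<^esub>" by (rule rel) simp
    then have zzz: "q Z \<otimes>\<^bsub>H'\<^esub> q Z \<otimes>\<^bsub>H'\<^esub> q Z = \<one>\<^bsub>H'\<^esub>" using c by simp
    have "q (Z \<otimes>\<^bsub>F\<^esub> F.cj U Z \<otimes>\<^bsub>F\<^esub> Z \<otimes>\<^bsub>F\<^esub> F.cj U Z) = \<one>\<^bsub>H'\<^esub>" by (rule rel) simp
    then have pair: "q Z \<otimes>\<^bsub>H'\<^esub> H.cj (q U) (q Z) \<otimes>\<^bsub>H'\<^esub> q Z \<otimes>\<^bsub>H'\<^esub> H.cj (q U) (q Z) = \<one>\<^bsub>H'\<^esub>"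
      using c by (simp add: q.hom_cj)
    have "q (F.cj T Y) = q Y'"
      by (rule q.hom_relatorD[OF rel]) (use c in simp_all)
    then have ty: "H.cj (q T) (q Y) = q Y'" using c by (simp add: q.hom_cj)
    have "q T = q ?C" by (rule q.hom_relatorD[OF rel]) (use c in simp_all)
    then have tC: "q T \<otimes>\<^bsub>H'\<^esub> \<one>\<^bsub>H'\<^esub> = H.cj ((q B \<otimes>\<^bsub>H'\<^esub> q T) [^]\<^bsub>H'\<^esub> k) (q X)"
      using c by (simp add: q.hom_cj q.hom_nat_pow)
    have "q W = q (U \<otimes>\<^bsub>F\<^esub> T)" by (rule q.hom_relatorD[OF rel]) (use c in simp_all)
    then have gen': "carrier H' = generate H' {q U \<otimes>\<^bsub>H'\<^esub> q T, q Z}" using gen c by simp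
    have pairs: "q Z \<otimes>\<^bsub>H'\<^esub> H.cj (q U [^]\<^bsub>H'\<^esub> j) (q Z) \<otimes>\<^bsub>H'\<^esub> q Z \<otimes>\<^bsub>H'\<^esub>
        H.cj (q U [^]\<^bsub>H'\<^esub> j) (q Z) = \<one>\<^bsub>H'\<^esub>" if "0 < j" "j < p" for j
    proof -
      let ?z = "H.cj (q U [^]\<^bsub>H'\<^esub> (2::nat)) (q Z)"
      have "q U [^]\<^bsub>H'\<^esub> (2::nat) \<otimes>\<^bsub>H'\<^esub> q U = \<one>\<^bsub>H'\<^esub>" using up by (simp add: v numeral_eq_Suc)
      then have u2: "H.cj (q U [^]\<^bsub>H'\<^esub> (2::nat)) (H.cj (q U) (q Z)) = q Z" using c qc by (simp add: H.cj_cj)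
      have "H.cj (q U [^]\<^bsub>H'\<^esub> (2::nat)) (q Z \<otimes>\<^bsub>H'\<^esub> H.cj (q U) (q Z) \<otimes>\<^bsub>H'\<^esub> q Z \<otimes>\<^bsub>H'\<^esub> H.cj (q U) (q Z)) = \<one>\<^bsub>H'\<^esub>"
        unfolding pair using c qc by simp
      then have "?z \<otimes>\<^bsub>H'\<^esub> q Z \<otimes>\<^bsub>H'\<^esub> ?z \<otimes>\<^bsub>H'\<^esub> q Z = \<one>\<^bsub>H'\<^esub>"
        using c qc u2 by (simp add: H.cj_mult)
      then have two: "q Z \<otimes>\<^bsub>H'\<^esub> ?z \<otimes>\<^bsub>H'\<^esub> q Z \<otimes>\<^bsub>H'\<^esub> ?z = \<one>\<^bsub>H'\<^esub>"
        by (rule H.pair_swap(1)[rotated 2]) (use c qc in simp_all)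
      have "j = 1 \<or> j = 2" using that by (auto simp: v)
      then show ?thesis using two pair c qc by auto
    qed
    have base: "alternating_base H' n p k M f (q U) (q T) (q Z) (q Y)"
      by (rule base_in_quotient[OF H' Y(1,3,2) up ut zzz pairs ty])
    interpret alternating_extension H' n p k M f "q U" "q T" "q Z" "q Y"
        "generate H' ((\<lambda>j. H.cj (q U [^]\<^bsub>H'\<^esub> j) (q Z)) ` {..<p})" "q B" "q X" "\<one>\<^bsub>H'\<^esub>"
      by (rule extension_in_quotient[OF H' base B X(1) H.one_closed tC]) (use qc c AF_carrier in auto)
    interpret N: normal N H' by (rule normal_N[OF gen'])
    have "q U \<in> N"
    proof -
      have "q U \<in> q ` generate F ?V" using UT(1) by (rule imageI)
      also have "\<dots> = generate H' (q ` ?V)" by (rule q.generate_img[OF VF, symmetric])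
      also have "\<dots> \<subseteq> N"
      proof (rule H.generate_subgroup_incl[OF _ N_subgroup])
        have "q (F.cj (W [^]\<^bsub>F\<^esub> (i::nat)) Z) \<in> N" for i
          using N.inv_op_closed2[OF qc[of "W [^]\<^bsub>F\<^esub> i"] z_N] c by (simp add: q.hom_cj H.cj_def)
        then show "q ` ?V \<subseteq> N" by blast
      qed
      finally show ?thesis .
    qed
    then have "finite (carrier H') \<and> 2 * card (carrier H') \<le> fact n" by (rule carrier_bound_even[OF gen' _ refl])
    moreover have "2 * card (Alt {1..n}) = fact n" using card_Alt[of "{1..n}"] by (simp add: v)
    ultimately show "finite (carrier H') \<and> card (carrier H') \<le> card (Alt {1..n})" by linarith
  qed (use WZ in auto)
  moreover have "\<phi> x = id" if "x \<in> ?R" for x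
  proof -
    have "cyc 1 p ^^ p = id" using cyc_funpow_length[of 1 p] p3 by simp
    then have "\<phi> (U [^]\<^bsub>F\<^esub> p) = id" using c by (simp add: \<phi>_pow \<phi>U)
    moreover have "\<phi> T = \<phi> ?C" using X(2) c by simp
    moreover have "\<phi> W = \<phi> (U \<otimes>\<^bsub>F\<^esub> T)" using c by (simp add: \<phi>_mult \<phi>W UT)
    moreover have "?C \<in> carrier F" using c by simp
    ultimately show ?thesis
      using that c \<phi>_cube \<phi>_commute \<phi>_pair Y(4) by (elim insertE emptyE) (simp_all add: \<phi>_relator)
  qed
  moreover have "?R \<subseteq> carrier F" using c by simp
  ultimately show "\<exists>R \<subseteq> carrier F. finite R \<and> card R \<le> 7 \<and> (\<forall>x \<in> R. \<phi> x = id) \<and> few_cosets F \<phi> {W, Z} R (card (Alt {1..6}))"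
    unfolding v(1) using card_le_7 by (intro exI[of _ ?R] conjI ballI) auto
qed

section \<open>Generating pairs\<close>

lemma Alt_subset_if_generators:
  assumes K: "subgroup K (sym_group n)" and p: "prime p" "odd p" and n: "p + 2 \<le> n"
    and M: "M = n - 1 \<or> M = n" "M < 2 * p"
    and w: "cyc 1 p \<circ> cyc (p + 1) M \<in> K" and z: "tri (p + 1) n p \<in> K"
  shows "Alt {1..n} \<subseteq> K"
proof -
  note D = subgroup_sym_groupD[OF K]
  have "p < M" using M n by auto
  then obtain \<alpha> \<beta> where "cycle_powers p M \<alpha> \<beta>" by (rule obtain_cycle_powers[OF p(1) _ M(2)])
  then interpret cp: cycle_powers p M \<alpha> \<beta> .
  have pow: "(cyc 1 p \<circ> cyc (p + 1) M) ^^ i \<in> K" for i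
    by (induction i) (simp_all only: funpow.simps D(1) D(2)[OF w])
  have "cyc 1 p \<in> K" "cyc (p + 1) M \<in> K" using pow[of \<alpha>] pow[of \<beta>] unfolding cp.cycle_power .
  then show ?thesis
    using odd_prime_ge_3[OF p] n M(1) z by (intro Alt_subset_conj_closed[OF K]) (auto intro: D(2,3))
qed

lemma subgroup_alt_group_imp_sym_group: "subgroup K (alt_group n) \<Longrightarrow> subgroup K (sym_group n)"
  using group.incl_subgroup[OF sym_group_is_group alt_group_is_subgroup[of n], of K]
  by (simp add: alt_group_def)

lemma carrier_alt_group: "carrier (alt_group n) = Alt {1..n}"
  by (auto simp: alt_group_carrier Alt_def)

lemma carrier_sym_group: "carrier (sym_group n) = {\<sigma>. \<sigma> permutes {1..n}}"
  by (auto simp: sym_group_carrier)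

definition seven_relator_pair :: "'f monoid \<Rightarrow> nat \<Rightarrow> (nat \<Rightarrow> nat) monoid \<Rightarrow> (nat \<Rightarrow> nat) \<Rightarrow> (nat \<Rightarrow> nat) \<Rightarrow> bool"
  where "seven_relator_pair F n G w z \<longleftrightarrow> w \<in> carrier G \<and> z \<in> carrier G \<and>
    generate G {w, z} = carrier G \<and> seven_relators F n (carrier G) w z"

lemma alt_group_pair:
  assumes n: "n \<ge> 5" and F: "group F"
  shows "\<exists>w z. seven_relator_pair F n (alt_group n) w z"
proof (cases "n = 6")
  case True
  let ?w = "cyc 1 3 \<circ> cyc 4 6" and ?z = "tri 4 6 3"
  interpret G: group "alt_group 6" by (rule alt_group_is_group)
  have "cyc 1 3 \<in> Alt {1..6}" "cyc 4 6 \<in> Alt {1..6}"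
    using evenperm_cyc[of 1 3] evenperm_cyc[of 4 6]
    by (auto simp: Alt_def intro: permutes_subset[OF cyc_permutes])
  then have w: "?w \<in> carrier (alt_group 6)" by (simp add: carrier_alt_group Alt_comp)
  have z: "?z \<in> carrier (alt_group 6)" by (simp add: carrier_alt_group tri_in_Alt)
  let ?K = "generate (alt_group 6) {?w, ?z}"
  have K: "subgroup ?K (sym_group 6)"
    using w z by (intro subgroup_alt_group_imp_sym_group G.generate_is_subgroup) auto
  have wK: "?w \<in> ?K" and zK: "?z \<in> ?K" by (auto intro: generate.incl)
  have wp: "?w permutes {1..6}" using w by (simp add: carrier_alt_group Alt_def)
  have conj: "tri (?w a) (?w b) (?w c) \<in> ?K" if "tri a b c \<in> ?K" for a b c
    using subgroup_sym_groupD(2,3)[OF K] wK that tri_conj_inv[OF wp, of a b c] by metis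
  have "tri 5 4 1 \<in> ?K" using conj[OF zK] by (simp add: cyc_def)
  moreover from conj[OF this] have "tri 6 5 2 \<in> ?K" by (simp add: cyc_def numeral_2_eq_2)
  ultimately have "Alt {1..6} \<subseteq> ?K" by (rule Alt_6_subset_subgroup[OF K zK])
  moreover have "?K \<subseteq> carrier (alt_group 6)" using w z by (intro G.generate_incl) auto
  ultimately have "?K = carrier (alt_group 6)" by (simp add: carrier_alt_group)
  moreover have "seven_relators F 6 (carrier (alt_group 6)) ?w ?z"
    unfolding carrier_alt_group by (rule seven_relators_6[OF F])
  ultimately show ?thesis using w z True unfolding seven_relator_pair_def by blast
next
  case False
  then obtain p where p: "prime p" "odd p" "p + 2 \<le> n" "n < 2 * p"
    using obtain_prime_for_degree n by metis
  \<comment> \<open>Exactly one of \<open>n\<close> and \<open>n - 1\<close> makes the second cycle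
    even, and either is below \<open>2 * p\<close>.\<close>
  define M where "M = (if even (n - (p + 1)) then n else n - 1)"
  have M: "M = n - 1 \<or> M = n" "M < 2 * p" "even (M - (p + 1))" using p by (auto simp: M_def)
  let ?w = "cyc 1 p \<circ> cyc (p + 1) M" and ?z = "tri (p + 1) n p"
  interpret G: group "alt_group n" by (rule alt_group_is_group)
  have "1 \<le> p" "p + 1 \<le> M" "M \<le> n" using p M(1) prime_ge_1_nat[OF p(1)] by auto
  then have "cyc 1 p \<in> Alt {1..n}" "cyc (p + 1) M \<in> Alt {1..n}"
    using p(2,3) M(3) evenperm_cyc[of 1 p] evenperm_cyc[of "p + 1" M]
    by (auto simp: Alt_def intro: permutes_subset[OF cyc_permutes])
  then have w: "?w \<in> carrier (alt_group n)" by (simp add: carrier_alt_group Alt_comp)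
  have z: "?z \<in> carrier (alt_group n)"
    unfolding carrier_alt_group using p(3) \<open>1 \<le> p\<close> by (intro tri_in_Alt) auto
  let ?K = "generate (alt_group n) {?w, ?z}"
  have "Alt {1..n} \<subseteq> ?K"
    using w z
    by (intro Alt_subset_if_generators[OF _ p(1-3) M(1,2)] subgroup_alt_group_imp_sym_group
        G.generate_is_subgroup generate.incl) auto
  moreover have "?K \<subseteq> carrier (alt_group n)" using w z by (intro G.generate_incl) auto
  ultimately have "?K = carrier (alt_group n)" by (simp add: carrier_alt_group)
  moreover have "seven_relators F n (carrier (alt_group n)) ?w ?z"
    unfolding carrier_alt_group by (rule seven_relators_even[OF F p(1-3) M])
  ultimately show ?thesis using w z unfolding seven_relator_pair_def by blast
qed

lemma sym_group_pair:
  assumes n: "n \<ge> 5" and F: "group F"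
  shows "\<exists>w z. seven_relator_pair F n (sym_group n) w z"
proof -
  have "\<exists>p M. prime p \<and> odd p \<and> p + 2 \<le> n \<and> n \<le> 2 * p \<and> (M = n - 1 \<or> M = n) \<and> M < 2 * p \<and> odd (M - (p + 1))"
  proof (cases "n = 6")
    case True
    \<comment> \<open>With \<open>M = 5\<close> the cycles have the coprime lengths 3 and 2, so
      degree 6 fits the general pattern here; it is the reason for asking
      \<open>n \<le> 2 * p\<close> instead of \<open>n < 2 * p\<close>.\<close>
    then show ?thesis by (intro exI[of _ 3] exI[of _ 5]) auto
  next
    case False
    then obtain p where p: "prime p" "odd p" "p + 2 \<le> n" "n < 2 * p"
      using obtain_prime_for_degree n by metis
    then show ?thesis
      by (intro exI[of _ p] exI[of _ "if odd (n - (p + 1)) then n else n - 1"]) auto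
  qed
  then obtain p M where p: "prime p" "odd p" "p + 2 \<le> n" "n \<le> 2 * p"
    and M: "M = n - 1 \<or> M = n" "M < 2 * p" "odd (M - (p + 1))" by blast
  let ?w = "cyc 1 p \<circ> cyc (p + 1) M" and ?z = "tri (p + 1) n p"
  interpret G: group "sym_group n" by (rule sym_group_is_group)
  have b: "1 \<le> p" "p + 1 \<le> M" "M \<le> n" using p M(1) prime_ge_1_nat[OF p(1)] by auto
  then have c: "cyc 1 p permutes {1..n}" "cyc (p + 1) M permutes {1..n}"
    using p(3) by (auto intro: permutes_subset[OF cyc_permutes])
  then have wp: "?w permutes {1..n}" by (intro permutes_compose)
  then have w: "?w \<in> carrier (sym_group n)" by (simp add: carrier_sym_group)
  have "?z \<in> Alt {1..n}" using p(3) b by (intro tri_in_Alt) auto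
  then have z: "?z \<in> carrier (sym_group n)" by (simp add: carrier_sym_group Alt_def)
  have odd: "\<not> evenperm ?w"
    using p(2) M(3) b evenperm_cyc[of 1 p] evenperm_cyc[of "p + 1" M] c permutes_imp_permutation[of "{1..n}"]
    by (subst evenperm_comp) auto
  let ?K = "generate (sym_group n) {?w, ?z}"
  have K: "subgroup ?K (sym_group n)" using w z by (intro G.generate_is_subgroup) auto
  have wK: "?w \<in> ?K" by (simp add: generate.incl)
  have A: "Alt {1..n} \<subseteq> ?K"
    by (intro Alt_subset_if_generators[OF K p(1-3) M(1,2)] generate.incl) auto
  have "\<sigma> \<in> ?K" if \<sigma>: "\<sigma> permutes {1..n}" for \<sigma>
  proof (cases "evenperm \<sigma>")
    case True
    then show ?thesis using A \<sigma> by (auto simp: Alt_def)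
  next
    case False
    have "inv' ?w \<circ> \<sigma> \<in> Alt {1..n}"
      using \<sigma> wp False odd permutes_imp_permutation[of "{1..n}"]
      by (auto simp: Alt_def evenperm_comp evenperm_inv permutation_inverse intro!: permutes_compose permutes_inv)
    then have "inv' ?w \<circ> \<sigma> \<in> ?K" using A by blast
    then have "?w \<circ> (inv' ?w \<circ> \<sigma>) \<in> ?K" by (rule subgroup_sym_groupD(2)[OF K wK])
    moreover have "?w \<circ> (inv' ?w \<circ> \<sigma>) = \<sigma>" by (simp only: comp_assoc[symmetric] permutes_inv_o[OF wp] id_comp)
    ultimately show ?thesis by simp
  qed
  then have "carrier (sym_group n) \<subseteq> ?K" by (auto simp: carrier_sym_group)
  moreover have "?K \<subseteq> carrier (sym_group n)" using w z by (intro G.generate_incl) auto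
  ultimately have "?K = carrier (sym_group n)" by blast
  moreover have "seven_relators F n (carrier (sym_group n)) ?w ?z"
    unfolding carrier_sym_group by (rule seven_relators_odd[OF F p M])
  ultimately show ?thesis using w z unfolding seven_relator_pair_def by blast
qed

text \<open>The set \<open>Q\<close> holds the relators that make \<open>W\<close> and
  \<open>Z\<close> generate the quotient. Joined to the seven they give few cosets, and the rest up
  to \<open>m\<close> is padding.\<close>

lemma presentation_from_seven_relators:
  fixes X :: "'x set" and n :: nat
  defines "F \<equiv> free_group X"
  assumes G: "G = alt_group n \<or> G = sym_group n"
    and f: "f ` X \<subseteq> carrier G" "X \<noteq> {}" "generate G (f ` X) = carrier G"
    and WZ: "W \<in> carrier F" "Z \<in> carrier F"
    and seven: "seven_relators F n (carrier G) (eval_word G f W) (eval_word G f Z)"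
    and Q: "Q \<subseteq> kernel F G (eval_word G f)" "finite Q" "7 + card Q \<le> m"
    and gen: "\<And>N. N \<lhd> F \<Longrightarrow> Q \<subseteq> N \<Longrightarrow> generate F ({W, Z} \<union> N) = carrier F"
  shows "\<exists>R. card R = m \<and> is_presentation_via G X R f"
proof -
  let ?\<phi> = "eval_word G f"
  have grp: "group G" using G sym_group_is_group alt_group_is_group by auto
  then interpret G: group G .
  have fin: "finite (carrier G)"
    using G finite_permutations[of "{1..n}"] by (auto simp: carrier_sym_group carrier_alt_group Alt_def)
  have F: "group F" unfolding F_def by (rule group_free_group)
  then interpret F: group F .
  have \<phi>G: "?\<phi> \<in> hom F G" unfolding F_def by (rule G.eval_word_hom[OF f(1)])
  interpret \<phi>: group_hom F G ?\<phi> using \<phi>G by unfold_locales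
  have "carrier G \<subseteq> carrier (sym_group n)" "mult G = mult (sym_group n)"
    using G by (auto simp: alt_group_def carrier_sym_group)
  then have \<phi>: "?\<phi> \<in> hom F (sym_group n)"
    using \<phi>G by (simp add: hom_def Pi_iff subset_iff)
  obtain R where R: "R \<subseteq> carrier F" "finite R" "card R \<le> 7" "\<forall>x \<in> R. ?\<phi> x = id"
    and few: "few_cosets F ?\<phi> {W, Z} R (card (carrier G))"
    using seven \<phi> WZ unfolding seven_relators_def by blast
  have one: "\<one>\<^bsub>G\<^esub> = id" using G by (auto simp: sym_group_one alt_group_one)
  have ker: "R \<union> Q \<subseteq> kernel F G ?\<phi>" using R Q by (auto simp: kernel_def one)
  let ?N = "normal_closure F (R \<union> Q)"
  have "R \<union> Q \<subseteq> carrier F" using ker by (auto simp: kernel_def)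
  then have N: "?N \<lhd> F" by (rule F.normal_normal_closure)
  have "?N \<subseteq> kernel F G ?\<phi>" using \<phi>.normal_kernel ker by (rule normal_closure_subset)
  then have "\<forall>x \<in> ?N. ?\<phi> x = id" by (auto simp: kernel_def one)
  moreover have RQ: "R \<union> Q \<subseteq> ?N" by (rule subset_normal_closure)
  moreover from RQ have "generate F ({W, Z} \<union> ?N) = carrier F" by (intro gen N) auto
  ultimately have "finite (rcosets\<^bsub>F\<^esub> ?N) \<and> card (rcosets\<^bsub>F\<^esub> ?N) \<le> card (carrier G)"
    using few N unfolding few_cosets_def by auto
  moreover have "card (R \<union> Q) \<le> m" using card_Un_le[of R Q] R Q by linarith
  ultimately show ?thesis
    using ker R Q unfolding F_def
    by (intro presentation_via_if_few_cosets[OF grp fin f(1,2,3), of "R \<union> Q"]) auto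
qed

theorem corollary3p40:
  fixes n :: nat and G :: "(nat \<Rightarrow> nat) monoid"
  assumes "n \<ge> 5"
    and "G = alt_group n \<or> G = sym_group n"
  shows "(\<forall>a \<in> carrier G. \<forall>b \<in> carrier G. generate G {a, b} = carrier G \<longrightarrow>
           (\<exists>(x :: nat) y R f. x \<noteq> y \<and> card R = 9 \<and> f x = a \<and> f y = b \<and>
              is_presentation_via G {x, y} R f)) \<and>
         (\<exists>(X :: nat set) R. card X = 2 \<and> card R = 8 \<and> is_presentation G X R)"
proof -
  let ?X = "{0, 1 :: nat}"
  let ?F = "free_group ?X"
  let ?f = "\<lambda>(a :: nat \<Rightarrow> nat) b (x :: nat). if x = 0 then a else b"
  let ?x = "[(0 :: nat, True)]" and ?y = "[(1 :: nat, True)]"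
  have F: "group ?F" by (rule group_free_group)
  then interpret F: group ?F .
  have grp: "group G" using assms(2) sym_group_is_group alt_group_is_group by auto
  then interpret G: group G .
  have letters: "?x \<in> carrier ?F" "?y \<in> carrier ?F" by (auto intro: generator_in_free_group)
  have letters_gen: "generate ?F {?x, ?y} = carrier ?F" using generate_free_group[of ?X] by simp
  have letters_gen': "generate ?F ({W, Z} \<union> N) = carrier ?F"
    if "{W, Z} \<union> N \<subseteq> carrier ?F" "{?x, ?y} \<subseteq> generate ?F ({W, Z} \<union> N)" for W Z N
    using F.generate_subgroup_incl[OF that(2) F.generate_is_subgroup[OF that(1)]]
      F.generate_incl[OF that(1)] letters_gen by blast
  obtain w z where "seven_relator_pair ?F n G w z"
    using assms alt_group_pair[OF _ F] sym_group_pair[OF _ F] by blast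
  then have wz: "w \<in> carrier G" "z \<in> carrier G" "generate G {w, z} = carrier G"
    and seven: "seven_relators ?F n (carrier G) w z" by (auto simp: seven_relator_pair_def)
  have eval: "eval_word G (?f a b) ?x = a" "eval_word G (?f a b) ?y = b"
    if "a \<in> carrier G" "b \<in> carrier G" for a b
    using that by (simp_all add: eval_letter_def)
  show ?thesis
  proof (intro conjI ballI impI)
    fix a b assume ab: "a \<in> carrier G" "b \<in> carrier G" "generate G {a, b} = carrier G"
    let ?\<phi> = "eval_word G (?f a b)"
    have fX: "?f a b ` ?X \<subseteq> carrier G" using ab(1,2) by simp
    have fgen: "generate G (?f a b ` ?X) = carrier G" using ab(3) by (simp add: insert_commute)
    have \<phi>: "?\<phi> \<in> hom ?F G" using fX by (rule G.eval_word_hom)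
    interpret \<phi>: group_hom ?F G ?\<phi> using \<phi> by unfold_locales
    have img: "generate G {?\<phi> V, ?\<phi> V'} = ?\<phi> ` generate ?F {V, V'}"
      if "V \<in> carrier ?F" "V' \<in> carrier ?F" for V V'
      using \<phi>.generate_img[of "{V, V'}"] that by (simp only: image_insert image_empty empty_subsetI insert_subset)
    have surj: "carrier G = ?\<phi> ` carrier ?F"
      using img[OF letters] unfolding eval[OF ab(1,2)] ab(3) letters_gen .
    obtain W where W: "W \<in> carrier ?F" "w = ?\<phi> W" using wz(1) unfolding surj by (rule imageE)
    obtain Z where Z: "Z \<in> carrier ?F" "z = ?\<phi> Z" using wz(2) unfolding surj by (rule imageE)
    note WZ = W(1) Z(1) W(2)[symmetric] Z(2)[symmetric]
    have surj': "carrier G = ?\<phi> ` generate ?F {W, Z}"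
      using img[OF WZ(1,2)] unfolding WZ(3,4) wz(3) .
    obtain A where A: "A \<in> generate ?F {W, Z}" "a = ?\<phi> A" using ab(1) unfolding surj' by (rule imageE)
    obtain B where B: "B \<in> generate ?F {W, Z}" "b = ?\<phi> B" using ab(2) unfolding surj' by (rule imageE)
    note AB = A(1) B(1) A(2)[symmetric] B(2)[symmetric]
    have WZs: "{W, Z} \<subseteq> carrier ?F" using WZ(1,2) by simp
    note ABc = F.generate_in_carrier[OF WZs AB(1)] F.generate_in_carrier[OF WZs AB(2)]
    \<comment> \<open>Modulo these two relators the free generators equal the words \<open>A\<close>
      and \<open>B\<close> in \<open>W\<close> and \<open>Z\<close>, so \<open>W\<close> and
      \<open>Z\<close> generate the quotient. This accounts for 7 + 2 = 9.\<close>
    let ?Q = "{inv\<^bsub>?F\<^esub> A \<otimes>\<^bsub>?F\<^esub> ?x, inv\<^bsub>?F\<^esub> B \<otimes>\<^bsub>?F\<^esub> ?y}"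
    have "\<exists>R. card R = 9 \<and> is_presentation_via G ?X R (?f a b)"
    proof (rule presentation_from_seven_relators[OF assms(2) fX _ fgen WZ(1,2), of ?Q])
      show "seven_relators ?F n (carrier G) (?\<phi> W) (?\<phi> Z)" using seven WZ by simp
      show "?Q \<subseteq> kernel ?F G ?\<phi>"
        using ab(1,2) AB(3,4) ABc letters eval[OF ab(1,2)] by (simp add: kernel_def del: eval_word_simps One_nat_def)
      show "7 + card ?Q \<le> 9" using card_insert_le_m1[of 2 "{inv\<^bsub>?F\<^esub> B \<otimes>\<^bsub>?F\<^esub> ?y}"] by simp
      fix N assume N: "N \<lhd> ?F" "?Q \<subseteq> N"
      have sub: "{W, Z} \<union> N \<subseteq> carrier ?F"
        using WZs subgroup.subset[OF normal_imp_subgroup[OF N(1)]] by simp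
      have mono: "generate ?F {W, Z} \<subseteq> generate ?F ({W, Z} \<union> N)" by (rule F.mono_generate) auto
      have letter: "l \<in> generate ?F ({W, Z} \<union> N)"
        if "l \<in> carrier ?F" "D \<in> generate ?F {W, Z}" "D \<in> carrier ?F" "inv\<^bsub>?F\<^esub> D \<otimes>\<^bsub>?F\<^esub> l \<in> N" for l D
      proof -
        have "D \<otimes>\<^bsub>?F\<^esub> (inv\<^bsub>?F\<^esub> D \<otimes>\<^bsub>?F\<^esub> l) \<in> generate ?F ({W, Z} \<union> N)"
          using subsetD[OF mono that(2)] by (rule generate.eng) (intro generate.incl UnI2 that(4))
        then show ?thesis using that by (simp add: F.m_assoc[symmetric] del: One_nat_def)
      qed
      show "generate ?F ({W, Z} \<union> N) = carrier ?F"
        using letter[OF letters(1) AB(1) ABc(1)] letter[OF letters(2) AB(2) ABc(2)] N(2)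
        by (intro letters_gen' sub) (simp del: One_nat_def)
    qed auto
    then obtain R where R: "card R = 9" "is_presentation_via G ?X R (?f a b)" by blast
    show "\<exists>(x :: nat) y R f. x \<noteq> y \<and> card R = 9 \<and> f x = a \<and> f y = b \<and> is_presentation_via G {x, y} R f"
      by (rule exI[of _ 0], rule exI[of _ 1], rule exI[of _ R], rule exI[of _ "?f a b"]) (use R in simp)
  next
    have fX: "?f w z ` ?X \<subseteq> carrier G" using wz(1,2) by simp
    have fgen: "generate G (?f w z ` ?X) = carrier G" using wz(3) by (simp add: insert_commute)
    \<comment> \<open>The free generators themselves are sent to \<open>w\<close> and
      \<open>z\<close>, so \<open>Q\<close> is empty and the step from 7 to 8 is pure
      padding.\<close>
    have "\<exists>R. card R = 8 \<and> is_presentation_via G ?X R (?f w z)"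
    proof (rule presentation_from_seven_relators[OF assms(2) fX _ fgen letters, of "{}"])
      show "seven_relators ?F n (carrier G) (eval_word G (?f w z) ?x) (eval_word G (?f w z) ?y)"
        using seven eval[OF wz(1,2)] by (simp del: eval_word_simps)
      fix N assume N: "N \<lhd> ?F"
      have sub: "{?x, ?y} \<union> N \<subseteq> carrier ?F"
        using letters subgroup.subset[OF normal_imp_subgroup[OF N]] by (simp del: One_nat_def)
      show "generate ?F ({?x, ?y} \<union> N) = carrier ?F"
        by (intro letters_gen' sub) (simp add: generate.incl)
    qed auto
    then obtain R where "card R = 8" "is_presentation_via G ?X R (?f w z)" by blast
    then show "\<exists>(X :: nat set) R. card X = 2 \<and> card R = 8 \<and> is_presentation G X R"
      by (intro exI[of _ ?X] exI[of _ R]) (auto simp: is_presentation_via_def is_presentation_def is_iso_def)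
  qed
qed

end
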